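(* Let $\varepsilon\in(0,1]$, $\mathrm{bo}>0$ and $0<\mu<1$ with $\tfrac{\sqrt\mu}{\mathrm{bo}}-\tfrac{\mu}{3}>0$, and let $\zeta_0\in\mathbb{A}^0_0$ be a real-valued zero-mean function with $$|\zeta_0|_{0,0}<\frac{\frac{\sqrt\mu}{\mathrm{bo}}-\frac{\mu}{3}}{128\varepsilon\left(\frac{\sqrt\mu}{\mathrm{bo}}+\frac{55}{6}\mu+1\right)}.$$ Then there exists a global weak solution $\zeta$ (on $[0,T]$ for every $T>0$) of the stable refined thin film equation $$\partial_t\zeta+\partial_x\left((1+\varepsilon\zeta)(-\partial_x\zeta+\tfrac{\sqrt\mu}{\mathrm{bo}}\partial_x^3\zeta)\right)-\tfrac{\mu}{3}\partial_x^2\left((1+\varepsilon\zeta)^3\partial_x^2\zeta\right)=0$$ with initial datum $\zeta_0$, which becomes instantaneously analytic in a growing strip of the complex plane. More precisely, for every $\nu\in\left[0,\tfrac12(\tfrac{\sqrt\mu}{\mathrm{bo}}-\tfrac{\mu}{3})\right)$ and $T>0$, $\zeta\in L^\infty([0,T];\mathbb{A}^0_{\nu t})\cap L^1([0,T];\mathbb{A}^4_{\nu t})$ and for all $t\in[0,T]$ $$|\zeta(t)|_{0,\nu t}+\tfrac{1}{64}\left(\tfrac{\sqrt\mu}{\mathrm{bo}}-\tfrac{\mu}{3}\right)\int_0^t|\zeta(t')|_{4,\nu t'}dt'\leq|\zeta_0|_{0,0},\qquad|\zeta(t)|_{0,\nu t}\leq|\zeta_0|_{0,0}\,e^{-\f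rac{t}{64}\left(\frac{\sqrt\mu}{\mathrm{bo}}-\frac{\mu}{3}\right)}.$$
   Context: $\mathbb{T}=\mathbb{R}/2\pi\mathbb{Z}$; $\widehat g(n)=\frac1{2\pi}\int_{\mathbb{T}}ge^{-inx}dx$; $|g|_{s,\lambda}=\sum_n(1+|n|)^se^{\lambda|n|}|\widehat g(n)|$, $\mathbb{A}^s_\lambda$ the space of $g$ with finite norm. The membership $\zeta\in L^\infty([0,T];\mathbb{A}^0_{\nu t})\cap L^1([0,T];\mathbb{A}^4_{\nu t})$ means $\sup_{t\in[0,T]}|\zeta(t)|_{0,\nu t}<\infty$ and $\int_0^T|\zeta(t)|_{4,\nu t}dt<\infty$. Weak solution: $\zeta\in L^\infty([0,T],L^\infty(\mathbb{T}))\cap L^1([0,T],W^{3,\infty}(\mathbb{T}))$ such that for every $\varphi\in C^\infty([0,T]\times\mathbb{T})$ and $t\in[0,T]$: $\int\zeta(t)\varphi(t)-\int\zeta_0\varphi(0)-\int_0^t\!\int\zeta\partial_t\varphi=-\int_0^t\!\int(1+\varepsilon\zeta)\partial_x\zeta\partial_x\varphi+\frac{\sqrt\mu}{\mathrm{bo}}\int_0^t\!\int(1+\varepsilon\zeta)\partial_x^3\zeta\partial_x\varphi+\frac\mu3\int_0^t\!\int(1+\varepsilon\zeta)^3\partial_x^2\zeta\partial_x^2\varphi$. *)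

theory Defs
  imports "HOL-Analysis.Analysis"
begin

text \<open>Functions on the torus T = R/2piZ are represented as 2pi-periodic functions on R.\<close>

definition tperiodic :: "(real \<Rightarrow> 'a) \<Rightarrow> bool" where
  "tperiodic g \<longleftrightarrow> (\<forall>x. g (x + 2 * pi) = g x)"

definition fourier_coeff :: "(real \<Rightarrow> real) \<Rightarrow> int \<Rightarrow> complex" where
  "fourier_coeff g n = complex_of_real (1 / (2 * pi)) *
     (LINT x|lebesgue_on {0..2*pi}. complex_of_real (g x) * exp (- \<i> * of_int n * complex_of_real x))"

text \<open>The Wiener-type norm |g|_{s,lam} = sum_n (1+|n|)^s e^{lam |n|} |hat g(n)|, valued in
  [0,\<infinity>] (so that g is in A^s_lam iff the norm is finite).\<close>
definition anorm :: "nat \<Rightarrow> real \<Rightarrow> (real \<Rightarrow> real) \<Rightarrow> ennreal" where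
  "anorm s lam g = (\<Sum>\<^sub>\<infinity>n\<in>(UNIV::int set).
     ennreal ((1 + real_of_int \<bar>n\<bar>) ^ s * exp (lam * real_of_int \<bar>n\<bar>) * cmod (fourier_coeff g n)))"

coinductive smooth2 :: "(real \<Rightarrow> real \<Rightarrow> real) \<Rightarrow> bool" where
  "\<lbrakk> \<forall>t x. ((\<lambda>p. f (fst p) (snd p)) has_derivative
                (\<lambda>h. ft t x * fst h + fx t x * snd h)) (at (t, x));
     smooth2 ft; smooth2 fx \<rbrakk> \<Longrightarrow> smooth2 f"

definition test_fun :: "(real \<Rightarrow> real \<Rightarrow> real) \<Rightarrow> bool" where
  "test_fun \<phi> \<longleftrightarrow> smooth2 \<phi> \<and> (\<forall>t. tperiodic (\<phi> t))"

definition pt :: "(real \<Rightarrow> real \<Rightarrow> real) \<Rightarrow> real \<Rightarrow> real \<Rightarrow> real" where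
  "pt \<phi> t x = deriv (\<lambda>s. \<phi> s x) t"

definition px :: "(real \<Rightarrow> real \<Rightarrow> real) \<Rightarrow> real \<Rightarrow> real \<Rightarrow> real" where
  "px \<phi> t x = deriv (\<phi> t) x"

definition pxx :: "(real \<Rightarrow> real \<Rightarrow> real) \<Rightarrow> real \<Rightarrow> real \<Rightarrow> real" where
  "pxx \<phi> t x = deriv (px \<phi> t) x"

abbreviation TT :: "real set" where "TT \<equiv> {0..2*pi}"

text \<open>Weak solution on [0,T] of the stable refined thin film equation with initial datum z0.
  zeta is in L^infty([0,T],L^infty(T)) and in L^1([0,T],W^{3,infty}(T)); the latter is expressed
  through (jointly measurable) spatial derivatives z1 = d_x zeta, z2 = d_x^2 zeta (classical, for a.e. t)
  and z3 = d_x^3 zeta (weak derivative of z2, i.e. z2 absolutely continuous with derivative z3),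
  all bounded by an integrable function B(t).\<close>
definition weak_solution ::
  "real \<Rightarrow> real \<Rightarrow> real \<Rightarrow> (real \<Rightarrow> real) \<Rightarrow> real \<Rightarrow> (real \<Rightarrow> real \<Rightarrow> real) \<Rightarrow> bool" where
  "weak_solution \<epsilon> \<mu> bo z0 T \<zeta> \<longleftrightarrow>
     (\<forall>t. tperiodic (\<zeta> t)) \<and>
     (\<forall>t\<in>{0..T}. integrable (lebesgue_on TT) (\<zeta> t)) \<and>
     (\<exists>M. AE t in lebesgue_on {0..T}. \<forall>x. \<bar>\<zeta> t x\<bar> \<le> M) \<and>
     (\<exists>z1 z2 z3 B.
        (\<lambda>p. \<zeta> (fst p) (snd p)) \<in> borel_measurable borel \<and>
        (\<lambda>p. z1 (fst p) (snd p)) \<in> borel_measurable borel \<and>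
        (\<lambda>p. z2 (fst p) (snd p)) \<in> borel_measurable borel \<and>
        (\<lambda>p. z3 (fst p) (snd p)) \<in> borel_measurable borel \<and>
        integrable (lebesgue_on {0..T}) B \<and>
        (AE t in lebesgue_on {0..T}.
           (\<forall>x. (\<zeta> t has_real_derivative z1 t x) (at x)) \<and>
           (\<forall>x. (z1 t has_real_derivative z2 t x) (at x)) \<and>
           (\<forall>x\<ge>0. (z3 t has_integral (z2 t x - z2 t 0)) {0..x}) \<and>
           (\<forall>x. \<bar>\<zeta> t x\<bar> \<le> B t \<and> \<bar>z1 t x\<bar> \<le> B t \<and> \<bar>z2 t x\<bar> \<le> B t) \<and>
           (AE x in lebesgue. \<bar>z3 t x\<bar> \<le> B t)) \<and>
        (\<forall>\<phi>. test_fun \<phi> \<longrightarrow> (\<forall>t\<in>{0..T}.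
           (LINT x|lebesgue_on TT. \<zeta> t x * \<phi> t x)
           - (LINT x|lebesgue_on TT. z0 x * \<phi> 0 x)
           - (LINT s|lebesgue_on {0..t}. LINT x|lebesgue_on TT. \<zeta> s x * pt \<phi> s x)
           = - (LINT s|lebesgue_on {0..t}. LINT x|lebesgue_on TT.
                   (1 + \<epsilon> * \<zeta> s x) * z1 s x * px \<phi> s x)
             + sqrt \<mu> / bo * (LINT s|lebesgue_on {0..t}. LINT x|lebesgue_on TT.
                   (1 + \<epsilon> * \<zeta> s x) * z3 s x * px \<phi> s x)
             + \<mu> / 3 * (LINT s|lebesgue_on {0..t}. LINT x|lebesgue_on TT.
                   (1 + \<epsilon> * \<zeta> s x) ^ 3 * z2 s x * pxx \<phi> s x))))"

end

theory Submission
  imports Defs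
begin

text \<open>
  Write \<open>\<beta> = sqrt \<mu> / bo\<close>, \<open>m = \<mu> / 3\<close> and \<open>\<delta> = \<beta> - m\<close>. In Fourier variables the equation reads
  \<open>a' = - L a + N a\<close> with \<open>L n = n\<^sup>2 + \<delta> n\<^sup>4\<close> and \<open>N\<close> a sum of convolution terms carrying four
  derivatives in total. With the weights \<open>W t n = exp ((\<delta>/2 \<bar>n\<bar> + \<delta>/64) t)\<close> put
  \<open>S = \<Sum> W \<bar>a\<bar>\<close> and \<open>H = \<Sum> n\<^sup>4 W \<bar>a\<bar>\<close>. Duhamel's formula gains
  \<open>S(t) + \<kappa> \<integral> H\<close> with \<open>\<kappa> = 31/64 \<delta>\<close>, while \<open>S (N a) \<le> c S H\<close> where the smallness
  assumption makes \<open>c |\<zeta>\<^sub>0|\<close> small against \<open>\<kappa>\<close>; hence Picard iteration contracts in the norm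
  \<open>sup S + \<kappa> \<integral> H\<close>. Since this norm is stated with the extremal weight \<open>W\<close>, one fixed point serves every \<open>\<nu> < \<delta>/2\<close>, and the factor
  \<open>exp (\<delta> t / 64)\<close> contained in \<open>W\<close> is the exponential decay. Feeding the a priori bound
  \<open>S \<le> 2 |\<zeta>\<^sub>0|\<close> back into Duhamel's estimate yields the sharp energy inequality.
\<close>

subsection \<open>Convolution and weighted norms of Fourier coefficients\<close>

text \<open>The leading nonlinear terms carry four derivatives, exactly as many as the dissipation
  controls, so parabolic smoothing over short times gains nothing and only the amplitude of the
  datum can make the map contract. What closes the argument is maximal regularity in L^1 in time
  with l^1 in frequency: the kernel lam exp(-lam t) has mass one, so Tonelli gives the endpoint
  estimate with constant 1, uniformly in the mode. No constant depends on the time horizon, hence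
  the solution is global at once. The same n^4 pays for the growing weight because frequencies are
  integers; at n = 0 there is no dissipation while the weight still grows, so the zero mean is
  carried through the whole iteration. The estimates live in \<open>ennreal\<close>, where they need
  no prior summability; summability enters where convolutions or Duhamel integrals are subtracted.
  The fixed point solves each mode in integrated form only, so the weak equation is reached by
  testing mode by mode and summing, and the datum, given as an integrable function, is recognised at
  time 0 through uniqueness of Fourier coefficients.\<close>

abbreviation C :: "int measure" where "C \<equiv> count_space UNIV"

definition wnorm :: "(int \<Rightarrow> real) \<Rightarrow> (int \<Rightarrow> complex) \<Rightarrow> ennreal" where
  "wnorm w u = (\<integral>\<^sup>+n. ennreal (w n * cmod (u n)) \<partial>C)"

abbreviation l1norm :: "(int \<Rightarrow> complex) \<Rightarrow> ennreal" where "l1norm \<equiv> wnorm (\<lambda>_. 1)"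

text \<open>A Bochner integral over counting measure is 0 where the series does not converge
  absolutely. Upper bounds on it are therefore unconditional, while its bilinearity needs
  summability.\<close>

definition conv :: "(int \<Rightarrow> complex) \<Rightarrow> (int \<Rightarrow> complex) \<Rightarrow> int \<Rightarrow> complex" where
  "conv u v n = (LINT k|C. u k * v (n - k))"

definition diag :: "(int \<Rightarrow> complex) \<Rightarrow> (int \<Rightarrow> complex) \<Rightarrow> int \<Rightarrow> complex" where
  "diag q u n = q n * u n"

lemmas LINT_cong = Bochner_Integration.integral_cong

interpretation C: sigma_finite_measure C
  by (rule sigma_finite_measure_count_space)

interpretation CC: pair_sigma_finite C C ..

lemma nn_integral_C_shift:
  fixes f :: "int \<Rightarrow> ennreal"
  shows "(\<integral>\<^sup>+n. f (n - k) \<partial>C) = (\<integral>\<^sup>+n. f n \<partial>C)"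
  by (rule nn_integral_bij_count_space) (auto simp: bij_betw_def inj_on_def surj_def intro: exI[of _ "_ + k"] image_eqI[of _ _ "_ + k"])

lemma ennreal_norm_integral_le:
  fixes f :: "'a \<Rightarrow> 'b::{banach, second_countable_topology}"
  shows "ennreal (norm (integral\<^sup>L M f)) \<le> (\<integral>\<^sup>+x. ennreal (norm (f x)) \<partial>M)"
  by (cases "integrable M f") (auto simp: integral_norm_bound_ennreal not_integrable_integral_eq)

text \<open>Triangle inequality inside the convolution, then Tonelli and the translation n = k + l.
  The majorant \<open>c k l\<close> of the weight is left free, so that the algebra property and the
  splitting of derivatives are both instances.\<close>

lemma wnorm_conv_le:
  assumes w: "\<And>n. 0 \<le> w n"
    and b: "\<And>k l. w (k + l) \<le> c k l"
  shows "wnorm w (conv u v) \<le> (\<integral>\<^sup>+k. \<integral>\<^sup>+l. ennreal (c k l * (cmod (u k) * cmod (v l))) \<partial>C \<partial>C)"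
proof -
  have "wnorm w (conv u v) \<le> (\<integral>\<^sup>+n. \<integral>\<^sup>+k. ennreal (c k (n - k) * (cmod (u k) * cmod (v (n - k)))) \<partial>C \<partial>C)"
    unfolding wnorm_def
  proof (rule nn_integral_mono)
    fix n
    have "ennreal (w n * cmod (conv u v n)) = ennreal (w n) * ennreal (cmod (conv u v n))"
      using w by (simp add: ennreal_mult')
    also have "\<dots> \<le> ennreal (w n) * (\<integral>\<^sup>+k. ennreal (cmod (u k * v (n - k))) \<partial>C)"
      unfolding conv_def by (intro mult_left_mono ennreal_norm_integral_le) auto
    also have "\<dots> = (\<integral>\<^sup>+k. ennreal (w n) * ennreal (cmod (u k * v (n - k))) \<partial>C)"
      by (subst nn_integral_cmult) auto
    also have "\<dots> \<le> (\<integral>\<^sup>+k. ennreal (c k (n - k) * (cmod (u k) * cmod (v (n - k)))) \<partial>C)"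
    proof (rule nn_integral_mono)
      fix k
      have "w n \<le> c k (n - k)" using b[of k "n - k"] by simp
      then have "w n * (cmod (u k) * cmod (v (n - k))) \<le> c k (n - k) * (cmod (u k) * cmod (v (n - k)))"
        by (intro mult_right_mono) auto
      then show "ennreal (w n) * ennreal (cmod (u k * v (n - k))) \<le> ennreal (c k (n - k) * (cmod (u k) * cmod (v (n - k))))"
        using w by (auto simp: ennreal_mult'[symmetric] norm_mult intro!: ennreal_leI)
    qed
    finally show "ennreal (w n * cmod (conv u v n)) \<le> (\<integral>\<^sup>+k. ennreal (c k (n - k) * (cmod (u k) * cmod (v (n - k)))) \<partial>C)" .
  qed
  also have "\<dots> = (\<integral>\<^sup>+k. \<integral>\<^sup>+n. ennreal (c k (n - k) * (cmod (u k) * cmod (v (n - k)))) \<partial>C \<partial>C)"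
    by (rule CC.Fubini') (simp add: pair_measure_countable)
  also have "\<dots> = (\<integral>\<^sup>+k. \<integral>\<^sup>+l. ennreal (c k l * (cmod (u k) * cmod (v l))) \<partial>C \<partial>C)"
    by (intro nn_integral_cong nn_integral_C_shift)
  finally show ?thesis .
qed

text \<open>Submultiplicativity makes the weighted l^1 norm an algebra norm for convolution;
  \<open>W_ge1\<close> makes it dominate the plain l^1 norm, so finite norm means an absolutely
  convergent Fourier series.\<close>

locale fourier_weight =
  fixes W :: "int \<Rightarrow> real"
  assumes W_ge1: "1 \<le> W n" and W_submult: "W (k + l) \<le> W k * W l"
begin

abbreviation S where "S \<equiv> wnorm W"
abbreviation H where "H \<equiv> wnorm (\<lambda>n. of_int n ^ 4 * W n)"

lemma W_nonneg [simp]: "0 \<le> W n" using W_ge1[of n] by linarith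

text \<open>\<open>p\<close> is the symbol of the derivatives outside the product, \<open>q\<close>
  of those on the second factor. Bounding their product by a sum of pure fourth powers puts all
  derivatives on one factor, so one \<open>H\<close> and one \<open>S\<close> suffice and no
  intermediate norms appear.\<close>

lemma wnorm_conv_diag:
  assumes p: "\<And>n. 0 \<le> p n"
    and c: "\<And>k l. p (k + l) * cmod (q l) \<le> c * (real_of_int k ^ 4 + real_of_int l ^ 4)" "0 \<le> c"
  shows "wnorm (\<lambda>n. p n * W n) (conv u (diag q v)) \<le> ennreal c * (H u * S v + S u * H v)"
proof -
  have "wnorm (\<lambda>n. p n * W n) (conv u (diag q v)) \<le>
    (\<integral>\<^sup>+k. \<integral>\<^sup>+l. ennreal (p (k + l) * (W k * W l) * (cmod (u k) * cmod (diag q v l))) \<partial>C \<partial>C)"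
    by (rule wnorm_conv_le) (auto intro!: mult_nonneg_nonneg mult_left_mono p W_submult)
  also have "\<dots> \<le> (\<integral>\<^sup>+k. \<integral>\<^sup>+l. ennreal c * (ennreal (of_int k ^ 4 * W k * cmod (u k)) * ennreal (W l * cmod (v l))
      + ennreal (W k * cmod (u k)) * ennreal (of_int l ^ 4 * W l * cmod (v l))) \<partial>C \<partial>C)"
  proof (intro nn_integral_mono)
    fix k l
    have "p (k + l) * cmod (q l) * (W k * W l * (cmod (u k) * cmod (v l)))
      \<le> c * (real_of_int k ^ 4 + real_of_int l ^ 4) * (W k * W l * (cmod (u k) * cmod (v l)))"
      by (intro mult_right_mono c(1)) auto
    also have "\<dots> = c * ((of_int k ^ 4 * W k * cmod (u k)) * (W l * cmod (v l)) + (W k * cmod (u k)) * (of_int l ^ 4 * W l * cmod (v l)))"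
      by (simp add: algebra_simps)
    finally have "ennreal (p (k + l) * (W k * W l) * (cmod (u k) * cmod (diag q v l))) \<le> ennreal \<dots>"
      by (intro ennreal_leI) (simp add: diag_def norm_mult algebra_simps)
    also have "\<dots> = ennreal c * (ennreal (of_int k ^ 4 * W k * cmod (u k)) * ennreal (W l * cmod (v l))
      + ennreal (W k * cmod (u k)) * ennreal (of_int l ^ 4 * W l * cmod (v l)))"
      using c(2) by (simp add: ennreal_mult' ennreal_plus mult_nonneg_nonneg ennreal_mult)
    finally show "ennreal (p (k + l) * (W k * W l) * (cmod (u k) * cmod (diag q v l))) \<le> \<dots>" .
  qed
  also have "\<dots> = ennreal c * (H u * S v + S u * H v)"
    by (simp add: wnorm_def nn_integral_cmult nn_integral_add nn_integral_multc)
  finally show ?thesis .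
qed

end

lemma integrable_C_iff: "integrable C (u :: int \<Rightarrow> complex) \<longleftrightarrow> l1norm u < \<infinity>"
  by (simp add: integrable_iff_bounded wnorm_def)

lemma norm_le_wnorm: "ennreal (w n * cmod (u n)) \<le> wnorm w u"
proof -
  have "ennreal (w n * cmod (u n)) = (\<integral>\<^sup>+k. ennreal (w n * cmod (u n)) * indicator {n} k \<partial>C)"
    by (simp add: nn_integral_cmult_indicator)
  also have "\<dots> \<le> wnorm w u"
    unfolding wnorm_def by (intro nn_integral_mono) (auto simp: indicator_def)
  finally show ?thesis .
qed

lemma wnorm_mono: "(\<And>n. w n * cmod (u n) \<le> w' n * cmod (v n)) \<Longrightarrow> wnorm w u \<le> wnorm w' v"
  unfolding wnorm_def by (intro nn_integral_mono ennreal_leI)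

lemma wnorm_add_le:
  assumes "\<And>n. 0 \<le> w n"
  shows "wnorm w (\<lambda>n. u n + v n) \<le> wnorm w u + wnorm w v"
proof -
  have "wnorm w (\<lambda>n. u n + v n) \<le> (\<integral>\<^sup>+n. ennreal (w n * cmod (u n)) + ennreal (w n * cmod (v n)) \<partial>C)"
    unfolding wnorm_def
    using assms by (intro nn_integral_mono)
      (auto simp: ennreal_plus[symmetric] distrib_left[symmetric] simp del: ennreal_plus intro!: ennreal_leI mult_left_mono norm_triangle_ineq)
  also have "\<dots> = wnorm w u + wnorm w v" by (simp add: wnorm_def nn_integral_add)
  finally show ?thesis .
qed

lemma wnorm_scale:
  assumes "\<And>n. 0 \<le> w n"
  shows "wnorm w (\<lambda>n. c * u n) = ennreal (cmod c) * wnorm w u"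
proof -
  have "ennreal (w n * cmod (c * u n)) = ennreal (cmod c) * ennreal (w n * cmod (u n))" for n
    by (simp add: ennreal_mult'[symmetric] norm_mult mult.left_commute)
  then show ?thesis by (simp add: wnorm_def nn_integral_cmult)
qed

lemma integrable_conv_term:
  fixes u v :: "int \<Rightarrow> complex"
  assumes "integrable C u" "integrable C v"
  shows "integrable C (\<lambda>k. u k * v (n - k))"
proof -
  obtain B where B: "l1norm v = ennreal B" "0 \<le> B"
    using assms(2) unfolding integrable_C_iff by (cases "l1norm v") auto
  have "cmod (v j) \<le> B" for j
    using norm_le_wnorm[of "\<lambda>_. 1" j v] B by simp
  then have *: "cmod (u k * v (n - k)) \<le> norm (complex_of_real B * u k)" for k
    using B(2) by (simp add: norm_mult mult.commute[of "cmod (u k)"] mult_right_mono)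
  show ?thesis
    by (rule Bochner_Integration.integrable_bound[of C "\<lambda>k. complex_of_real B * u k", OF _ _ AE_I2[OF *]])
      (simp_all add: assms(1))
qed

lemma conv_diff:
  assumes "integrable C u" "integrable C u'" "integrable C v" "integrable C v'"
  shows "conv u v n - conv u' v' n = conv (\<lambda>n. u n - u' n) v n + conv u' (\<lambda>n. v n - v' n) n"
proof -
  note i = integrable_conv_term[of _ _ n]
  have "conv (\<lambda>n. u n - u' n) v n = conv u v n - conv u' v n"
    unfolding conv_def by (subst Bochner_Integration.integral_diff[symmetric]) (auto intro!: i assms simp: algebra_simps)
  moreover have "conv u' (\<lambda>n. v n - v' n) n = conv u' v n - conv u' v' n"
    unfolding conv_def by (subst Bochner_Integration.integral_diff[symmetric]) (auto intro!: i assms simp: algebra_simps)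
  ultimately show ?thesis by simp
qed

context fourier_weight begin

text \<open>Real upper bounds stand in for the extended norms: nested convolutions then reduce to
  real arithmetic, with finiteness of both norms built in.\<close>

definition bnd :: "(int \<Rightarrow> complex) \<Rightarrow> real \<Rightarrow> real \<Rightarrow> bool" where
  "bnd u s h \<longleftrightarrow> 0 \<le> s \<and> 0 \<le> h \<and> S u \<le> ennreal s \<and> H u \<le> ennreal h"

lemma bnd_weaken:
  assumes "bnd u s h" "s \<le> s'" "h \<le> h'"
  shows "bnd u s' h'"
proof -
  have "S u \<le> ennreal s'" by (rule order_trans[OF _ ennreal_leI[OF assms(2)]]) (use assms(1) in \<open>simp add: bnd_def\<close>)
  moreover have "H u \<le> ennreal h'" by (rule order_trans[OF _ ennreal_leI[OF assms(3)]]) (use assms(1) in \<open>simp add: bnd_def\<close>)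
  ultimately show ?thesis using assms by (simp add: bnd_def)
qed

lemma bnd_add:
  assumes "bnd u s h" "bnd v s' h'"
  shows "bnd (\<lambda>n. u n + v n) (s + s') (h + h')"
proof -
  have "S (\<lambda>n. u n + v n) \<le> ennreal s + ennreal s'" "H (\<lambda>n. u n + v n) \<le> ennreal h + ennreal h'"
    using assms unfolding bnd_def by (auto intro!: order_trans[OF wnorm_add_le] add_mono)
  then show ?thesis using assms unfolding bnd_def by simp
qed

lemma bnd_scale:
  assumes "bnd u s h"
  shows "bnd (\<lambda>n. c * u n) (cmod c * s) (cmod c * h)"
proof -
  have "S (\<lambda>n. c * u n) \<le> ennreal (cmod c) * ennreal s"
    unfolding wnorm_scale[of W, OF W_nonneg] using assms by (intro mult_left_mono) (auto simp: bnd_def)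
  moreover have "H (\<lambda>n. c * u n) \<le> ennreal (cmod c) * ennreal h"
    by (subst wnorm_scale) (use assms in \<open>auto simp: bnd_def intro!: mult_left_mono\<close>)
  ultimately show ?thesis using assms by (simp add: bnd_def ennreal_mult')
qed

lemma bnd_conv_diag:
  assumes "bnd u s h" "bnd v s' h'" and p: "\<And>n. 0 \<le> p n"
    and c: "\<And>k l. p (k + l) * cmod (q l) \<le> c * (real_of_int k ^ 4 + real_of_int l ^ 4)" "0 \<le> c"
  shows "wnorm (\<lambda>n. p n * W n) (conv u (diag q v)) \<le> ennreal (c * (h * s' + s * h'))"
proof -
  have "H u * S v + S u * H v \<le> ennreal h * ennreal s' + ennreal s * ennreal h'"
    using assms(1,2) unfolding bnd_def by (intro add_mono mult_mono) auto
  also have "\<dots> = ennreal (h * s' + s * h')"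
    using assms(1,2) unfolding bnd_def by (simp add: ennreal_mult ennreal_plus)
  finally have "ennreal c * (H u * S v + S u * H v) \<le> ennreal c * ennreal (h * s' + s * h')"
    by (rule mult_left_mono) simp
  with wnorm_conv_diag[OF p c] show ?thesis
    unfolding ennreal_mult'[OF c(2)] by (rule order_trans)
qed

lemma S_conv_le: "S (conv u v) \<le> S u * S v"
proof -
  have "S (conv u v) \<le> (\<integral>\<^sup>+k. \<integral>\<^sup>+l. ennreal (W k * W l * (cmod (u k) * cmod (v l))) \<partial>C \<partial>C)"
    by (rule wnorm_conv_le) (auto intro!: W_submult)
  also have "\<dots> = (\<integral>\<^sup>+k. \<integral>\<^sup>+l. ennreal (W k * cmod (u k)) * ennreal (W l * cmod (v l)) \<partial>C \<partial>C)"
    by (intro nn_integral_cong) (auto simp: ennreal_mult[symmetric] mult_ac)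
  also have "\<dots> = S u * S v"
    by (simp add: wnorm_def nn_integral_cmult nn_integral_multc)
  finally show ?thesis .
qed

lemma bnd_conv:
  assumes "bnd u s h" "bnd v s' h'"
  shows "bnd (conv u v) (s * s') (8 * (h * s' + s * h'))"
proof -
  have "S (conv u v) \<le> ennreal s * ennreal s'"
    using assms unfolding bnd_def by (intro order_trans[OF S_conv_le] mult_mono) auto
  moreover have "H (conv u (diag (\<lambda>_. 1) v)) \<le> ennreal (8 * (h * s' + s * h'))"
  proof (rule bnd_conv_diag[OF assms])
    fix k l :: int
    define a b where "a = real_of_int k" and "b = real_of_int l"
    \<comment> \<open>The constant 8 comes from using (a + b)^2 \<le> 2 (a^2 + b^2) twice: first for
      a and b, then for their squares.\<close>
    have "(a + b)^2 \<le> 2 * (a^2 + b^2)" using sum_squares_bound[of a b] by (simp add: power2_sum)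
    then have "((a + b)^2)^2 \<le> (2 * (a^2 + b^2))^2" by (rule power_mono) simp
    also have "\<dots> = 4 * ((a^2)^2 + (b^2)^2 + 2 * a^2 * b^2)" by algebra
    also have "\<dots> \<le> 8 * ((a^2)^2 + (b^2)^2)" using sum_squares_bound[of "a^2" "b^2"] by (simp add: algebra_simps)
    finally have "(a + b) ^ 4 \<le> 8 * (a ^ 4 + b ^ 4)" by simp
    then show "real_of_int (k + l) ^ 4 * cmod 1 \<le> 8 * (real_of_int k ^ 4 + real_of_int l ^ 4)"
      by (simp add: a_def b_def)
  qed auto
  moreover have "diag (\<lambda>_. 1) v = v" by (simp add: diag_def fun_eq_iff)
  ultimately show ?thesis using assms unfolding bnd_def by (simp add: ennreal_mult)
qed

text \<open>Both factors are compared with M = max |k| |l|; |k + l| \<le> 2 M accounts for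
  \<open>2 ^ i\<close>. Since M is an integer, M^(i+j) \<le> M^4, where M = 0 is the case that uses
  i + j \<ge> 1. Thus even a flux with only two derivatives is absorbed by \<open>H\<close>.\<close>

lemma pow_max_bound:
  assumes "1 \<le> i + j" "i + j \<le> (4::nat)"
  shows "\<bar>real_of_int (k + l)\<bar> ^ i * \<bar>real_of_int l\<bar> ^ j \<le> 2 ^ i * (real_of_int k ^ 4 + real_of_int l ^ 4)"
proof -
  define M where "M = max \<bar>k\<bar> \<bar>l\<bar>"
  have "\<bar>real_of_int (k + l)\<bar> ^ i * \<bar>real_of_int l\<bar> ^ j \<le> (2 * real_of_int M) ^ i * real_of_int M ^ j"
    unfolding M_def by (intro mult_mono power_mono) auto
  also have "\<dots> = 2 ^ i * real_of_int M ^ (i + j)" by (simp add: power_mult_distrib power_add)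
  also have "real_of_int M ^ (i + j) \<le> real_of_int M ^ 4"
  proof (cases "M = 0")
    case False
    then have "1 \<le> real_of_int M" unfolding M_def by linarith
    then show ?thesis by (intro power_increasing assms)
  next
    case True
    with assms(1) show ?thesis by (cases "i + j") simp_all
  qed
  also have "real_of_int M ^ 4 \<le> real_of_int k ^ 4 + real_of_int l ^ 4"
    unfolding M_def by (auto simp: max_def)
  finally show ?thesis by simp
qed

text \<open>On integers |n|^j \<le> 1 + n^4, so \<open>S\<close> and \<open>H\<close> together
  dominate the l^1 norm. This supplies the summability that \<open>conv_diff\<close> asks
  for.\<close>

lemma bnd_integrable_power:
  assumes "bnd u s h" "j \<le> 4"
  shows "integrable C (diag (\<lambda>l. of_int l ^ j) u)"
proof -
  have "l1norm (diag (\<lambda>l. of_int l ^ j) u) \<le> (\<integral>\<^sup>+n. ennreal (W n * cmod (u n)) + ennreal (of_int n ^ 4 * W n * cmod (u n)) \<partial>C)"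
    unfolding wnorm_def
  proof (intro nn_integral_mono)
    fix n
    have "\<bar>real_of_int n\<bar> ^ j \<le> 1 + real_of_int n ^ 4"
    proof (cases "n = 0")
      case False
      then have "\<bar>real_of_int n\<bar> ^ j \<le> \<bar>real_of_int n\<bar> ^ 4" by (intro power_increasing assms) linarith
      then show ?thesis by simp
    qed (simp add: power_0_left)
    then have "\<bar>real_of_int n\<bar> ^ j * 1 \<le> (1 + real_of_int n ^ 4) * W n"
      by (intro mult_mono) (auto simp: W_ge1)
    then have "\<bar>real_of_int n\<bar> ^ j * cmod (u n) \<le> (1 + real_of_int n ^ 4) * W n * cmod (u n)"
      by (intro mult_right_mono) auto
    then show "ennreal (1 * cmod (diag (\<lambda>l. of_int l ^ j) u n)) \<le> ennreal (W n * cmod (u n)) + ennreal (of_int n ^ 4 * W n * cmod (u n))"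
      by (simp add: diag_def norm_mult norm_power ennreal_plus[symmetric] algebra_simps ennreal_leI del: ennreal_plus)
  qed
  also have "\<dots> = S u + H u" by (simp add: wnorm_def nn_integral_add)
  also have "\<dots> < \<infinity>" using assms(1) unfolding bnd_def by (auto simp: top.extremum_strict order_le_less_trans[OF _ ennreal_less_top])
  finally show ?thesis by (simp add: integrable_C_iff)
qed

lemma bnd_integrable: "bnd u s h \<Longrightarrow> integrable C u"
  using bnd_integrable_power[of u s h 0] by (simp add: diag_def[abs_def])

end

subsection \<open>The nonlinearity\<close>

text \<open>The coefficients of (1 + \<epsilon> \<zeta>)^3 - 1. Removing the constant 1 leaves the
  linear part of that flux to \<open>L\<close>, where it lowers \<beta> to \<delta> = \<beta> -
  m.\<close>

definition gam :: "real \<Rightarrow> (int \<Rightarrow> complex) \<Rightarrow> int \<Rightarrow> complex" where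
  "gam \<epsilon> u n = of_real (3 * \<epsilon>) * u n + of_real (3 * \<epsilon>\<^sup>2) * conv u u n + of_real (\<epsilon> ^ 3) * conv (conv u u) u n"

abbreviation dpow :: "nat \<Rightarrow> (int \<Rightarrow> complex) \<Rightarrow> int \<Rightarrow> complex" where
  "dpow j \<equiv> diag (\<lambda>l. of_int l ^ j)"

text \<open>The Fourier symbol of
  \<open>\<epsilon> \<partial>\<^sub>x (\<zeta> \<zeta>\<^sub>x) - \<beta> \<epsilon> \<partial>\<^sub>x (\<zeta> \<zeta>\<^sub>x\<^sub>x\<^sub>x) + m \<partial>\<^sub>x\<^sub>x (((1 + \<epsilon> \<zeta>)\<^sup>3 - 1) \<zeta>\<^sub>x\<^sub>x)\<close>; the powers of \<open>\<i>\<close> have been multiplied out.\<close>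

definition nonlin :: "real \<Rightarrow> real \<Rightarrow> real \<Rightarrow> (int \<Rightarrow> complex) \<Rightarrow> int \<Rightarrow> complex" where
  "nonlin \<epsilon> \<beta> m u n = of_real (- \<epsilon>) * (of_int n ^ 1 * conv u (dpow 1 u) n)
     + of_real (- \<beta> * \<epsilon>) * (of_int n ^ 1 * conv u (dpow 3 u) n)
     + of_real m * (of_int n ^ 2 * conv (gam \<epsilon> u) (dpow 2 u) n)"

context fourier_weight begin

lemma S_flux_le:
  assumes "bnd g s h" "bnd u s' h'" "1 \<le> i + j" "i + j \<le> 4"
  shows "S (\<lambda>n. of_int n ^ i * conv g (dpow j u) n) \<le> ennreal (2 ^ i * (h * s' + s * h'))"
proof -
  have "S (\<lambda>n. of_int n ^ i * conv g (dpow j u) n) = wnorm (\<lambda>n. \<bar>real_of_int n\<bar> ^ i * W n) (conv g (dpow j u))"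
    unfolding wnorm_def by (intro nn_integral_cong) (simp add: norm_mult norm_power mult_ac)
  also have "\<dots> \<le> ennreal (2 ^ i * (h * s' + s * h'))"
    by (rule bnd_conv_diag[OF assms(1,2)]) (use pow_max_bound[OF assms(3,4)] in \<open>auto simp: norm_power\<close>)
  finally show ?thesis .
qed

text \<open>The splitting g u - g' u' = (g - g') u + g' (u - u') makes each half a flux estimate in
  which one factor is a difference.\<close>

lemma S_flux_diff_le:
  assumes "bnd g sg hg" "bnd g' sg' hg'" "bnd u su hu" "bnd u' su' hu'"
    and "bnd (\<lambda>n. g n - g' n) sdg hdg" "bnd (\<lambda>n. u n - u' n) sd he"
    and ij: "1 \<le> i + j" "i + j \<le> 4"
  shows "S (\<lambda>n. of_int n ^ i * conv g (dpow j u) n - of_int n ^ i * conv g' (dpow j u') n)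
    \<le> ennreal (2 ^ i * (hdg * su + sdg * hu + hg' * sd + sg' * he))"
proof -
  have j: "j \<le> 4" using ij by simp
  have "conv g (dpow j u) n - conv g' (dpow j u') n
      = conv (\<lambda>n. g n - g' n) (dpow j u) n + conv g' (dpow j (\<lambda>n. u n - u' n)) n" for n
  proof -
    have "(\<lambda>n. dpow j u n - dpow j u' n) = dpow j (\<lambda>n. u n - u' n)"
      by (simp add: diag_def fun_eq_iff right_diff_distrib)
    then show ?thesis
      using conv_diff[of g g' "dpow j u" "dpow j u'" n] bnd_integrable_power[OF _ j] bnd_integrable assms(1-4) by metis
  qed
  then have "S (\<lambda>n. of_int n ^ i * conv g (dpow j u) n - of_int n ^ i * conv g' (dpow j u') n)
      = S (\<lambda>n. of_int n ^ i * conv (\<lambda>n. g n - g' n) (dpow j u) n + of_int n ^ i * conv g' (dpow j (\<lambda>n. u n - u' n)) n)"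
    by (simp add: right_diff_distrib[symmetric] distrib_left[symmetric])
  also have "\<dots> \<le> ennreal (2 ^ i * (hdg * su + sdg * hu)) + ennreal (2 ^ i * (hg' * sd + sg' * he))"
    by (intro order_trans[OF wnorm_add_le] add_mono S_flux_le assms ij) simp
  also have "\<dots> = ennreal (2 ^ i * (hdg * su + sdg * hu + hg' * sd + sg' * he))"
    using assms by (subst ennreal_plus[symmetric]) (auto simp: bnd_def algebra_simps)
  finally show ?thesis .
qed

lemma bnd_conv_diff:
  assumes "bnd g sg hg" "bnd g' sg' hg'" "bnd u su hu" "bnd u' su' hu'"
    and "bnd (\<lambda>n. g n - g' n) sdg hdg" "bnd (\<lambda>n. u n - u' n) sd he"
  shows "bnd (\<lambda>n. conv g u n - conv g' u' n) (sdg * su + sg' * sd) (8 * (hdg * su + sdg * hu + hg' * sd + sg' * he))"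
proof -
  have "conv g u n - conv g' u' n = conv (\<lambda>n. g n - g' n) u n + conv g' (\<lambda>n. u n - u' n) n" for n
    by (intro conv_diff bnd_integrable[OF assms(1)] bnd_integrable[OF assms(2)] bnd_integrable[OF assms(3)] bnd_integrable[OF assms(4)])
  then show ?thesis
    using bnd_add[OF bnd_conv[OF assms(5,3)] bnd_conv[OF assms(2,6)]] by (simp add: algebra_simps)
qed

text \<open>With \<open>m = \<mu> / 3\<close> the constant is the \<open>1 + \<beta> + 55/6 \<mu>\<close> of the smallness assumption.\<close>

lemma nonlin_diff:
  assumes u: "bnd u su hu" and v: "bnd v sv hv" and d: "bnd (\<lambda>n. u n - v n) sd he"
    and R: "su \<le> R" "sv \<le> R" and \<epsilon>: "0 < \<epsilon>" "\<epsilon> * R \<le> 1 / 64" and \<beta>: "0 \<le> \<beta>" and m: "0 \<le> m"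
  shows "S (\<lambda>n. nonlin \<epsilon> \<beta> m u n - nonlin \<epsilon> \<beta> m v n)
    \<le> ennreal (2 * \<epsilon> * (1 + \<beta> + 55 / 2 * m) * (sd * (hu + hv) + (su + sv) * he))"
proof -
  \<comment> \<open>\<open>X\<close> is the Lipschitz bound of a quadratic product. Every product of
    higher order will be bounded by a power of \<open>R\<close> times \<open>X\<close>.\<close>
  define X where "X = sd * (hu + hv) + (su + sv) * he"
  have nn: "0 \<le> su" "0 \<le> hu" "0 \<le> sv" "0 \<le> hv" "0 \<le> sd" "0 \<le> he" "0 \<le> R"
    using u v d R unfolding bnd_def by auto
  have X0: "0 \<le> X" unfolding X_def using nn by simp
  note uu = bnd_conv[OF u u] and vv = bnd_conv[OF v v]
  note dd2 = bnd_conv_diff[OF u v u v d d]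
  have s2: "bnd (\<lambda>n. conv u u n - conv v v n) ((su + sv) * sd) (8 * X)"
    by (rule bnd_weaken[OF dd2]) (auto simp: X_def algebra_simps)
  note uuu = bnd_conv[OF uu u] and vvv = bnd_conv[OF vv v]
  note dd3 = bnd_conv_diff[OF uu vv u v s2 d]
  \<comment> \<open>Up to a factor 8 or \<open>2 ^ i\<close>, \<open>E2\<close> and
    \<open>E3\<close> are what the difference estimate yields for cubic and quartic products, one
    further factor of u or v each time.\<close>
  define E2 where "E2 = 8 * X * su + (su + sv) * sd * hu + 8 * (hv * sv + sv * hv) * sd + sv * sv * he"
  have s3: "bnd (\<lambda>n. conv (conv u u) u n - conv (conv v v) v n) ((su + sv) * sd * su + sv * sv * sd) (8 * E2)"
    using dd3 by (simp add: E2_def)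
  define E3 where "E3 = 8 * E2 * su + ((su + sv) * sd * su + sv * sv * sd) * hu + 8 * (8 * (hv * sv + sv * hv) * sv + sv * sv * hv) * sd + sv * sv * sv * he"
  have t1: "su * X \<le> R * X" "sv * (sd * hu) \<le> R * (sd * hu)" "su * (sd * hu) \<le> R * (sd * hu)" "sv * (sd * hv) \<le> R * (sd * hv)" "sv * (sv * he) \<le> R * (sv * he)"
    using nn R X0 by (auto intro!: mult_right_mono)
  have RX: "R * X = R * (sd * hu) + R * (sd * hv) + R * (su * he) + R * (sv * he)"
    unfolding X_def by (simp add: algebra_simps)
  have p: "0 \<le> R * (sd * hu)" "0 \<le> R * (sd * hv)" "0 \<le> R * (su * he)" "0 \<le> R * (sv * he)" using nn by auto
  have "E2 = 8 * (su * X) + su * (sd * hu) + sv * (sd * hu) + 16 * (sv * (sd * hv)) + sv * (sv * he)"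
    unfolding E2_def by (simp add: algebra_simps)
  then have E2: "E2 \<le> 24 * (R * X)" using t1 RX p by linarith
  have E20: "0 \<le> E2" unfolding E2_def using nn X0 by simp
  have q: "su * su \<le> R * R" "sv * sv \<le> R * R" "su * sv \<le> R * R" using nn R by (auto intro!: mult_mono)
  \<comment> \<open>328 = 8 * 24 + 136, where 136 is the largest coefficient among the remaining
    terms of \<open>E3\<close>.\<close>
  have "su * E2 \<le> R * (24 * (R * X))" using E2 E20 nn R by (intro mult_mono) auto
  moreover have "su * su * (sd * hu) \<le> R * R * (sd * hu)" "su * sv * (sd * hu) \<le> R * R * (sd * hu)" "sv * sv * (sd * hu) \<le> R * R * (sd * hu)"
      "sv * sv * (sd * hv) \<le> R * R * (sd * hv)" "sv * sv * (sv * he) \<le> R * R * (sv * he)"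
    using q nn by (auto intro!: mult_right_mono)
  moreover have "E3 = 8 * (su * E2) + su * su * (sd * hu) + su * sv * (sd * hu) + sv * sv * (sd * hu) + 136 * (sv * sv * (sd * hv)) + sv * sv * (sv * he)"
    unfolding E3_def by (simp add: algebra_simps)
  moreover have "R * R * X = R * R * (sd * hu) + R * R * (sd * hv) + R * R * (su * he) + R * R * (sv * he)"
    unfolding X_def by (simp add: algebra_simps)
  moreover have "0 \<le> R * R * (sd * hu)" "0 \<le> R * R * (sd * hv)" "0 \<le> R * R * (su * he)" "0 \<le> R * R * (sv * he)" using nn by auto
  ultimately have E3: "E3 \<le> 328 * (R * R * X)" by simp
  have c: "cmod (of_real (3 * \<epsilon>)) = 3 * \<epsilon>" "cmod (of_real (3 * \<epsilon>\<^sup>2)) = 3 * \<epsilon>\<^sup>2" "cmod (of_real (\<epsilon> ^ 3)) = \<epsilon> ^ 3"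
    using \<epsilon> by (auto simp: norm_mult norm_power)
  have lin: "bnd (\<lambda>n. of_real (3 * \<epsilon>) * f n + of_real (3 * \<epsilon>\<^sup>2) * g n + of_real (\<epsilon> ^ 3) * k n)
     (3 * \<epsilon> * s1 + 3 * \<epsilon>\<^sup>2 * s2 + \<epsilon> ^ 3 * s3) (3 * \<epsilon> * h1 + 3 * \<epsilon>\<^sup>2 * h2 + \<epsilon> ^ 3 * h3)"
    if "bnd f s1 h1" "bnd g s2 h2" "bnd k s3 h3" for f g k s1 s2 s3 h1 h2 h3
    using bnd_add[OF bnd_add[OF bnd_scale[OF that(1), of "of_real (3 * \<epsilon>)"] bnd_scale[OF that(2), of "of_real (3 * \<epsilon>\<^sup>2)"]] bnd_scale[OF that(3), of "of_real (\<epsilon> ^ 3)"]]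
    unfolding c .
  note gu = lin[OF u uu uuu, folded gam_def] and gv = lin[OF v vv vvv, folded gam_def]
  have "(\<lambda>n. of_real (3 * \<epsilon>) * (u n - v n) + of_real (3 * \<epsilon>\<^sup>2) * (conv u u n - conv v v n) + of_real (\<epsilon> ^ 3) * (conv (conv u u) u n - conv (conv v v) v n))
     = (\<lambda>n. gam \<epsilon> u n - gam \<epsilon> v n)"
    by (simp add: gam_def fun_eq_iff algebra_simps)
  then have dg: "bnd (\<lambda>n. gam \<epsilon> u n - gam \<epsilon> v n) (3 * \<epsilon> * sd + 3 * \<epsilon>\<^sup>2 * ((su + sv) * sd) + \<epsilon> ^ 3 * ((su + sv) * sd * su + sv * sv * sd))
      (3 * \<epsilon> * he + 3 * \<epsilon>\<^sup>2 * (8 * X) + \<epsilon> ^ 3 * (8 * E2))"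
    using lin[OF d s2 s3] by simp
  let ?f1 = "\<lambda>n. of_int n ^ 1 * conv u (dpow 1 u) n - of_int n ^ 1 * conv v (dpow 1 v) n"
  let ?f2 = "\<lambda>n. of_int n ^ 1 * conv u (dpow 3 u) n - of_int n ^ 1 * conv v (dpow 3 v) n"
  let ?f3 = "\<lambda>n. of_int n ^ 2 * conv (gam \<epsilon> u) (dpow 2 u) n - of_int n ^ 2 * conv (gam \<epsilon> v) (dpow 2 v) n"
  have f1: "S ?f1 \<le> ennreal (2 * X)"
    by (rule S_flux_diff_le[OF u v u v d d, of 1 1, THEN order_trans]) (auto simp: X_def algebra_simps)
  have f2: "S ?f2 \<le> ennreal (2 * X)"
    by (rule S_flux_diff_le[OF u v u v d d, of 1 3, THEN order_trans]) (auto simp: X_def algebra_simps)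
  have f3: "S ?f3 \<le> ennreal (17 * \<epsilon> * X)"
  proof (rule S_flux_diff_le[OF gu gv u v dg d, of 2 2, THEN order_trans], simp, simp, rule ennreal_leI)
    have "(3 * \<epsilon> * he + 3 * \<epsilon>\<^sup>2 * (8 * X) + \<epsilon> ^ 3 * (8 * E2)) * su +
       (3 * \<epsilon> * sd + 3 * \<epsilon>\<^sup>2 * ((su + sv) * sd) + \<epsilon> ^ 3 * ((su + sv) * sd * su + sv * sv * sd)) * hu +
       (3 * \<epsilon> * hv + 3 * \<epsilon>\<^sup>2 * (8 * (hv * sv + sv * hv)) + \<epsilon> ^ 3 * (8 * (8 * (hv * sv + sv * hv) * sv + sv * sv * hv))) * sd +
       (3 * \<epsilon> * sv + 3 * \<epsilon>\<^sup>2 * (sv * sv) + \<epsilon> ^ 3 * (sv * sv * sv)) * he = 3 * \<epsilon> * X + 3 * \<epsilon>\<^sup>2 * E2 + \<epsilon> ^ 3 * E3" (is "?L = _")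
      unfolding X_def E3_def E2_def by algebra
    also have "\<dots> \<le> 3 * \<epsilon> * X + 3 * \<epsilon>\<^sup>2 * (24 * (R * X)) + \<epsilon> ^ 3 * (328 * (R * R * X))"
      using E2 E3 \<epsilon> by (intro add_mono mult_left_mono) auto
    also have "\<dots> = \<epsilon> * X * (3 + 72 * (\<epsilon> * R) + 328 * (\<epsilon> * R)\<^sup>2)"
      by algebra
    \<comment> \<open>With \<epsilon> R \<le> 1/64 the bracket is at most 3 + 72/64 + 328/4096 <
      17/4. The factor 2^2 of the two outer derivatives then gives 17.\<close>
    also have "\<dots> \<le> \<epsilon> * X * (17 / 4)"
    proof -
      have "(\<epsilon> * R)\<^sup>2 \<le> (1 / 64)\<^sup>2" using \<epsilon> nn by (intro power_mono) auto
      also have "\<dots> = 1 / 4096" by (simp add: power2_eq_square)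
      finally have "3 + 72 * (\<epsilon> * R) + 328 * (\<epsilon> * R)\<^sup>2 \<le> 17 / 4" using \<epsilon>(2) by simp
      then show ?thesis using \<epsilon> X0 by (intro mult_left_mono) auto
    qed
    finally show "2\<^sup>2 * ?L \<le> 17 * \<epsilon> * X" by simp
  qed
  have "S (\<lambda>n. nonlin \<epsilon> \<beta> m u n - nonlin \<epsilon> \<beta> m v n)
     = S (\<lambda>n. (of_real (- \<epsilon>) * ?f1 n + of_real (- \<beta> * \<epsilon>) * ?f2 n) + of_real m * ?f3 n)"
    unfolding nonlin_def by (intro arg_cong[of _ _ S] ext) (simp only: algebra_simps)
  also have "\<dots> \<le> ennreal \<epsilon> * ennreal (2 * X) + ennreal (\<beta> * \<epsilon>) * ennreal (2 * X) + ennreal m * ennreal (17 * \<epsilon> * X)"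
  proof (intro order_trans[OF wnorm_add_le] add_mono)
    show "S (\<lambda>n. of_real (- \<epsilon>) * ?f1 n) \<le> ennreal \<epsilon> * ennreal (2 * X)"
      unfolding wnorm_scale[of W, OF W_nonneg] by (intro mult_mono f1) (use \<epsilon> in auto)
    show "S (\<lambda>n. of_real (- \<beta> * \<epsilon>) * ?f2 n) \<le> ennreal (\<beta> * \<epsilon>) * ennreal (2 * X)"
      unfolding wnorm_scale[of W, OF W_nonneg] by (intro mult_mono f2) (use \<epsilon> \<beta> in \<open>auto simp: norm_mult\<close>)
    show "S (\<lambda>n. of_real m * ?f3 n) \<le> ennreal m * ennreal (17 * \<epsilon> * X)"
      unfolding wnorm_scale[of W, OF W_nonneg] by (intro mult_mono f3) (use m in auto)
  qed auto
  also have "\<dots> = ennreal (\<epsilon> * (2 * X) + \<beta> * \<epsilon> * (2 * X) + m * (17 * \<epsilon> * X))"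
    using \<epsilon> \<beta> m X0 by (simp add: ennreal_mult)
  also have "\<dots> \<le> ennreal (2 * \<epsilon> * (1 + \<beta> + 55 / 2 * m) * X)"
  proof (rule ennreal_leI)
    have "0 \<le> m * \<epsilon> * X" using m \<epsilon> X0 by auto
    then show "\<epsilon> * (2 * X) + \<beta> * \<epsilon> * (2 * X) + m * (17 * \<epsilon> * X) \<le> 2 * \<epsilon> * (1 + \<beta> + 55 / 2 * m) * X"
      by (simp add: algebra_simps)
  qed
  finally show ?thesis unfolding X_def .
qed

end

subsection \<open>Duhamel's formula\<close>

lemma pred_in_atLeastAtMost [measurable (raw)]:
  fixes f g h :: "'a \<Rightarrow> real"
  assumes [measurable]: "f \<in> borel_measurable M" "g \<in> borel_measurable M" "h \<in> borel_measurable M"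
  shows "Measurable.pred M (\<lambda>x. f x \<in> {g x..h x})"
  unfolding atLeastAtMost_iff by measurable

text \<open>The mild solution of a' = -L a + f, a(0) = z. The value 0 at negative times lets norms
  in time be integrals over the whole line.\<close>

definition duhamel :: "real \<Rightarrow> complex \<Rightarrow> (real \<Rightarrow> complex) \<Rightarrow> real \<Rightarrow> complex" where
  "duhamel L z f t = (if t < 0 then 0 else of_real (exp (- L * t)) * z +
     (LINT s|lborel. (if 0 \<le> s \<and> s \<le> t then of_real (exp (- L * (t - s))) * f s else 0)))"

lemma duhamel_measurable [measurable]:
  assumes [measurable]: "f \<in> borel_measurable borel"
  shows "duhamel L z f \<in> borel_measurable borel"
  unfolding duhamel_def[abs_def] by measurable

text \<open>A balance of mass: a unit inserted at time s has, by time t, either survived or been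
  dissipated. This identity is the source of the constant 1 in the maximal regularity
  estimate.\<close>

lemma exp_kernel_integral:
  fixes lam s t :: real
  assumes "s \<le> t" "0 \<le> lam"
  shows "ennreal (exp (- lam * (t - s))) + ennreal lam * (\<integral>\<^sup>+r. ennreal (exp (- lam * (r - s))) * indicator {s..t} r \<partial>lborel) = 1"
proof -
  have "(\<integral>\<^sup>+r. ennreal (lam * exp (- lam * (r - s))) * indicator {s..t} r \<partial>lborel) = ennreal (- exp (- lam * (t - s)) - - exp (- lam * (s - s)))"
    by (rule nn_integral_FTC_Icc[of _ s t "\<lambda>r. - exp (- lam * (r - s))"])
      (use assms in \<open>auto intro!: derivative_eq_intros simp: algebra_simps\<close>)
  moreover have "(\<integral>\<^sup>+r. ennreal (lam * exp (- lam * (r - s))) * indicator {s..t} r \<partial>lborel) = ennreal lam * (\<integral>\<^sup>+r. ennreal (exp (- lam * (r - s))) * indicator {s..t} r \<partial>lborel)"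
    using assms by (subst nn_integral_cmult[symmetric]) (auto simp: ennreal_mult' mult.assoc)
  ultimately have "ennreal lam * (\<integral>\<^sup>+r. ennreal (exp (- lam * (r - s))) * indicator {s..t} r \<partial>lborel) = ennreal (1 - exp (- lam * (t - s)))"
    by simp
  then show ?thesis using assms by (simp add: ennreal_plus[symmetric] del: ennreal_plus)
qed

text \<open>The weighted modulus of the Duhamel solution is dominated by the solution \<open>y\<close> of
  \<open>y' = - lam y + F\<close>, and for \<open>y\<close> the inequality is an identity.\<close>

lemma duhamel_energy:
  fixes f :: "real \<Rightarrow> complex"
  assumes [measurable]: "f \<in> borel_measurable borel"
    and lam: "0 \<le> lam" "lam \<le> L - \<theta>" and t: "0 \<le> t"
  shows "ennreal (exp (\<theta> * t) * cmod (duhamel L z f t))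
     + ennreal lam * (\<integral>\<^sup>+s\<in>{0..t}. ennreal (exp (\<theta> * s) * cmod (duhamel L z f s)) \<partial>lborel)
     \<le> ennreal (cmod z) + (\<integral>\<^sup>+s\<in>{0..t}. ennreal (exp (\<theta> * s) * cmod (f s)) \<partial>lborel)" (is "?lhs \<le> _")
proof -
  define F where "F s = ennreal (exp (\<theta> * s) * cmod (f s))" for s
  have [measurable]: "F \<in> borel_measurable borel" unfolding F_def by measurable
  define k where "k r s = ennreal (exp (- lam * (r - s)))" for r s :: real
  have [measurable (raw)]: "(\<lambda>x. k (g x) (h x)) \<in> borel_measurable M"
    if [measurable]: "g \<in> borel_measurable M" "h \<in> borel_measurable M" for g h and M :: "'x measure"
    unfolding k_def by measurable
  let ?K = "\<lambda>s. \<integral>\<^sup>+r. k r s * indicator {s..t} r \<partial>lborel"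
  \<comment> \<open>Variation of constants for the scalar majorant, kept in \<open>ennreal\<close>
    so that Tonelli applies without integrability of \<open>f\<close>.\<close>
  define y where "y r = ennreal (cmod z) * k r 0 + (\<integral>\<^sup>+s. F s * indicator {0..r} s * k r s \<partial>lborel)" for r
  \<comment> \<open>The weight consumes \<theta> of the decay rate \<open>L\<close>; at least
    \<open>lam\<close> remains.\<close>
  have ex: "exp (\<theta> * r) * exp (- L * (r - s)) \<le> exp (- lam * (r - s)) * exp (\<theta> * s)" if "s \<le> r" for r s
  proof -
    have "lam * (r - s) \<le> (L - \<theta>) * (r - s)" using that lam by (intro mult_right_mono) auto
    then show ?thesis by (simp add: exp_add[symmetric] algebra_simps)
  qed
  have le: "ennreal (exp (\<theta> * r) * cmod (duhamel L z f r)) \<le> y r" if r: "0 \<le> r" for r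
  proof -
    let ?I = "LINT s|lborel. (if 0 \<le> s \<and> s \<le> r then of_real (exp (- L * (r - s))) * f s else 0)"
    have "exp (\<theta> * r) * cmod (duhamel L z f r) \<le> exp (\<theta> * r) * (exp (- L * r) * cmod z + cmod ?I)"
      using r by (intro mult_left_mono) (auto simp: duhamel_def norm_mult intro!: order_trans[OF norm_triangle_ineq])
    also have "\<dots> \<le> exp (- lam * r) * cmod z + exp (\<theta> * r) * cmod ?I"
      using mult_right_mono[OF ex[of 0 r], of "cmod z"] r by (simp add: algebra_simps)
    finally have "ennreal (exp (\<theta> * r) * cmod (duhamel L z f r)) \<le> ennreal (exp (- lam * r) * cmod z) + ennreal (exp (\<theta> * r)) * ennreal (cmod ?I)"
      by (simp add: ennreal_leI ennreal_plus[symmetric] ennreal_mult[symmetric] del: ennreal_plus)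
    also have "\<dots> \<le> y r"
      unfolding y_def
    proof (rule add_mono)
      show "ennreal (exp (- lam * r) * cmod z) \<le> ennreal (cmod z) * k r 0"
        unfolding k_def by (simp add: ennreal_mult' mult.commute)
      have "ennreal (exp (\<theta> * r)) * ennreal (cmod ?I) \<le> ennreal (exp (\<theta> * r)) * (\<integral>\<^sup>+s. ennreal (cmod (if 0 \<le> s \<and> s \<le> r then of_real (exp (- L * (r - s))) * f s else 0)) \<partial>lborel)"
        by (intro mult_left_mono ennreal_norm_integral_le) auto
      also have "\<dots> = (\<integral>\<^sup>+s. ennreal (exp (\<theta> * r)) * ennreal (cmod (if 0 \<le> s \<and> s \<le> r then of_real (exp (- L * (r - s))) * f s else 0)) \<partial>lborel)"
        by (rule nn_integral_cmult[symmetric]) measurable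
      also have "\<dots> \<le> (\<integral>\<^sup>+s. F s * indicator {0..r} s * k r s \<partial>lborel)"
      proof (rule nn_integral_mono)
        fix s
        show "ennreal (exp (\<theta> * r)) * ennreal (cmod (if 0 \<le> s \<and> s \<le> r then of_real (exp (- L * (r - s))) * f s else 0)) \<le> F s * indicator {0..r} s * k r s"
        proof (cases "0 \<le> s \<and> s \<le> r")
          case True
          have "exp (\<theta> * r) * (exp (- L * (r - s)) * cmod (f s)) \<le> exp (\<theta> * s) * cmod (f s) * exp (- lam * (r - s))"
            using mult_right_mono[OF ex[of s r], of "cmod (f s)"] True by (simp add: mult_ac)
          then show ?thesis using True unfolding F_def k_def
            by (simp add: ennreal_mult[symmetric] norm_mult ennreal_leI)
        qed auto
      qed
      finally show "ennreal (exp (\<theta> * r)) * ennreal (cmod ?I) \<le> (\<integral>\<^sup>+s. F s * indicator {0..r} s * k r s \<partial>lborel)" .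
    qed
    finally show ?thesis .
  qed
  have [measurable]: "y \<in> borel_measurable borel" unfolding y_def[abs_def] by measurable
  have "(\<integral>\<^sup>+r\<in>{0..t}. y r \<partial>lborel)
     = (\<integral>\<^sup>+r. ennreal (cmod z) * (k r 0 * indicator {0..t} r) + (\<integral>\<^sup>+s. F s * indicator {0..r} s * k r s * indicator {0..t} r \<partial>lborel) \<partial>lborel)"
    unfolding y_def by (intro nn_integral_cong, subst nn_integral_multc) (simp_all add: distrib_right mult.assoc)
  also have "\<dots> = ennreal (cmod z) * (\<integral>\<^sup>+r\<in>{0..t}. k r 0 \<partial>lborel) + (\<integral>\<^sup>+r. (\<integral>\<^sup>+s. F s * indicator {0..r} s * k r s * indicator {0..t} r \<partial>lborel) \<partial>lborel)"
    by (subst nn_integral_add) (auto simp: nn_integral_cmult)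
  also have "(\<integral>\<^sup>+r. (\<integral>\<^sup>+s. F s * indicator {0..r} s * k r s * indicator {0..t} r \<partial>lborel) \<partial>lborel)
     = (\<integral>\<^sup>+s. (\<integral>\<^sup>+r. F s * indicator {0..r} s * k r s * indicator {0..t} r \<partial>lborel) \<partial>lborel)"
    by (rule lborel_pair.Fubini') measurable
  also have "\<dots> = (\<integral>\<^sup>+s. F s * indicator {0..t} s * ?K s \<partial>lborel)"
  proof (rule nn_integral_cong)
    fix s
    have "F s * indicator {0..r} s * k r s * indicator {0..t} r = F s * indicator {0..t} s * (k r s * indicator {s..t} r)" for r
      by (auto simp: indicator_def)
    then show "(\<integral>\<^sup>+r. F s * indicator {0..r} s * k r s * indicator {0..t} r \<partial>lborel)
       = F s * indicator {0..t} s * ?K s"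
      by (simp add: nn_integral_cmult)
  qed
  finally have Y: "(\<integral>\<^sup>+r\<in>{0..t}. y r \<partial>lborel) = ennreal (cmod z) * (\<integral>\<^sup>+r\<in>{0..t}. k r 0 \<partial>lborel)
     + (\<integral>\<^sup>+s. F s * indicator {0..t} s * ?K s \<partial>lborel)" .
  have one: "k t s + ennreal lam * ?K s = 1" if "s \<le> t" for s
    using exp_kernel_integral[OF that lam(1)] unfolding k_def by simp
  \<comment> \<open>After the exchange of integrals each source \<open>F s\<close>, and likewise the
    datum at s = 0, is multiplied by the kernel at t plus \<open>lam\<close> times its integral over
    {s..t}, which is 1.\<close>
  have "y t + ennreal lam * (\<integral>\<^sup>+r\<in>{0..t}. y r \<partial>lborel)
     = ennreal (cmod z) * (k t 0 + ennreal lam * (\<integral>\<^sup>+r\<in>{0..t}. k r 0 \<partial>lborel))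
       + ((\<integral>\<^sup>+s. F s * indicator {0..t} s * k t s \<partial>lborel) + (\<integral>\<^sup>+s. ennreal lam * (F s * indicator {0..t} s * ?K s) \<partial>lborel))"
    unfolding Y unfolding y_def by (subst nn_integral_cmult[of _ lborel "ennreal lam"]) (measurable, simp add: algebra_simps)
  also have "\<dots> = ennreal (cmod z) + (\<integral>\<^sup>+s\<in>{0..t}. F s \<partial>lborel)"
  proof -
    have "(\<integral>\<^sup>+s. F s * indicator {0..t} s * k t s \<partial>lborel) + (\<integral>\<^sup>+s. ennreal lam * (F s * indicator {0..t} s * ?K s) \<partial>lborel)
       = (\<integral>\<^sup>+s. F s * indicator {0..t} s * k t s + ennreal lam * (F s * indicator {0..t} s * ?K s) \<partial>lborel)"
      by (subst nn_integral_add) auto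
    also have "\<dots> = (\<integral>\<^sup>+s\<in>{0..t}. F s \<partial>lborel)"
    proof (intro nn_integral_cong)
      fix s
      have "F s * indicator {0..t} s * k t s + ennreal lam * (F s * indicator {0..t} s * ?K s)
         = F s * indicator {0..t} s * (k t s + ennreal lam * ?K s)"
        by (simp add: algebra_simps)
      then show "F s * indicator {0..t} s * k t s + ennreal lam * (F s * indicator {0..t} s * ?K s)
         = F s * indicator {0..t} s" by (cases "0 \<le> s \<and> s \<le> t") (auto simp: one simp del: indicator_eq_0_iff)
    qed
    finally show ?thesis using one[of 0] t by simp
  qed
  finally have "y t + ennreal lam * (\<integral>\<^sup>+r\<in>{0..t}. y r \<partial>lborel) = ennreal (cmod z) + (\<integral>\<^sup>+s\<in>{0..t}. F s \<partial>lborel)" .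
  moreover have "?lhs
     \<le> y t + ennreal lam * (\<integral>\<^sup>+r\<in>{0..t}. y r \<partial>lborel)"
    using t by (intro add_mono le mult_left_mono nn_integral_mono) (auto simp: indicator_def le)
  ultimately show ?thesis by (simp add: F_def)
qed

subsection \<open>The fixed point\<close>

lemma measurable_pair_C:
  assumes "\<And>n. (\<lambda>t. f t n) \<in> measurable M K"
  shows "(\<lambda>(t, n). f t n) \<in> measurable (M \<Otimes>\<^sub>M C) K"
  unfolding case_prod_unfold
  by (rule measurable_compose_countable'[of UNIV "\<lambda>n x. f (fst x) n" "M \<Otimes>\<^sub>M C" K snd])
    (auto intro: measurable_compose[OF measurable_fst assms])

lemma wnorm_measurable:
  assumes [measurable]: "\<And>n. (\<lambda>t. w t n) \<in> borel_measurable M" "\<And>n. (\<lambda>t. u t n) \<in> borel_measurable M"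
  shows "(\<lambda>t. wnorm (w t) (u t)) \<in> borel_measurable M"
  unfolding wnorm_def
  by (rule C.borel_measurable_nn_integral, rule measurable_pair_C) measurable

lemma conv_measurable:
  assumes [measurable]: "\<And>n. (\<lambda>t. u t n) \<in> borel_measurable M" "\<And>n. (\<lambda>t. v t n) \<in> borel_measurable M"
  shows "(\<lambda>t. conv (u t) (v t) n) \<in> borel_measurable M"
  unfolding conv_def
  by (rule C.borel_measurable_lebesgue_integral, rule measurable_pair_C) measurable

lemma nonlin_measurable:
  assumes [measurable]: "\<And>n. (\<lambda>t. u t n) \<in> borel_measurable M"
  shows "(\<lambda>t. nonlin \<epsilon> \<beta> m (u t) n) \<in> borel_measurable M"
proof -
  have [measurable]: "(\<lambda>t. diag q (u t) n) \<in> borel_measurable M" for q n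
    unfolding diag_def by measurable
  have [measurable]: "(\<lambda>t. gam \<epsilon> (u t) n) \<in> borel_measurable M" for n
    unfolding gam_def by (intro borel_measurable_add borel_measurable_times conv_measurable assms) simp_all
  show ?thesis
    unfolding nonlin_def by (intro borel_measurable_add borel_measurable_times conv_measurable) (use assms in simp_all)
qed

text \<open>\<open>dpow j\<close> omits the powers of the imaginary unit, so odd j produces a sign
  under n -> -n; \<open>c\<close> carries that sign.\<close>

lemma conv_cnj:
  assumes "\<And>n. u (- n) = cnj (u n)" "\<And>n. v (- n) = c * cnj (v n)"
  shows "conv u v (- n) = c * cnj (conv u v n)"
proof -
  have "conv u v (- n) = (LINT k|C. u (- k) * v (- n - - k))"
    unfolding conv_def
    by (rule integral_bij_count_space[symmetric]) (auto simp: bij_betw_def inj_on_def surj_def intro: exI[of _ "- _"])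
  also have "\<dots> = (LINT k|C. c * cnj (u k * v (n - k)))"
    using assms(1) assms(2)[of "n - _"] by (intro LINT_cong) (auto simp: algebra_simps)
  also have "\<dots> = c * cnj (conv u v n)"
    unfolding conv_def by (simp del: complex_cnj_mult)
  finally show ?thesis .
qed

text \<open>The signs cancel because each term has an even total number of derivatives, counting
  those outside and inside the product. This keeps the solution real-valued.\<close>

lemma nonlin_cnj:
  assumes u: "\<And>n. u (- n) = cnj (u n)"
  shows "nonlin \<epsilon> \<beta> m u (- n) = cnj (nonlin \<epsilon> \<beta> m u n)"
proof -
  have d: "dpow j u (- n) = (- 1) ^ j * cnj (dpow j u n)" for j n
    by (simp add: diag_def u power_minus[of "of_int n"])
  have uu: "conv u u (- n) = cnj (conv u u n)" for n using conv_cnj[of u u 1] u by simp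
  have uuu: "conv (conv u u) u (- n) = cnj (conv (conv u u) u n)" for n using conv_cnj[of "conv u u" u 1] u uu by simp
  have g: "gam \<epsilon> u (- n) = cnj (gam \<epsilon> u n)" for n by (simp add: gam_def u uu uuu)
  have "conv u (dpow j u) (- n) = (- 1) ^ j * cnj (conv u (dpow j u) n)" for j
    by (rule conv_cnj) (rule u, rule d)
  moreover have "conv (gam \<epsilon> u) (dpow j u) (- n) = (- 1) ^ j * cnj (conv (gam \<epsilon> u) (dpow j u) n)" for j
    by (rule conv_cnj) (rule g, rule d)
  ultimately show ?thesis unfolding nonlin_def by (simp only:) simp
qed

lemma duhamel_cnj:
  assumes "\<And>s. f' s = cnj (f s)"
  shows "duhamel L (cnj z) f' t = cnj (duhamel L z f t)"
proof -
  have "(if 0 \<le> s \<and> s \<le> t then of_real (exp (- L * (t - s))) * f' s else 0)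
     = cnj (if 0 \<le> s \<and> s \<le> t then of_real (exp (- L * (t - s))) * f s else 0)" for s
    by (simp add: assms)
  then show ?thesis unfolding duhamel_def by simp
qed

lemma duhamel_integrable:
  fixes h :: "real \<Rightarrow> complex"
  assumes "integrable lborel h" and l: "0 \<le> l"
  shows "integrable lborel (\<lambda>s. if 0 \<le> s \<and> s \<le> t then of_real (exp (- l * (t - s))) * h s else 0)"
proof (rule Bochner_Integration.integrable_bound[OF assms(1)])
  have [measurable]: "h \<in> borel_measurable borel" using borel_measurable_integrable[OF assms(1)] by simp
  show "(\<lambda>s. if 0 \<le> s \<and> s \<le> t then of_real (exp (- l * (t - s))) * h s else 0) \<in> borel_measurable lborel"
    by measurable
  have "cmod (if 0 \<le> s \<and> s \<le> t then of_real (exp (- l * (t - s))) * h s else 0) \<le> cmod (h s)" for s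
  proof (cases "0 \<le> s \<and> s \<le> t")
    case True
    then have "exp (- l * (t - s)) * cmod (h s) \<le> 1 * cmod (h s)"
      using l by (intro mult_right_mono) auto
    then show ?thesis using True by (simp add: norm_mult)
  qed auto
  then show "AE s in lborel. cmod (if 0 \<le> s \<and> s \<le> t then of_real (exp (- l * (t - s))) * h s else 0) \<le> cmod (h s)"
    by (rule AE_I2)
qed

lemma duhamel_diff:
  assumes "integrable lborel f" "integrable lborel g" and l: "0 \<le> l"
  shows "duhamel l y f t - duhamel l y g t = duhamel l 0 (\<lambda>s. f s - g s) t"
proof (cases "t < 0")
  case False
  have "(LINT s|lborel. (if 0 \<le> s \<and> s \<le> t then of_real (exp (- l * (t - s))) * (f s - g s) else 0))
    = (LINT s|lborel. (if 0 \<le> s \<and> s \<le> t then of_real (exp (- l * (t - s))) * f s else 0) - (if 0 \<le> s \<and> s \<le> t then of_real (exp (- l * (t - s))) * g s else 0))"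
    by (rule LINT_cong) (simp_all add: right_diff_distrib)
  also have "\<dots> = (LINT s|lborel. (if 0 \<le> s \<and> s \<le> t then of_real (exp (- l * (t - s))) * f s else 0)) - (LINT s|lborel. (if 0 \<le> s \<and> s \<le> t then of_real (exp (- l * (t - s))) * g s else 0))"
    by (intro Bochner_Integration.integral_diff duhamel_integrable assms)
  finally show ?thesis using False by (simp only: duhamel_def if_False mult_zero_right add_0 add_diff_cancel_left)
qed (simp add: duhamel_def)

lemma nonlin_at_0 [simp]: "nonlin \<epsilon> \<beta> m u 0 = 0"
  by (simp add: nonlin_def)

lemma conv_zero [simp]: "conv u (\<lambda>_. 0) = (\<lambda>_. 0)" "conv (\<lambda>_. 0) u = (\<lambda>_. 0)"
  by (simp_all add: conv_def fun_eq_iff)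

lemma gam_zero [simp]: "gam \<epsilon> (\<lambda>_. 0) = (\<lambda>_. 0)"
  by (simp add: gam_def fun_eq_iff)

lemma diag_zero [simp]: "diag q (\<lambda>_. 0) = (\<lambda>_. 0)"
  by (simp add: diag_def fun_eq_iff)

lemma nonlin_zero [simp]: "nonlin \<epsilon> \<beta> m (\<lambda>_. 0) = (\<lambda>_. 0)"
  by (simp add: nonlin_def fun_eq_iff)

lemma wnorm_zero [simp]: "wnorm w (\<lambda>_. 0) = 0"
  by (simp add: wnorm_def)

text \<open>Monotone convergence turns bounds on {0..t} that are uniform in t into a bound on the
  half-line; this is how the estimates become global in time.\<close>

lemma nn_integral_le_Icc:
  fixes f :: "real \<Rightarrow> ennreal"
  assumes [measurable]: "f \<in> borel_measurable borel" and neg: "\<And>t. t < 0 \<Longrightarrow> f t = 0"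
    and b: "\<And>t. 0 \<le> t \<Longrightarrow> (\<integral>\<^sup>+s\<in>{0..t}. f s \<partial>lborel) \<le> c"
  shows "(\<integral>\<^sup>+s. f s \<partial>lborel) \<le> c"
proof -
  have "f s = (SUP k. f s * indicator {0..real k} s)" for s
  proof (cases "s < 0")
    case False
    obtain k where "s \<le> real k" using real_arch_simple by blast
    then have "f s \<le> (SUP k. f s * indicator {0..real k} s)"
      using False by (intro SUP_upper2[of k]) (auto simp: indicator_def)
    moreover have "(SUP k. f s * indicator {0..real k} s) \<le> f s"
      by (intro SUP_least) (auto simp: indicator_def)
    ultimately show ?thesis by (rule antisym)
  qed (simp add: neg)
  then have "(\<integral>\<^sup>+s. f s \<partial>lborel) = (\<integral>\<^sup>+s. (SUP k. f s * indicator {0..real k} s) \<partial>lborel)" by metis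
  also have "\<dots> = (SUP k. \<integral>\<^sup>+s. f s * indicator {0..real k} s \<partial>lborel)"
    by (intro nn_integral_monotone_convergence_SUP) (auto simp: incseq_def le_fun_def indicator_def)
  also have "\<dots> \<le> c" by (intro SUP_least b) simp
  finally show ?thesis .
qed

section \<open>The Cauchy problem in Fourier variables\<close>

locale thin_film =
  fixes \<epsilon> \<beta> m \<delta> z :: real and zh :: "int \<Rightarrow> complex"
  assumes \<epsilon>: "0 < \<epsilon>" and \<beta>: "0 \<le> \<beta>" and m: "0 \<le> m" and \<delta>: "0 < \<delta>" "\<delta> = \<beta> - m"
    and z: "0 \<le> z" "l1norm zh = ennreal z"
    and zh0: "zh 0 = 0" and zh_cnj: "zh (- n) = cnj (zh n)"
    and small: "\<epsilon> * z * (1 + \<beta> + 55 / 2 * m) \<le> \<delta> / 128"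
begin

definition L :: "int \<Rightarrow> real" where "L n = real_of_int n ^ 2 + \<delta> * real_of_int n ^ 4"
definition \<theta> :: "int \<Rightarrow> real" where "\<theta> n = \<delta> / 2 * \<bar>real_of_int n\<bar> + \<delta> / 64"
text \<open>\<open>max 0 t\<close> keeps the weight at least 1 for every real t, so the weight
  locale can be instantiated without a sign condition on time.\<close>

definition W :: "real \<Rightarrow> int \<Rightarrow> real" where "W t n = exp (\<theta> n * max 0 t)"
text \<open>What is left of the dissipation \<open>\<delta> n\<^sup>4\<close> after paying for the growth rate \<open>\<theta> n\<close> of the weight
  (for \<open>n \<noteq> 0\<close>; the zeroth mode vanishes identically).\<close>

definition \<kappa> :: real where "\<kappa> = 31 / 64 * \<delta>"

sublocale W: fourier_weight "W t" for t
proof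
  show "1 \<le> W t n" for n using \<delta>(1) unfolding W_def \<theta>_def by (intro one_le_exp_iff[THEN iffD2] mult_nonneg_nonneg) auto
  have "\<theta> (k + l) \<le> \<theta> k + \<theta> l" for k l
  proof -
    have "\<delta> / 2 * \<bar>real_of_int (k + l)\<bar> \<le> \<delta> / 2 * (\<bar>real_of_int k\<bar> + \<bar>real_of_int l\<bar>)"
      using \<delta>(1) by (intro mult_left_mono) auto
    then show ?thesis unfolding \<theta>_def distrib_left using \<delta>(1) by linarith
  qed
  then show "W t (k + l) \<le> W t k * W t l" for k l
    unfolding W_def exp_add[symmetric] by (simp add: distrib_right[symmetric] mult_right_mono)
qed

abbreviation S :: "real \<Rightarrow> (int \<Rightarrow> complex) \<Rightarrow> ennreal" where "S t \<equiv> wnorm (W t)"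
abbreviation H :: "real \<Rightarrow> (int \<Rightarrow> complex) \<Rightarrow> ennreal" where "H t \<equiv> wnorm (\<lambda>n. of_int n ^ 4 * W t n)"
abbreviation N :: "(int \<Rightarrow> complex) \<Rightarrow> int \<Rightarrow> complex" where "N \<equiv> nonlin \<epsilon> \<beta> m"

definition Phi :: "(int \<Rightarrow> complex) \<Rightarrow> (real \<Rightarrow> int \<Rightarrow> complex) \<Rightarrow> real \<Rightarrow> int \<Rightarrow> complex" where
  "Phi y f t n = duhamel (L n) (y n) (\<lambda>s. f s n) t"

lemma kappa_pos: "0 < \<kappa>" using \<delta>(1) by (simp add: \<kappa>_def)

lemma W_measurable [measurable]: "(\<lambda>t. W t n) \<in> borel_measurable borel"
  unfolding W_def by measurable

lemma S_measurable:
  assumes "\<And>n. (\<lambda>t. u t n) \<in> borel_measurable borel"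
  shows "(\<lambda>t. S t (u t)) \<in> borel_measurable borel" "(\<lambda>t. H t (u t)) \<in> borel_measurable borel"
  by (intro wnorm_measurable; use assms in simp)+

text \<open>For a nonzero integer both |n| and 1 are at most n^4, so the growth rate of the weight
  costs at most (1/2 + 1/64) \<delta> n^4. Of \<delta> n^4 there remain 31/64, and the n^2 in
  \<open>L\<close> is only used as nonnegative.\<close>

lemma dissipation:
  assumes "n \<noteq> 0"
  shows "\<kappa> * real_of_int n ^ 4 \<le> L n - \<theta> n"
proof -
  have 1: "1 \<le> \<bar>real_of_int n\<bar>" using assms by linarith
  then have "\<bar>real_of_int n\<bar> ^ 1 \<le> \<bar>real_of_int n\<bar> ^ 4" by (intro power_increasing) auto
  then have "\<bar>real_of_int n\<bar> \<le> real_of_int n ^ 4" by simp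
  then have "\<delta> / 2 * \<bar>real_of_int n\<bar> \<le> \<delta> / 2 * real_of_int n ^ 4" "\<delta> / 64 * 1 \<le> \<delta> / 64 * real_of_int n ^ 4"
    using \<delta>(1) 1 by (intro mult_left_mono; simp)+
  then have "\<kappa> * real_of_int n ^ 4 + \<theta> n \<le> \<delta> * real_of_int n ^ 4"
    unfolding \<kappa>_def \<theta>_def by (simp add: field_simps)
  then show ?thesis unfolding L_def using zero_le_power2[of "real_of_int n"] by linarith
qed

lemma Phi_measurable:
  assumes "\<And>n. (\<lambda>s. f s n) \<in> borel_measurable borel"
  shows "(\<lambda>t. Phi y f t n) \<in> borel_measurable borel"
  unfolding Phi_def by (rule duhamel_measurable) (rule assms)

lemma Phi_0: "y 0 = 0 \<Longrightarrow> (\<And>s. f s 0 = 0) \<Longrightarrow> Phi y f t 0 = 0"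
  by (simp add: Phi_def duhamel_def cong: if_cong)

text \<open>The scalar energy inequality is applied with rate \<kappa> n^4 in mode n and summed;
  Tonelli exchanges the sum with the time integrals, and the factor n^4 turns \<open>S\<close> into
  \<open>H\<close>.\<close>

lemma Phi_energy:
  assumes [measurable]: "\<And>n. (\<lambda>s. f s n) \<in> borel_measurable borel"
    and y0: "y 0 = 0" and f0: "\<And>s. f s 0 = 0" and t: "0 \<le> t"
  shows "S t (Phi y f t) + ennreal \<kappa> * (\<integral>\<^sup>+s\<in>{0..t}. H s (Phi y f s) \<partial>lborel)
    \<le> l1norm y + (\<integral>\<^sup>+s\<in>{0..t}. S s (f s) \<partial>lborel)"
proof -
  define E where "E s n = ennreal (W s n * cmod (Phi y f s n))" for s n
  define G where "G s n = ennreal (W s n * cmod (f s n))" for s n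
  have [measurable]: "(\<lambda>s. Phi y f s n) \<in> borel_measurable borel" for n by (rule Phi_measurable) measurable
  have [measurable]: "(\<lambda>s. E s n) \<in> borel_measurable borel" "(\<lambda>s. G s n) \<in> borel_measurable borel" for n
    unfolding E_def G_def by measurable
  have mode: "E t n + ennreal (\<kappa> * real_of_int n ^ 4) * (\<integral>\<^sup>+s\<in>{0..t}. E s n \<partial>lborel)
      \<le> ennreal (1 * cmod (y n)) + (\<integral>\<^sup>+s\<in>{0..t}. G s n \<partial>lborel)" for n
  \<comment> \<open>The mean is treated apart: \<open>L 0 = 0\<close> while
    \<open>\<theta> 0 = \<delta> / 64\<close> is positive, so the dissipation estimate fails at n =
    0.\<close>
  proof (cases "n = 0")
    case True
    then show ?thesis by (simp add: E_def Phi_0 y0 f0)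
  next
    case False
    have "0 \<le> \<kappa> * real_of_int n ^ 4" using kappa_pos by simp
    from duhamel_energy[OF _ this dissipation[OF False] t, of "\<lambda>s. f s n" "y n"]
    have "ennreal (exp (\<theta> n * t) * cmod (Phi y f t n)) +
      ennreal (\<kappa> * real_of_int n ^ 4) * (\<integral>\<^sup>+s\<in>{0..t}. ennreal (exp (\<theta> n * s) * cmod (Phi y f s n)) \<partial>lborel)
     \<le> ennreal (cmod (y n)) + (\<integral>\<^sup>+s\<in>{0..t}. ennreal (exp (\<theta> n * s) * cmod (f s n)) \<partial>lborel)"
      unfolding Phi_def by simp
    moreover have "(\<integral>\<^sup>+s\<in>{0..t}. ennreal (exp (\<theta> n * s) * cmod (g s n)) \<partial>lborel)
        = (\<integral>\<^sup>+s\<in>{0..t}. ennreal (W s n * cmod (g s n)) \<partial>lborel)" for g :: "real \<Rightarrow> int \<Rightarrow> complex"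
      by (intro nn_integral_cong) (auto simp: W_def indicator_def)
    ultimately show ?thesis using t by (simp add: E_def G_def W_def)
  qed
  interpret P: pair_sigma_finite lborel C ..
  have H: "H s (Phi y f s) = (\<integral>\<^sup>+n. ennreal (real_of_int n ^ 4) * E s n \<partial>C)" for s
    unfolding wnorm_def E_def by (intro nn_integral_cong) (simp add: ennreal_mult'[symmetric] mult.assoc)
  have "(\<integral>\<^sup>+s\<in>{0..t}. H s (Phi y f s) \<partial>lborel) = (\<integral>\<^sup>+s. (\<integral>\<^sup>+n. ennreal (real_of_int n ^ 4) * E s n * indicator {0..t} s \<partial>C) \<partial>lborel)"
    unfolding H by (intro nn_integral_cong) (simp add: nn_integral_multc)
  also have "\<dots> = (\<integral>\<^sup>+n. (\<integral>\<^sup>+s\<in>{0..t}. ennreal (real_of_int n ^ 4) * E s n \<partial>lborel) \<partial>C)"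
    by (rule P.Fubini'[symmetric], rule measurable_pair_C) measurable
  also have "\<dots> = (\<integral>\<^sup>+n. ennreal (real_of_int n ^ 4) * (\<integral>\<^sup>+s\<in>{0..t}. E s n \<partial>lborel) \<partial>C)"
    by (intro nn_integral_cong) (simp add: nn_integral_cmult mult.assoc)
  finally have "S t (Phi y f t) + ennreal \<kappa> * (\<integral>\<^sup>+s\<in>{0..t}. H s (Phi y f s) \<partial>lborel)
     = (\<integral>\<^sup>+n. E t n + ennreal \<kappa> * (ennreal (real_of_int n ^ 4) * (\<integral>\<^sup>+s\<in>{0..t}. E s n \<partial>lborel)) \<partial>C)"
    by (simp add: nn_integral_add nn_integral_cmult wnorm_def E_def)
  also have "\<dots> = (\<integral>\<^sup>+n. E t n + ennreal (\<kappa> * real_of_int n ^ 4) * (\<integral>\<^sup>+s\<in>{0..t}. E s n \<partial>lborel) \<partial>C)"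
    using kappa_pos by (simp add: ennreal_mult mult.assoc)
  also have "\<dots> \<le> (\<integral>\<^sup>+n. ennreal (1 * cmod (y n)) + (\<integral>\<^sup>+s\<in>{0..t}. G s n \<partial>lborel) \<partial>C)"
    by (intro nn_integral_mono mode)
  also have "\<dots> = l1norm y + (\<integral>\<^sup>+n. (\<integral>\<^sup>+s\<in>{0..t}. G s n \<partial>lborel) \<partial>C)"
    by (simp add: nn_integral_add wnorm_def)
  also have "(\<integral>\<^sup>+n. (\<integral>\<^sup>+s\<in>{0..t}. G s n \<partial>lborel) \<partial>C) = (\<integral>\<^sup>+s. (\<integral>\<^sup>+n. G s n * indicator {0..t} s \<partial>C) \<partial>lborel)"
    by (rule P.Fubini', rule measurable_pair_C) measurable
  also have "\<dots> = (\<integral>\<^sup>+s\<in>{0..t}. S s (f s) \<partial>lborel)"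
    unfolding wnorm_def G_def by (intro nn_integral_cong) (simp add: nn_integral_multc)
  finally show ?thesis .
qed

text \<open>The closed ball of radius \<open>r\<close>: the supremum of \<open>S\<close> and
  \<kappa> times the time integral of \<open>H\<close> are bounded by \<open>r\<close> separately. A
  predicate with a real radius avoids building a normed space of trajectories, and the side
  conditions needed to apply the Duhamel estimate again travel with it.\<close>

definition good :: "(real \<Rightarrow> int \<Rightarrow> complex) \<Rightarrow> real \<Rightarrow> bool" where
  "good a r \<longleftrightarrow> 0 \<le> r \<and> (\<forall>n. (\<lambda>t. a t n) \<in> borel_measurable borel) \<and> (\<forall>t. a t 0 = 0) \<and> (\<forall>t n. t < 0 \<longrightarrow> a t n = 0) \<and>
     (\<forall>t. S t (a t) \<le> ennreal r) \<and> (\<integral>\<^sup>+s. H s (a s) \<partial>lborel) \<le> ennreal (r / \<kappa>)"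

lemma good_measurable: "good a r \<Longrightarrow> (\<lambda>t. a t n) \<in> borel_measurable borel"
  by (simp add: good_def)

lemma good_zero: "0 \<le> r \<Longrightarrow> good (\<lambda>_ _. 0) r"
  using kappa_pos by (simp add: good_def)

lemma good_add:
  assumes "good a r" "good b r'"
  shows "good (\<lambda>t n. a t n + b t n) (r + r')"
proof -
  have [measurable]: "(\<lambda>t. a t n) \<in> borel_measurable borel" "(\<lambda>t. b t n) \<in> borel_measurable borel" for n
    using assms by (auto simp: good_def)
  have r: "0 \<le> r" "0 \<le> r'" using assms by (auto simp: good_def)
  have "S t (\<lambda>n. a t n + b t n) \<le> ennreal (r + r')" for t
  proof -
    have "S t (\<lambda>n. a t n + b t n) \<le> S t (a t) + S t (b t)" by (rule wnorm_add_le) simp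
    also have "\<dots> \<le> ennreal r + ennreal r'" using assms by (intro add_mono) (auto simp: good_def)
    finally show ?thesis using r by simp
  qed
  moreover have "(\<integral>\<^sup>+s. H s (\<lambda>n. a s n + b s n) \<partial>lborel) \<le> ennreal ((r + r') / \<kappa>)"
  proof -
    have "(\<integral>\<^sup>+s. H s (\<lambda>n. a s n + b s n) \<partial>lborel) \<le> (\<integral>\<^sup>+s. H s (a s) + H s (b s) \<partial>lborel)"
      by (intro nn_integral_mono wnorm_add_le) simp
    also have "\<dots> = (\<integral>\<^sup>+s. H s (a s) \<partial>lborel) + (\<integral>\<^sup>+s. H s (b s) \<partial>lborel)"
      by (intro nn_integral_add) (simp_all add: S_measurable)
    also have "\<dots> \<le> ennreal (r / \<kappa>) + ennreal (r' / \<kappa>)"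
      using assms by (intro add_mono) (auto simp: good_def)
    also have "\<dots> = ennreal ((r + r') / \<kappa>)"
      using r kappa_pos by (simp add: ennreal_plus[symmetric] add_divide_distrib del: ennreal_plus)
    finally show ?thesis .
  qed
  ultimately show ?thesis using assms r by (auto simp: good_def)
qed

lemma good_mono: "good a r \<Longrightarrow> r \<le> r' \<Longrightarrow> good a r'"
proof -
  assume a: "good a r" "r \<le> r'"
  have "r / \<kappa> \<le> r' / \<kappa>" using a kappa_pos by (intro divide_right_mono) auto
  then show ?thesis
    using a unfolding good_def by (auto elim!: order_trans intro!: ennreal_leI)
qed

lemma good_norm:
  assumes "good a r"
  shows "cmod (a t n) \<le> r"
proof -
  have "ennreal (cmod (a t n)) \<le> ennreal (W t n * cmod (a t n))"
    using W.W_ge1[of t n] by (intro ennreal_leI) (simp add: mult_le_cancel_right1)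
  also have "\<dots> \<le> S t (a t)" by (rule norm_le_wnorm)
  also have "\<dots> \<le> ennreal r" using assms by (simp add: good_def)
  finally show ?thesis using assms by (simp add: good_def)
qed

lemma good_Phi:
  assumes f: "\<And>n. (\<lambda>s. f s n) \<in> borel_measurable borel"
    and y0: "y 0 = 0" and f0: "\<And>s. f s 0 = 0" and r: "0 \<le> r"
    and b: "l1norm y + (\<integral>\<^sup>+s. S s (f s) \<partial>lborel) \<le> ennreal r"
  shows "good (Phi y f) r"
proof -
  let ?I = "\<lambda>t. \<integral>\<^sup>+s\<in>{0..t}. H s (Phi y f s) \<partial>lborel"
  have meas: "(\<lambda>t. Phi y f t n) \<in> borel_measurable borel" for n by (rule Phi_measurable[OF f])
  have neg: "Phi y f t = (\<lambda>_. 0)" if "t < 0" for t using that by (simp add: Phi_def duhamel_def fun_eq_iff)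
  have E: "S t (Phi y f t) + ennreal \<kappa> * ?I t \<le> ennreal r" if "0 \<le> t" for t
  proof -
    have "(\<integral>\<^sup>+s\<in>{0..t}. S s (f s) \<partial>lborel) \<le> (\<integral>\<^sup>+s. S s (f s) \<partial>lborel)"
      by (intro nn_integral_mono) (auto simp: indicator_def)
    then show ?thesis
      using Phi_energy[of f y t, OF f y0 f0 that] b by (meson add_left_mono order_trans)
  qed
  have S: "S t (Phi y f t) \<le> ennreal r" for t
  proof (cases "t < 0")
    case False
    have "S t (Phi y f t) \<le> S t (Phi y f t) + ennreal \<kappa> * ?I t" by simp
    also have "\<dots> \<le> ennreal r" using False by (intro E) simp
    finally show ?thesis .
  qed (simp add: neg)
  have "(\<integral>\<^sup>+s. H s (Phi y f s) \<partial>lborel) \<le> ennreal (r / \<kappa>)"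
  proof (rule nn_integral_le_Icc)
    show "(\<lambda>s. H s (Phi y f s)) \<in> borel_measurable borel" by (intro S_measurable meas)
    show "H t (Phi y f t) = 0" if "t < 0" for t using that by (simp add: neg)
    fix t :: real assume "0 \<le> t"
    have "ennreal \<kappa> * ?I t \<le>
      S t (Phi y f t) + ennreal \<kappa> * ?I t" by simp
    also have "\<dots> \<le> ennreal r" by (rule E[OF \<open>0 \<le> t\<close>])
    finally have "ennreal (1 / \<kappa>) * (ennreal \<kappa> * ?I t) \<le> ennreal (1 / \<kappa>) * ennreal r"
      by (rule mult_left_mono) simp
    then show "?I t \<le> ennreal (r / \<kappa>)"
      using kappa_pos r by (simp add: mult.assoc[symmetric] ennreal_mult[symmetric])
  qed
  then show ?thesis using r meas S neg Phi_0[of y f, OF y0 f0] by (auto simp: good_def)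
qed

section \<open>Contraction of the Duhamel map by one half\<close>

lemma small': "16 * \<epsilon> * (1 + \<beta> + 55 / 2 * m) * z \<le> \<delta> / 8"
  using small by (simp add: mult_ac)

text \<open>Since \<delta> = \<beta> - m does not exceed \<open>K\<close>, smallness forces
  \<epsilon> z \<le> 1/128. For the ball of radius 2z this is the bound \<epsilon> R \<le> 1/64
  under which the terms of higher order were absorbed.\<close>

lemma \<epsilon>_z: "\<epsilon> * (2 * z) \<le> 1 / 64"
proof -
  define K where "K = 1 + \<beta> + 55 / 2 * m"
  have K: "\<delta> \<le> K" using \<delta> m unfolding K_def by linarith
  then have "(\<epsilon> * z) * K \<le> (1 / 128) * K" using small unfolding K_def[symmetric] by linarith
  then have "\<epsilon> * z \<le> 1 / 128" using K \<delta>(1) by (simp add: mult_le_cancel_right)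
  then show ?thesis by simp
qed

text \<open>The Lipschitz bound at a single time. Finiteness of \<open>H\<close> permits the passage
  to real bounds and holds at almost every time, by integrability.\<close>

lemma nonlin_pointwise:
  assumes "good a (2 * z)" "good b (2 * z)" "good (\<lambda>t n. a t n - b t n) r"
    and fin: "H s (a s) < \<infinity>" "H s (b s) < \<infinity>" "H s (\<lambda>n. a s n - b s n) < \<infinity>"
  shows "S s (\<lambda>n. N (a s) n - N (b s) n) \<le> ennreal (2 * \<epsilon> * (1 + \<beta> + 55 / 2 * m)) *
    (ennreal r * (H s (a s) + H s (b s)) + ennreal (4 * z) * H s (\<lambda>n. a s n - b s n))"
proof -
  obtain ha where ha: "H s (a s) = ennreal ha" "0 \<le> ha" using fin(1) by (cases "H s (a s)") auto
  obtain hb where hb: "H s (b s) = ennreal hb" "0 \<le> hb" using fin(2) by (cases "H s (b s)") auto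
  obtain hd' where hd': "H s (\<lambda>n. a s n - b s n) = ennreal hd'" "0 \<le> hd'"
    using fin(3) by (cases "H s (\<lambda>n. a s n - b s n)") auto
  note h = ha hb hd'
  have r: "0 \<le> r" using assms(3) by (simp add: good_def)
  have "S s (\<lambda>n. N (a s) n - N (b s) n) \<le> ennreal (2 * \<epsilon> * (1 + \<beta> + 55 / 2 * m) * (r * (ha + hb) + (2 * z + 2 * z) * hd'))"
  proof (rule W.nonlin_diff[where R = "2 * z"])
    show "W.bnd s (a s) (2 * z) ha" "W.bnd s (b s) (2 * z) hb" "W.bnd s (\<lambda>n. a s n - b s n) r hd'"
      using assms(1-3) h by (simp_all add: W.bnd_def good_def)
  qed (use \<epsilon> \<beta> m \<epsilon>_z in simp_all)
  also have "\<dots> = ennreal (2 * \<epsilon> * (1 + \<beta> + 55 / 2 * m)) * (ennreal r * (H s (a s) + H s (b s)) + ennreal (4 * z) * H s (\<lambda>n. a s n - b s n))"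
  proof -
    have "ennreal (A * (B * (c + d) + (D + D) * e)) = ennreal A * (ennreal B * (ennreal c + ennreal d) + ennreal (D + D) * ennreal e)"
      if "0 \<le> A" "0 \<le> B" "0 \<le> c" "0 \<le> d" "0 \<le> D" "0 \<le> e" for A B c d D e
      using that by (simp only: ennreal_mult ennreal_plus mult_nonneg_nonneg add_nonneg_nonneg)
    from this[of "2 * \<epsilon> * (1 + \<beta> + 55 / 2 * m)" r ha hb "2 * z" hd'] show ?thesis
      unfolding h using h r z \<epsilon> \<beta> m by simp
  qed
  finally show ?thesis .
qed

lemma good_AE_finite:
  assumes "good a r"
  shows "AE s in lborel. H s (a s) < \<infinity>"
proof -
  have "(\<lambda>s. H s (a s)) \<in> borel_measurable lborel"
    using S_measurable(2)[of a] assms by (simp add: good_def)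
  moreover have "(\<integral>\<^sup>+s. H s (a s) \<partial>lborel) \<noteq> \<infinity>"
    using assms by (auto simp: good_def top_unique)
  ultimately show ?thesis using nn_integral_noteq_infinite[of "\<lambda>s. H s (a s)" lborel] by (simp add: top.not_eq_extremum)
qed

lemma nonlin_time:
  assumes ab: "good a (2 * z)" "good b (2 * z)" "good (\<lambda>t n. a t n - b t n) r"
  shows "(\<integral>\<^sup>+s. S s (\<lambda>n. N (a s) n - N (b s) n) \<partial>lborel) \<le> ennreal (r / 2)"
proof -
  have r: "0 \<le> r" using ab(3) by (simp add: good_def)
  define K where "K = 1 + \<beta> + 55 / 2 * m"
  have K: "0 \<le> K" unfolding K_def using \<beta> m by simp
  have meas: "(\<lambda>s. H s (a s)) \<in> borel_measurable lborel" "(\<lambda>s. H s (b s)) \<in> borel_measurable lborel"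
    "(\<lambda>s. H s (\<lambda>n. a s n - b s n)) \<in> borel_measurable lborel"
    using S_measurable(2)[of a] S_measurable(2)[of b] S_measurable(2)[of "\<lambda>t n. a t n - b t n"] ab by (auto simp: good_def)
  have "(\<integral>\<^sup>+s. S s (\<lambda>n. N (a s) n - N (b s) n) \<partial>lborel)
     \<le> (\<integral>\<^sup>+s. ennreal (2 * \<epsilon> * K) * (ennreal r * (H s (a s) + H s (b s)) + ennreal (4 * z) * H s (\<lambda>n. a s n - b s n)) \<partial>lborel)"
  proof (rule nn_integral_mono_AE)
    show "AE s in lborel. S s (\<lambda>n. N (a s) n - N (b s) n) \<le> ennreal (2 * \<epsilon> * K) * (ennreal r * (H s (a s) + H s (b s)) + ennreal (4 * z) * H s (\<lambda>n. a s n - b s n))"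
      using good_AE_finite[OF ab(1)] good_AE_finite[OF ab(2)] good_AE_finite[OF ab(3)]
      by eventually_elim (unfold K_def, intro nonlin_pointwise ab)
  qed
  also have "\<dots> = ennreal (2 * \<epsilon> * K) * (ennreal r * ((\<integral>\<^sup>+s. H s (a s) \<partial>lborel) + (\<integral>\<^sup>+s. H s (b s) \<partial>lborel))
      + ennreal (4 * z) * (\<integral>\<^sup>+s. H s (\<lambda>n. a s n - b s n) \<partial>lborel))"
    using meas by (simp add: nn_integral_cmult nn_integral_add)
  also have "\<dots> \<le> ennreal (2 * \<epsilon> * K) * (ennreal r * (ennreal (2 * z / \<kappa>) + ennreal (2 * z / \<kappa>)) + ennreal (4 * z) * ennreal (r / \<kappa>))"
    using ab by (intro mult_left_mono add_mono) (auto simp: good_def)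
  also have "\<dots> = ennreal (2 * \<epsilon> * K * (r * (2 * z / \<kappa> + 2 * z / \<kappa>) + 4 * z * (r / \<kappa>)))"
  proof -
    have "ennreal A * (ennreal B * (ennreal c + ennreal c) + ennreal d * ennreal e) = ennreal (A * (B * (c + c) + d * e))"
      if "0 \<le> A" "0 \<le> B" "0 \<le> c" "0 \<le> d" "0 \<le> e" for A B c d e
      using that by (simp only: ennreal_mult ennreal_plus mult_nonneg_nonneg add_nonneg_nonneg)
    then show ?thesis using r z(1) \<epsilon> K kappa_pos by simp
  qed
  also have "\<dots> \<le> ennreal (r / 2)"
  proof (rule ennreal_leI)
    \<comment> \<open>The two integrals of \<open>H\<close> contribute 4z, the two bounds on
      \<open>S\<close> another 4z; with 2 \<epsilon> K in front this is 16 \<epsilon> K z \<le>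
      \<delta>/8. Divided by \<kappa> = 31/64 \<delta>, the contraction factor is 8/31.\<close>
    have "2 * \<epsilon> * K * (r * (2 * z / \<kappa> + 2 * z / \<kappa>) + 4 * z * (r / \<kappa>)) = (16 * \<epsilon> * K * z) * (r / \<kappa>)"
      by (simp add: field_simps)
    also have "\<dots> \<le> \<delta> / 8 * (r / \<kappa>)"
      using small' r kappa_pos unfolding K_def by (intro mult_right_mono) auto
    also have "\<dots> = 8 / 31 * r" using \<delta>(1) unfolding \<kappa>_def by (simp add: field_simps)
    also have "\<dots> \<le> r / 2" using r by simp
    finally show "2 * \<epsilon> * K * (r * (2 * z / \<kappa> + 2 * z / \<kappa>) + 4 * z * (r / \<kappa>)) \<le> r / 2" .
  qed
  finally show ?thesis .
qed

text \<open>Comparison with the zero trajectory, where \<open>N\<close> vanishes: the contraction by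
  one half takes the radius 2z to z.\<close>

lemma nonlin_L1:
  assumes "good a (2 * z)"
  shows "(\<integral>\<^sup>+s. S s (N (a s)) \<partial>lborel) \<le> ennreal z"
proof -
  have "good (\<lambda>t n. a t n - 0) (2 * z)" using assms by simp
  from nonlin_time[OF assms good_zero this] show ?thesis using z(1) by simp
qed

lemma L_nonneg: "0 \<le> L n" using \<delta>(1) by (simp add: L_def)

lemma mode_integrable:
  assumes f: "\<And>n. (\<lambda>s. f s n) \<in> borel_measurable borel" and b: "(\<integral>\<^sup>+s. S s (f s) \<partial>lborel) < \<infinity>"
  shows "integrable lborel (\<lambda>s. f s n)"
proof (rule integrableI_bounded)
  have "(\<integral>\<^sup>+s. ennreal (cmod (f s n)) \<partial>lborel) \<le> (\<integral>\<^sup>+s. S s (f s) \<partial>lborel)"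
  proof (rule nn_integral_mono)
    fix s
    have "ennreal (cmod (f s n)) \<le> ennreal (W s n * cmod (f s n))"
      using W.W_ge1[of s n] by (intro ennreal_leI) (simp add: mult_le_cancel_right1)
    also have "\<dots> \<le> S s (f s)" by (rule norm_le_wnorm)
    finally show "ennreal (cmod (f s n)) \<le> S s (f s)" .
  qed
  then show "(\<integral>\<^sup>+s. ennreal (norm (f s n)) \<partial>lborel) < \<infinity>" using b by (simp add: order_le_less_trans)
qed (use f in simp)

lemma nonlin_good_measurable: "good a r \<Longrightarrow> (\<lambda>s. N (a s) n) \<in> borel_measurable borel"
  by (rule nonlin_measurable) (rule good_measurable)

text \<open>The datum cancels, leaving a Duhamel map with zero datum. Subtracting the two Bochner
  integrals requires integrable forcing in each mode, which the bound on the nonlinearity in L^1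
  provides.\<close>

lemma good_Phi_diff:
  assumes a: "good a (2 * z)" and b: "good b (2 * z)" and d: "good (\<lambda>t n. a t n - b t n) r"
  shows "good (\<lambda>t n. Phi zh (\<lambda>s. N (a s)) t n - Phi zh (\<lambda>s. N (b s)) t n) (r / 2)"
proof -
  have i: "integrable lborel (\<lambda>s. N (c s) n)" if "good c (2 * z)" for c n
    by (rule mode_integrable) (use nonlin_L1[OF that] nonlin_good_measurable[OF that] in \<open>auto simp: order_le_less_trans\<close>)
  have "(\<lambda>t n. Phi zh (\<lambda>s. N (a s)) t n - Phi zh (\<lambda>s. N (b s)) t n) = Phi (\<lambda>_. 0) (\<lambda>s n. N (a s) n - N (b s) n)"
    unfolding Phi_def fun_eq_iff
    by (intro allI duhamel_diff i a b L_nonneg)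
  moreover have "good (Phi (\<lambda>_. 0) (\<lambda>s n. N (a s) n - N (b s) n)) (r / 2)"
  proof (rule good_Phi)
    show "(\<lambda>s. N (a s) n - N (b s) n) \<in> borel_measurable borel" for n
      using nonlin_good_measurable[OF a] nonlin_good_measurable[OF b] by simp
  qed (use nonlin_time[OF a b d] d in \<open>auto simp: good_def\<close>)
  ultimately show ?thesis by simp
qed

text \<open>Fatou's lemma, in frequency and then in time: balls are closed under pointwise
  convergence of the coefficients. This takes the place of completeness of a space of
  trajectories.\<close>

lemma good_lim:
  assumes g: "\<And>k. good (b k) r" and lim: "\<And>t n. (\<lambda>k. b k t n) \<longlonglongrightarrow> c t n"
  shows "good c r"
proof -
  have r: "0 \<le> r" using g by (simp add: good_def)
  have meas [measurable]: "(\<lambda>t. b k t n) \<in> borel_measurable borel" for k n using g by (simp add: good_def)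
  have [measurable]: "(\<lambda>t. c t n) \<in> borel_measurable borel" for n
    by (rule borel_measurable_LIMSEQ_metric[OF meas lim])
  have fatou: "wnorm w (c t) \<le> liminf (\<lambda>k. wnorm w (b k t))" if w: "\<And>n. 0 \<le> w n" for w t
  proof -
    have "ennreal (w n * cmod (c t n)) = liminf (\<lambda>k. ennreal (w n * cmod (b k t n)))" for n
      by (rule lim_imp_Liminf[symmetric]) (auto intro!: tendsto_intros lim)
    then have "wnorm w (c t) = (\<integral>\<^sup>+n. liminf (\<lambda>k. ennreal (w n * cmod (b k t n))) \<partial>C)" by (simp add: wnorm_def)
    also have "\<dots> \<le> liminf (\<lambda>k. wnorm w (b k t))" unfolding wnorm_def by (rule nn_integral_liminf) simp
    finally show ?thesis .
  qed
  have "S t (c t) \<le> ennreal r" for t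
  proof -
    have "liminf (\<lambda>k. S t (b k t)) \<le> liminf (\<lambda>k. ennreal r)"
      by (rule Liminf_mono) (use g in \<open>auto simp: good_def\<close>)
    then show ?thesis using fatou[of "W t" t] by (simp add: Liminf_const)
  qed
  moreover have "(\<integral>\<^sup>+s. H s (c s) \<partial>lborel) \<le> ennreal (r / \<kappa>)"
  proof -
    have "(\<integral>\<^sup>+s. H s (c s) \<partial>lborel) \<le> (\<integral>\<^sup>+s. liminf (\<lambda>k. H s (b k s)) \<partial>lborel)"
      by (intro nn_integral_mono fatou) simp
    also have "\<dots> \<le> liminf (\<lambda>k. \<integral>\<^sup>+s. H s (b k s) \<partial>lborel)"
      using S_measurable(2)[OF meas] by (intro nn_integral_liminf) simp
    also have "\<dots> \<le> liminf (\<lambda>k. ennreal (r / \<kappa>))"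
      by (rule Liminf_mono) (use g in \<open>auto simp: good_def\<close>)
    finally show ?thesis by (simp add: Liminf_const)
  qed
  moreover have "c t 0 = 0" for t using LIMSEQ_unique[OF lim[of t 0]] g by (simp add: good_def)
  moreover have "c t n = 0" if "t < 0" for t n using LIMSEQ_unique[OF lim[of t n]] g that by (simp add: good_def)
  ultimately show ?thesis using r by (simp add: good_def)
qed

text \<open>The iteration starts at zero, so its first increment is the linear flow of the datum and the
  bound \<open>2 z\<close> on all iterates is the sum of the geometric series of increments.\<close>

primrec iter :: "nat \<Rightarrow> real \<Rightarrow> int \<Rightarrow> complex" where
  "iter 0 = (\<lambda>_ _. 0)"
| "iter (Suc j) = Phi zh (\<lambda>s. N (iter j s))"

declare iter.simps(2) [simp del]

text \<open>One induction for both claims: an increment is halved only if the two iterates concerned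
  lie in the ball of radius 2z, and that membership comes from the preceding increments.\<close>

lemma good_iter:
  "good (iter j) (2 * z * (1 - 1 / 2 ^ j)) \<and> good (\<lambda>t n. iter (Suc j) t n - iter j t n) (z / 2 ^ j)"
proof (induction j)
  case 0
  have "good (Phi zh (\<lambda>_ _. 0)) z"
    by (rule good_Phi) (simp_all add: zh0 z)
  then show ?case by (simp add: good_zero iter.simps(2))
next
  case (Suc j)
  have ring: "2 * z * (1 - 1 / 2 ^ j) + z / 2 ^ j = 2 * z * (1 - 1 / 2 ^ Suc j)" by (simp add: field_simps)
  have "good (iter (Suc j)) (2 * z * (1 - 1 / 2 ^ Suc j))"
    using good_add[OF conjunct1[OF Suc] conjunct2[OF Suc]] unfolding ring by simp
  moreover from this have "good (iter (Suc j)) (2 * z)"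
    by (rule good_mono) (use z(1) in \<open>simp add: field_simps\<close>)
  moreover have "good (iter j) (2 * z)"
    using conjunct1[OF Suc] by (rule good_mono) (use z(1) in \<open>simp add: field_simps\<close>)
  ultimately show ?case
    using good_Phi_diff[of "iter (Suc j)" "iter j" "z / 2 ^ j"] Suc by (simp add: mult.commute iter.simps(2))
qed

lemma good_iter_tail: "good (\<lambda>t n. iter (J + k) t n - iter J t n) (2 * z / 2 ^ J * (1 - 1 / 2 ^ k))"
proof (induction k)
  case (Suc k)
  have "2 * z / 2 ^ J * (1 - 1 / 2 ^ k) + z / 2 ^ (J + k) = 2 * z / 2 ^ J * (1 - 1 / 2 ^ Suc k)"
    by (simp add: field_simps power_add)
  with good_add[OF Suc conjunct2[OF good_iter[of "J + k"]]] show ?case by simp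
qed (simp add: good_zero)

definition sol :: "real \<Rightarrow> int \<Rightarrow> complex" where
  "sol t n = lim (\<lambda>j. iter j t n)"

lemma iter_tendsto: "(\<lambda>j. iter j t n) \<longlonglongrightarrow> sol t n"
proof -
  have "summable (\<lambda>j. z * (1 / 2) ^ j)" by (intro summable_mult summable_geometric) simp
  then have "summable (\<lambda>j. iter (Suc j) t n - iter j t n)"
  proof (rule summable_comparison_test')
    show "norm (iter (Suc j) t n - iter j t n) \<le> z * (1 / 2) ^ j" for j
      using good_norm[OF conjunct2[OF good_iter[of j]], of t n] by (simp add: power_one_over)
  qed
  then have "(\<lambda>k. \<Sum>j<k. iter (Suc j) t n - iter j t n) \<longlonglongrightarrow> (\<Sum>j. iter (Suc j) t n - iter j t n)"
    by (rule summable_LIMSEQ)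
  moreover have "(\<Sum>j<k. iter (Suc j) t n - iter j t n) = iter k t n" for k
    by (induction k) simp_all
  ultimately show ?thesis by (simp add: sol_def limI)
qed

text \<open>The geometric tail beyond J is bounded uniformly in k, so closedness of the ball passes
  the bound to the limit. The case J = 0 bounds the solution itself.\<close>

lemma good_sol_diff: "good (\<lambda>t n. sol t n - iter J t n) (2 * z / 2 ^ J)"
proof (rule good_lim)
  show "good (\<lambda>t n. iter (J + k) t n - iter J t n) (2 * z / 2 ^ J)" for k
    by (rule good_mono[OF good_iter_tail]) (use z(1) in \<open>simp add: field_simps\<close>)
  show "(\<lambda>k. iter (J + k) t n - iter J t n) \<longlonglongrightarrow> sol t n - iter J t n" for t n
    using LIMSEQ_ignore_initial_segment[OF iter_tendsto[of t n], of J] by (intro tendsto_intros) (simp add: add.commute)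
qed

lemma good_sol: "good sol (2 * z)"
  using good_sol_diff[of 0] by simp

text \<open>By the contraction, \<open>iter (Suc J)\<close> is within z / 2^J of the Duhamel image
  of \<open>sol\<close>; it also converges to \<open>sol\<close>, so the two limits agree.\<close>

lemma sol_fixed_point: "Phi zh (\<lambda>s. N (sol s)) t n = sol t n"
proof -
  have "good (iter J) (2 * z)" for J
    using conjunct1[OF good_iter] by (rule good_mono) (use z(1) in \<open>simp add: field_simps\<close>)
  then have "good (\<lambda>t n. Phi zh (\<lambda>s. N (sol s)) t n - Phi zh (\<lambda>s. N (iter J s)) t n) (2 * z / 2 ^ J / 2)" for J
    by (intro good_Phi_diff good_sol good_sol_diff)
  from good_norm[OF this] have b: "cmod (iter (Suc J) t n - Phi zh (\<lambda>s. N (sol s)) t n) \<le> z / 2 ^ J" for J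
    by (simp add: norm_minus_commute iter.simps(2))
  have "(\<lambda>J. z * (1 / 2) ^ J) \<longlonglongrightarrow> z * 0"
    by (intro tendsto_intros LIMSEQ_power_zero) simp
  then have "(\<lambda>J. z / 2 ^ J) \<longlonglongrightarrow> 0"
    by (simp add: power_one_over)
  then have "(\<lambda>J. iter (Suc J) t n - Phi zh (\<lambda>s. N (sol s)) t n) \<longlonglongrightarrow> 0"
    by (rule Lim_null_comparison[rotated]) (use b in simp)
  then have "(\<lambda>J. iter (Suc J) t n) \<longlonglongrightarrow> Phi zh (\<lambda>s. N (sol s)) t n"
    by (rule LIM_zero_cancel)
  moreover have "(\<lambda>J. iter (Suc J) t n) \<longlonglongrightarrow> sol t n"
    using iter_tendsto by (rule LIMSEQ_Suc)
  ultimately show ?thesis by (rule LIMSEQ_unique)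
qed

lemma sol_cnj: "sol t (- n) = cnj (sol t n)"
proof -
  have "iter j t (- n) = cnj (iter j t n)" for j t n
  proof (induction j arbitrary: t n)
    case (Suc j)
    have "L (- n) = L n" by (simp add: L_def)
    moreover have "N (iter j s) (- n) = cnj (N (iter j s) n)" for s
      by (rule nonlin_cnj) (rule Suc)
    ultimately show ?case
      using duhamel_cnj[of "\<lambda>s. N (iter j s) (- n)" "\<lambda>s. N (iter j s) n"] by (simp add: iter.simps(2) Phi_def zh_cnj)
  qed simp
  then have "(\<lambda>j. iter j t (- n)) \<longlonglongrightarrow> cnj (sol t n)"
    using tendsto_cnj[OF iter_tendsto[of t n]] by simp
  with iter_tendsto show ?thesis by (rule LIMSEQ_unique)
qed

lemma sol_initial: "sol 0 n = zh n"
proof -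
  have "AE s in lborel. (if 0 \<le> s \<and> s \<le> 0 then of_real (exp (- L n * (0 - s))) * N (sol s) n else 0) = 0"
    using AE_lborel_singleton[of "0 :: real"] by eventually_elim auto
  then have "(LINT s|lborel. (if 0 \<le> s \<and> s \<le> 0 then of_real (exp (- L n * (0 - s))) * N (sol s) n else 0)) = 0"
    by (rule integral_eq_zero_AE)
  then show ?thesis using sol_fixed_point[of 0 n] by (simp add: Phi_def duhamel_def)
qed

text \<open>\<open>\<delta> / 4\<close> is \<open>16\<close> times the \<open>\<delta> / 64\<close> of the theorem, because \<open>(1 + \<bar>n\<bar>)\<^sup>4 \<le> 16 n\<^sup>4\<close> for \<open>n \<noteq> 0\<close>.\<close>

lemma sol_energy:
  assumes t: "0 \<le> t"
  shows "S t (sol t) + ennreal (\<delta> / 4) * (\<integral>\<^sup>+s\<in>{0..t}. H s (sol s) \<partial>lborel) \<le> ennreal z"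
proof -
  define K where "K = 1 + \<beta> + 55 / 2 * m"
  have K: "0 \<le> K" unfolding K_def using \<beta> m by simp
  define I where "I = (\<integral>\<^sup>+s\<in>{0..t}. H s (sol s) \<partial>lborel)"
  have meas [measurable]: "(\<lambda>t. sol t n) \<in> borel_measurable borel" for n using good_sol by (rule good_measurable)
  note [measurable] = S_measurable(2)[OF meas]
  have fin: "I < \<infinity>"
  proof -
    have "I \<le> (\<integral>\<^sup>+s. H s (sol s) \<partial>lborel)" unfolding I_def by (intro nn_integral_mono) (auto simp: indicator_def)
    also have "\<dots> < \<infinity>" using good_sol by (auto simp: good_def intro: order_le_less_trans)
    finally show ?thesis .
  qed
  have "(\<lambda>s. Phi zh (\<lambda>s. N (sol s)) s) = sol" by (simp add: fun_eq_iff sol_fixed_point)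
  then have "S t (sol t) + ennreal \<kappa> * I \<le> ennreal z + (\<integral>\<^sup>+s\<in>{0..t}. S s (N (sol s)) \<partial>lborel)"
    using Phi_energy[of "\<lambda>s. N (sol s)" zh t] t nonlin_good_measurable[OF good_sol] zh0 z by (simp add: I_def)
  \<comment> \<open>Against the zero trajectory the Lipschitz bound costs 2 \<epsilon> K (2z + 4z) =
    12 \<epsilon> K z, at most 3/32 \<delta>. Subtracted from \<kappa> this leaves 25/64 \<delta>,
    more than the \<delta>/4 claimed.\<close>
  also have "(\<integral>\<^sup>+s\<in>{0..t}. S s (N (sol s)) \<partial>lborel) \<le> ennreal (3 * \<delta> / 32) * I"
  proof -
    have "AE s in lborel. S s (N (sol s)) * indicator {0..t} s \<le> ennreal (3 * \<delta> / 32) * (H s (sol s) * indicator {0..t} s)"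
      using good_AE_finite[OF good_sol]
    proof eventually_elim
      fix s assume fin: "H s (sol s) < \<infinity>"
      have "S s (\<lambda>n. N (sol s) n - N (\<lambda>_. 0) n) \<le> ennreal (2 * \<epsilon> * K) * (ennreal (2 * z) * (H s (sol s) + H s (\<lambda>_. 0)) + ennreal (4 * z) * H s (\<lambda>n. sol s n - 0))"
        unfolding K_def by (rule nonlin_pointwise) (use good_sol good_zero z fin in auto)
      also have "\<dots> = ennreal (2 * \<epsilon> * K * (2 * z + 4 * z)) * H s (sol s)"
      proof -
        have "ennreal A * (ennreal B * (x + 0) + ennreal D * x) = ennreal (A * (B + D)) * x" if "0 \<le> A" "0 \<le> B" "0 \<le> D" for A B D x
          using that by (simp add: ennreal_mult distrib_right mult.assoc)
        then show ?thesis using z(1) K \<epsilon> by simp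
      qed
      also have "\<dots> \<le> ennreal (3 * \<delta> / 32) * H s (sol s)"
        using small' by (intro mult_right_mono ennreal_leI) (auto simp: K_def algebra_simps)
      finally show "S s (N (sol s)) * indicator {0..t} s \<le> ennreal (3 * \<delta> / 32) * (H s (sol s) * indicator {0..t} s)"
        by (simp add: mult.assoc[symmetric] mult_right_mono)
    qed
    then have "(\<integral>\<^sup>+s\<in>{0..t}. S s (N (sol s)) \<partial>lborel) \<le> (\<integral>\<^sup>+s. ennreal (3 * \<delta> / 32) * (H s (sol s) * indicator {0..t} s) \<partial>lborel)"
      by (rule nn_integral_mono_AE)
    then show ?thesis by (simp add: nn_integral_cmult I_def)
  qed
  finally have E: "S t (sol t) + ennreal \<kappa> * I \<le> ennreal z + ennreal (3 * \<delta> / 32) * I" by simp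
  \<comment> \<open>The integral \<open>I\<close> stands on both sides and can be subtracted only
    because it is already known to be finite; hence the passage to real numbers.\<close>
  obtain i where i: "I = ennreal i" "0 \<le> i" using fin by (cases I) auto
  have "S t (sol t) < \<infinity>" using good_sol by (auto simp: good_def intro: order_le_less_trans)
  then obtain s where s: "S t (sol t) = ennreal s" "0 \<le> s" by (cases "S t (sol t)") auto
  have "ennreal (s + \<kappa> * i) \<le> ennreal (z + 3 * \<delta> / 32 * i)"
    using E ennreal_mult[of "3 * \<delta> / 32" i] i s z(1) \<delta>(1) kappa_pos by (simp add: ennreal_mult[of \<kappa> i])
  then have "s + \<kappa> * i \<le> z + 3 * \<delta> / 32 * i"
    by (rule ennreal_le_iff[THEN iffD1, rotated]) (use z(1) \<delta>(1) i in simp)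
  moreover have "\<kappa> * i = 31 / 64 * (\<delta> * i)" "3 * \<delta> / 32 * i = 3 / 32 * (\<delta> * i)" "\<delta> / 4 * i = 1 / 4 * (\<delta> * i)"
    by (simp_all add: \<kappa>_def)
  moreover have "0 \<le> \<delta> * i" using \<delta>(1) i by simp
  ultimately have "s + \<delta> / 4 * i \<le> z" by linarith
  then have "ennreal (s + \<delta> / 4 * i) \<le> ennreal z" by (rule ennreal_leI)
  moreover have "0 \<le> \<delta> / 4" using \<delta>(1) by simp
  ultimately show ?thesis unfolding I_def[symmetric] i s using i(2) s(2)
    by (simp only: ennreal_plus ennreal_mult mult_nonneg_nonneg)
qed

end

subsection \<open>Absolutely convergent Fourier series\<close>

text \<open>An integral over counting measure, so that Fubini and dominated convergence treat sums
  and integrals alike.\<close>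

definition fser :: "(int \<Rightarrow> complex) \<Rightarrow> real \<Rightarrow> complex" where
  "fser u x = (LINT n|C. u n * cis (of_int n * x))"

abbreviation idiff :: "nat \<Rightarrow> (int \<Rightarrow> complex) \<Rightarrow> int \<Rightarrow> complex" where
  "idiff j \<equiv> diag (\<lambda>n. (\<i> * of_int n) ^ j)"

interpretation one: fourier_weight "\<lambda>_. 1"
  by standard auto

lemma integrable_fser_term:
  assumes "integrable C u"
  shows "integrable C (\<lambda>n. u n * cis (of_int n * x))"
  by (rule Bochner_Integration.integrable_bound[OF assms]) (auto simp: norm_mult)

lemma integrable_conv:
  assumes "integrable C u" "integrable C v"
  shows "integrable C (conv u v)"
proof -
  have "l1norm (conv u v) \<le> l1norm u * l1norm v" by (rule one.S_conv_le)
  also have "\<dots> < \<infinity>" using assms unfolding integrable_C_iff by (simp add: ennreal_mult_less_top)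
  finally show ?thesis by (simp add: integrable_C_iff)
qed

text \<open>Split e^{inx} = e^{ikx} e^{i(n-k)x} and exchange the sums; Fubini's hypothesis is the
  product of two absolutely convergent series.\<close>

lemma fser_conv:
  assumes u: "integrable C u" and v: "integrable C v"
  shows "fser (conv u v) x = fser u x * fser v x"
proof -
  define E where "E n = cis (of_int n * x)" for n
  have E: "E n = E k * E (n - k)" for n k by (simp add: E_def cis_mult left_diff_distrib)
  define F where "F k n = (u k * E k) * (v (n - k) * E (n - k))" for k n
  have shift: "(LINT n|C. f (n - k)) = (LINT n|C. f n)" for f :: "int \<Rightarrow> 'b::{banach, second_countable_topology}" and k
    by (rule integral_bij_count_space) (auto simp: bij_betw_def inj_on_def surj_def intro: exI[of _ "_ + k"] image_eqI[of _ _ "_ + k"])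
  have ishift: "integrable C (\<lambda>n. f (n - k)) = integrable C f" for f :: "int \<Rightarrow> 'b::{banach, second_countable_topology}" and k
    by (rule integrable_bij_count_space) (auto simp: bij_betw_def inj_on_def surj_def intro: exI[of _ "_ + k"] image_eqI[of _ _ "_ + k"])
  have vE: "integrable C (\<lambda>k. v k * E k)"
    unfolding E_def by (intro integrable_fser_term v)
  have int: "integrable (C \<Otimes>\<^sub>M C) (\<lambda>(k, n). F k n)"
  proof (rule CC.Fubini_integrable)
    show "(\<lambda>(k, n). F k n) \<in> borel_measurable (C \<Otimes>\<^sub>M C)" by (simp add: pair_measure_countable)
    have "(LINT n|C. norm (F k n)) = norm (u k) * (LINT n|C. norm (v n))" for k
    proof -
      have "(LINT n|C. norm (F k n)) = (LINT n|C. norm (u k) * norm (v (n - k)))"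
        by (simp add: F_def norm_mult E_def)
      also have "\<dots> = norm (u k) * (LINT n|C. norm (v n))" using shift[of "\<lambda>n. norm (v n)" k] by simp
      finally show ?thesis .
    qed
    then show "integrable C (\<lambda>k. LINT n|C. norm (case (k, n) of (k, n) \<Rightarrow> F k n))"
      using u by simp
    show "AE k in C. integrable C (\<lambda>n. case (k, n) of (k, n) \<Rightarrow> F k n)"
      using vE ishift[of "\<lambda>n. v n * E n"] by (simp add: F_def)
  qed
  have "fser (conv u v) x = (LINT n|C. LINT k|C. F k n)"
    unfolding fser_def conv_def
  proof (rule LINT_cong[OF refl])
    fix n
    have "(LINT k|C. u k * v (n - k)) * E n = (LINT k|C. u k * v (n - k) * E n)" by simp
    also have "\<dots> = (LINT k|C. F k n)"
      by (rule LINT_cong[OF refl]) (simp add: F_def E[of n] mult_ac)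
    finally show "(LINT k|C. u k * v (n - k)) * cis (of_int n * x) = (LINT k|C. F k n)" by (simp add: E_def)
  qed
  also have "\<dots> = (LINT k|C. LINT n|C. F k n)" by (rule CC.Fubini_integral[OF int])
  also have "\<dots> = (LINT k|C. u k * E k * (LINT n|C. v n * E n))"
    using shift[of "\<lambda>n. v n * E n"] by (simp add: F_def)
  also have "\<dots> = fser u x * fser v x" by (simp add: fser_def E_def)
  finally show ?thesis .
qed

lemma fser_add:
  assumes "integrable C u" "integrable C v"
  shows "fser (\<lambda>n. u n + v n) x = fser u x + fser v x"
  unfolding fser_def distrib_right
  by (intro Bochner_Integration.integral_add integrable_fser_term assms)

lemma fser_scale: "fser (\<lambda>n. c * u n) x = c * fser u x"
  by (simp add: fser_def mult.assoc)

lemma fser_cnj: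
  assumes "\<And>n. u (- n) = cnj (u n)"
  shows "fser u x = of_real (Re (fser u x))"
proof -
  have "cnj (fser u x) = (LINT n|C. cnj (u n * cis (of_int n * x)))" by (simp add: fser_def del: complex_cnj_mult)
  also have "\<dots> = (LINT n|C. u (- n) * cis (of_int (- n) * x))" by (simp add: assms cis_cnj)
  also have "\<dots> = fser u x" unfolding fser_def
    by (rule integral_bij_count_space) (auto simp: bij_betw_def inj_on_def surj_def intro: exI[of _ "- _"])
  finally show ?thesis by (metis Reals_cnj_iff of_real_Re)
qed

text \<open>Dominated convergence of the difference quotients along an arbitrary null sequence; the
  mean value inequality makes \<open>b\<close> a majorant.\<close>

lemma DERIV_integral_C:
  fixes g g' :: "int \<Rightarrow> real \<Rightarrow> real"
  assumes d: "\<And>n x. DERIV (g n) x :> g' n x" and b: "\<And>n x. \<bar>g' n x\<bar> \<le> b n" and ib: "integrable C b"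
    and ig: "\<And>x. integrable C (\<lambda>n. g n x)"
  shows "DERIV (\<lambda>x. LINT n|C. g n x) x :> (LINT n|C. g' n x)"
  unfolding DERIV_def LIMSEQ_SEQ_conv[symmetric]
proof (intro allI impI)
  fix h :: "nat \<Rightarrow> real" assume h: "(\<forall>k. h k \<noteq> 0) \<and> h \<longlonglongrightarrow> 0"
  have "(\<lambda>k. LINT n|C. (g n (x + h k) - g n x) / h k) \<longlonglongrightarrow> (LINT n|C. g' n x)"
  proof (rule integral_dominated_convergence[where w = b])
    show "AE n in C. (\<lambda>k. (g n (x + h k) - g n x) / h k) \<longlonglongrightarrow> g' n x"
    proof (rule AE_I2)
      fix n
      show "(\<lambda>k. (g n (x + h k) - g n x) / h k) \<longlonglongrightarrow> g' n x"
        using d[of n x, unfolded DERIV_def LIMSEQ_SEQ_conv[symmetric]] h by blast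
    qed
    show "AE n in C. norm ((g n (x + h k) - g n x) / h k) \<le> b n" for k
    proof (rule AE_I2)
      fix n
      have "norm (g n (x + h k) - g n x) \<le> b n * norm (x + h k - x)"
        by (rule field_differentiable_bound[of UNIV "g n" "g' n"]) (use d b in auto)
      then show "norm ((g n (x + h k) - g n x) / h k) \<le> b n"
        using h by (simp add: divide_le_eq)
    qed
  qed (use ib in auto)
  moreover have "(LINT n|C. (g n (x + h k) - g n x) / h k) = ((LINT n|C. g n (x + h k)) - (LINT n|C. g n x)) / h k" for k
    by (simp only: integral_divide_zero Bochner_Integration.integral_diff[OF ig ig])
  ultimately show "(\<lambda>k. ((LINT n|C. g n (x + h k)) - (LINT n|C. g n x)) / h k) \<longlonglongrightarrow> (LINT n|C. g' n x)"
    by (simp only:)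
qed

lemma Re_fser: "integrable C u \<Longrightarrow> Re (fser u x) = (LINT n|C. Re (u n * cis (of_int n * x)))"
  unfolding fser_def by (subst integral_Re[OF integrable_fser_term]) simp_all

lemma fser_DERIV:
  assumes u: "integrable C u" "integrable C (idiff 1 u)"
  shows "DERIV (\<lambda>x. Re (fser u x)) x :> Re (fser (idiff 1 u) x)"
  unfolding Re_fser[OF u(1)] Re_fser[OF u(2)]
proof (rule DERIV_integral_C)
  show "DERIV (\<lambda>x. Re (u n * cis (of_int n * x))) x :> Re (idiff 1 u n * cis (of_int n * x))" for n x
    by (auto intro!: derivative_eq_intros simp: diag_def algebra_simps)
  show "\<bar>Re (idiff 1 u n * cis (of_int n * x))\<bar> \<le> norm (idiff 1 u n)" for n x
    using abs_Re_le_cmod[of "idiff 1 u n * cis (of_int n * x)"] by (simp add: norm_mult)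
  show "integrable C (\<lambda>n. norm (idiff 1 u n))" using u(2) by simp
  show "integrable C (\<lambda>n. Re (u n * cis (of_int n * x)))" for x
    by (intro integrable_Re integrable_fser_term u)
qed

lemma fser_bound:
  assumes "l1norm u \<le> ennreal B" "0 \<le> B"
  shows "cmod (fser u x) \<le> B"
proof -
  have "ennreal (cmod (fser u x)) \<le> l1norm u"
    using ennreal_norm_integral_le[of C "\<lambda>n. u n * cis (of_int n * x)"] by (simp add: fser_def wnorm_def norm_mult)
  then show ?thesis using assms by (metis ennreal_le_iff order_trans)
qed

lemma fser_periodic: "fser u (x + 2 * pi) = fser u x"
proof -
  have "cis (of_int n * (x + 2 * pi)) = cis (of_int n * x)" for n
  proof -
    have "cis (of_int n * (x + 2 * pi)) = cis (of_int n * x) * cis (2 * pi * real_of_int n)"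
      by (simp add: cis_mult algebra_simps)
    then show ?thesis by (simp add: cis_multiple_2pi)
  qed
  then show ?thesis by (simp add: fser_def)
qed

section \<open>Orthogonality of exponentials and pairings on the torus\<close>

lemma integrable_lebesgue_on_cis:
  "integrable (lebesgue_on {0..2*pi}) (\<lambda>x. cis (of_int n * x))"
  by (intro continuous_imp_integrable_real continuous_intros)

lemma cis_has_vector_derivative:
  "((\<lambda>x. cis (of_int n * x)) has_vector_derivative \<i> * of_int n * cis (of_int n * x)) (at x within A)"
proof -
  have "((\<lambda>w. exp (\<i> * of_int n * w)) has_field_derivative \<i> * of_int n * exp (\<i> * of_int n * of_real x)) (at (of_real x))"
    by (auto intro!: derivative_eq_intros)
  from has_vector_derivative_real_field[OF this, of A] show ?thesis by (simp add: cis_conv_exp mult.assoc)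
qed

lemma integral_cis:
  "(LINT x|lebesgue_on {0..2*pi}. cis (of_int n * x)) = (if n = 0 then of_real (2 * pi) else 0)"
proof (cases "n = 0")
  case False
  have "((\<lambda>x. \<i> * of_int n * cis (of_int n * x)) has_integral (cis (of_int n * (2 * pi)) - cis (of_int n * 0))) {0..2*pi}"
    by (rule fundamental_theorem_of_calculus) (use cis_has_vector_derivative in auto)
  from has_integral_mult_right[OF this, of "1 / (\<i> * of_int n)"]
  have "((\<lambda>x. cis (of_int n * x)) has_integral (1 / (\<i> * of_int n) * (cis (of_int n * (2 * pi)) - cis (of_int n * 0)))) {0..2*pi}"
    using False by (simp add: mult.assoc[symmetric])
  moreover have "cis (of_int n * (2 * pi)) = 1" using cis_multiple_2pi[of "real_of_int n"] by (simp add: mult_ac)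
  ultimately have "((\<lambda>x. cis (of_int n * x)) has_integral 0) {0..2*pi}" by simp
  then show ?thesis using False
    by (simp add: lebesgue_integral_eq_integral[OF integrable_lebesgue_on_cis] integral_unique)
qed (simp add: lebesgue_integral_eq_integral[OF continuous_imp_integrable_real] scaleR_conv_of_real measure_restrict_space)

interpretation X: finite_measure "lebesgue_on {0..2*pi :: real}"
  by (rule finite_measure_lebesgue_on) (metis cbox_interval lmeasurable_cbox)

abbreviation TX :: "real measure" where "TX \<equiv> lebesgue_on {0..2*pi}"

text \<open>This is 2 pi times the Fourier coefficient of index -n. With this sign the integral of
  \<open>fser u\<close> against \<psi> is the plain sum of \<open>u n * tcoef \<psi> n\<close>,
  without reflection or conjugation.\<close>

definition tcoef :: "(real \<Rightarrow> real) \<Rightarrow> int \<Rightarrow> complex" where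
  "tcoef \<psi> n = (LINT x|TX. cis (of_int n * x) * of_real (\<psi> x))"

lemma borel_measurable_lebesgue_on:
  assumes "f \<in> borel_measurable borel"
  shows "f \<in> borel_measurable (lebesgue_on (A :: real set))"
  by (rule measurable_restrict_space1, rule measurable_completion) (use assms in simp)

lemma cis_measurable [measurable]: "(\<lambda>x. cis (c * x)) \<in> borel_measurable borel"
  by (intro borel_measurable_continuous_onI continuous_intros)

lemma cis_measurable_TX [measurable]: "(\<lambda>x. cis (c * x)) \<in> borel_measurable (lebesgue_on A)"
  by (rule borel_measurable_lebesgue_on) measurable

text \<open>Fubini for an l^1 sequence and an L^1 function, the exponentials having modulus
  one.\<close>

lemma fser_pair:
  assumes u: "integrable C u" and \<psi>: "integrable TX \<psi>"
  shows "(LINT x|TX. fser u x * \<psi> x) = (LINT n|C. u n * (LINT x|TX. cis (of_int n * x) * \<psi> x))"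
proof -
  interpret CX: pair_sigma_finite C TX ..
  have [measurable]: "\<psi> \<in> borel_measurable TX" using \<psi> by auto
  have int: "integrable (C \<Otimes>\<^sub>M TX) (\<lambda>(n, x). u n * cis (of_int n * x) * \<psi> x)"
  proof (rule CX.Fubini_integrable)
    show "(\<lambda>(n, x). u n * cis (of_int n * x) * \<psi> x) \<in> borel_measurable (C \<Otimes>\<^sub>M TX)"
    proof (rule measurable_pair_measure_countable1)
      fix n
      have "(\<lambda>x. u n * cis (of_int n * x) * \<psi> x) \<in> borel_measurable TX" by measurable
      then show "(\<lambda>x. case (n, x) of (n, x) \<Rightarrow> u n * cis (of_int n * x) * \<psi> x) \<in> borel_measurable TX" by simp
    qed simp
    have "(LINT x|TX. norm (case (n, x) of (n, x) \<Rightarrow> u n * cis (of_int n * x) * \<psi> x)) = norm (u n) * (LINT x|TX. norm (\<psi> x))" for n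
      by (simp add: norm_mult)
    then show "integrable C (\<lambda>n. LINT x|TX. norm (case (n, x) of (n, x) \<Rightarrow> u n * cis (of_int n * x) * \<psi> x))"
      using u by simp
    show "AE n in C. integrable TX (\<lambda>x. case (n, x) of (n, x) \<Rightarrow> u n * cis (of_int n * x) * \<psi> x)"
    proof (rule AE_I2)
      fix n
      have "integrable TX (\<lambda>x. u n * cis (of_int n * x) * \<psi> x)"
        by (rule Bochner_Integration.integrable_bound[OF integrable_mult_right[OF \<psi>, of "u n"]]) (measurable, simp add: norm_mult)
      then show "integrable TX (\<lambda>x. case (n, x) of (n, x) \<Rightarrow> u n * cis (of_int n * x) * \<psi> x)" by simp
    qed
  qed
  have "(LINT x|TX. fser u x * \<psi> x) = (LINT x|TX. LINT n|C. u n * cis (of_int n * x) * \<psi> x)"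
    unfolding fser_def by simp
  also have "\<dots> = (LINT n|C. LINT x|TX. u n * cis (of_int n * x) * \<psi> x)"
    by (rule CX.Fubini_integral[OF int])
  also have "\<dots> = (LINT n|C. u n * (LINT x|TX. cis (of_int n * x) * \<psi> x))"
    by (simp add: mult.assoc)
  finally show ?thesis .
qed

lemma fourier_coeff_fser:
  assumes u: "integrable C u" and s: "\<And>n. u (- n) = cnj (u n)"
  shows "fourier_coeff (\<lambda>x. Re (fser u x)) n = u n"
proof -
  have e: "exp (- \<i> * of_int n * complex_of_real x) = cis (of_int (- n) * x)" for x
    by (simp add: cis_conv_exp mult_ac)
  have "(LINT x|TX. complex_of_real (Re (fser u x)) * exp (- \<i> * of_int n * complex_of_real x))
    = (LINT x|TX. fser u x * cis (of_int (- n) * x))"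
    unfolding e using fser_cnj[of u] s by simp
  also have "\<dots> = (LINT k|C. u k * (LINT x|TX. cis (of_int k * x) * cis (of_int (- n) * x)))"
    by (rule fser_pair[OF u integrable_lebesgue_on_cis])
  also have "\<dots> = (LINT k|C. u k * (if k = n then of_real (2 * pi) else 0))"
  proof (rule LINT_cong[OF refl])
    fix k
    have "cis (of_int k * x) * cis (of_int (- n) * x) = cis (of_int (k - n) * x)" for x
      by (simp add: cis_mult algebra_simps)
    then show "u k * (LINT x|TX. cis (of_int k * x) * cis (of_int (- n) * x)) = u k * (if k = n then of_real (2 * pi) else 0)"
      using integral_cis[of "k - n"] by (simp only:) simp
  qed
  also have "\<dots> = (LINT k|C. (if k = n then of_real (2 * pi) * u n else 0))"
    by (rule LINT_cong[OF refl]) auto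
  also have "\<dots> = of_real (2 * pi) * u n"
    by (subst lebesgue_integral_count_space_finite_support) auto
  finally show ?thesis by (simp add: fourier_coeff_def)
qed

text \<open>Continuity cannot come from the composition \<phi> o \<open>Arg2pi\<close>, since
  \<open>Arg2pi\<close> jumps at 1. Instead, \<open>cis\<close> maps a compact interval onto the
  circle, so the preimage of a closed set under F is the image of a compact set; periodicity
  reconciles the two endpoints.\<close>

lemma continuous_on_circle:
  fixes \<phi> :: "real \<Rightarrow> real"
  assumes "continuous_on UNIV \<phi>" and per: "\<And>x. \<phi> (x + 2 * pi) = \<phi> x"
  obtains F where "continuous_on (sphere (0::complex) 1) F" "\<And>x. x \<in> {0..2*pi} \<Longrightarrow> F (cis x) = \<phi> x"
proof
  define F where "F z = \<phi> (Arg2pi z)" for z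
  show F: "F (cis x) = \<phi> x" if "x \<in> {0..2*pi}" for x
  proof (cases "x = 2 * pi")
    case True
    then have "cis x = 1" by simp
    moreover have "Arg2pi 1 = 0" by (rule Arg2pi_unique[of 1]) auto
    ultimately show ?thesis using per[of 0] True by (simp add: F_def)
  next
    case False
    then have "Arg2pi (cis x) = x" using that by (intro Arg2pi_unique[of 1]) (auto simp: cis_conv_exp)
    then show ?thesis by (simp add: F_def)
  qed
  have surj: "sphere (0::complex) 1 = cis ` {0..2*pi}"
  proof -
    have "z \<in> cis ` {0..2*pi}" if "cmod z = 1" for z
      using Arg2pi[of z] that by (intro image_eqI[of _ _ "Arg2pi z"]) (auto simp: cis_conv_exp is_Arg_def)
    then show ?thesis by auto
  qed
  show "continuous_on (sphere (0::complex) 1) F"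
  proof (subst continuous_on_closed_vimage)
    show "\<forall>B. closed B \<longrightarrow> closed (F -` B \<inter> sphere 0 1)"
    proof (intro allI impI)
      fix B :: "real set" assume B: "closed B"
      have eq: "F -` B \<inter> sphere 0 1 = cis ` ({0..2*pi} \<inter> \<phi> -` B)"
        unfolding surj using F by auto
      have "closed (\<phi> -` B)" using assms(1) B by (simp add: continuous_closed_vimage continuous_on_eq_continuous_at)
      then have "compact ({0..2*pi} \<inter> \<phi> -` B)" by (intro compact_Int_closed) auto
      then have "compact (cis ` ({0..2*pi} \<inter> \<phi> -` B))"
        by (rule compact_continuous_image[rotated]) (intro continuous_intros)
      then show "closed (F -` B \<inter> sphere 0 1)" unfolding eq by (rule compact_imp_closed)
    qed
  qed simp
qed

lemma integrable_TX_mult: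
  fixes g h :: "real \<Rightarrow> complex"
  assumes g: "integrable TX g" and h: "continuous_on UNIV h"
  shows "integrable TX (\<lambda>x. g x * h x)"
proof -
  have "compact (h ` {0..2*pi})" using h by (intro compact_continuous_image) (auto intro: continuous_on_subset)
  then obtain B where B: "\<And>x. x \<in> {0..2*pi} \<Longrightarrow> norm (h x) \<le> B"
    by (meson bounded_iff compact_imp_bounded imageI)
  have [measurable]: "h \<in> borel_measurable TX"
    by (rule borel_measurable_lebesgue_on) (intro borel_measurable_continuous_onI h)
  have [measurable]: "g \<in> borel_measurable TX" using g by auto
  show ?thesis
  proof (rule Bochner_Integration.integrable_bound[of TX "\<lambda>x. B *\<^sub>R g x"])
    show "AE x in TX. norm (g x * h x) \<le> norm (B *\<^sub>R g x)"
    proof (rule AE_I2)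
      fix x assume "x \<in> space TX"
      then have "x \<in> {0..2*pi}" by (simp add: space_restrict_space)
      from B[OF this] show "norm (g x * h x) \<le> norm (B *\<^sub>R g x)"
        by (simp add: norm_mult mult.commute[of "norm (g x)"] mult_right_mono)
    qed
  qed (use g in auto)
qed

text \<open>By Stone--Weierstrass on the circle, vanishing Fourier coefficients kill every continuous
  periodic function; multiplicativity of the predicate below is what makes the induction over
  polynomials in \<open>cis x\<close> work.\<close>

lemma integral_zero_of_fourier_coeff_zero:
  fixes g \<phi> :: "real \<Rightarrow> real"
  assumes g: "integrable TX g" and z: "\<And>n. fourier_coeff g n = 0"
    and \<phi>: "continuous_on UNIV \<phi>" and per: "\<And>x. \<phi> (x + 2 * pi) = \<phi> x"
  shows "(LINT x|TX. g x * \<phi> x) = 0"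
proof -
  define G where "G x = complex_of_real (g x)" for x
  have G: "integrable TX G" unfolding G_def using g by simp
  define Z where "Z h \<longleftrightarrow> continuous_on UNIV h \<and> (\<forall>k::int. (LINT x|TX. G x * (h x * cis (of_int k * x))) = 0)" for h
  have Z_cont: "Z h \<Longrightarrow> continuous_on UNIV h" for h by (simp add: Z_def)
  have Gi: "integrable TX (\<lambda>x. G x * (h x * cis (of_int k * x)))" if "continuous_on UNIV h" for h and k :: int
    by (intro integrable_TX_mult[OF G] continuous_intros that)
  have Z1: "Z (\<lambda>_. 1)"
  proof -
    have "(LINT x|TX. G x * cis (of_int k * x)) = 0" for k
    proof -
      have "exp (- \<i> * of_int (- k) * complex_of_real x) = cis (of_int k * x)" for x
        by (simp add: cis_conv_exp mult_ac)
      then show ?thesis using z[of "- k"] unfolding fourier_coeff_def G_def by (simp only:) simp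
    qed
    then show ?thesis by (simp add: Z_def)
  qed
  have Z_add: "Z (\<lambda>x. h x + h' x)" if "Z h" "Z h'" for h h'
    using that unfolding Z_def
    by (auto simp: distrib_left distrib_right Bochner_Integration.integral_add[OF Gi Gi] intro!: continuous_intros)
  have Z_scale: "Z (\<lambda>x. c * h x)" if "Z h" for c h
  proof -
    have "(LINT x|TX. G x * (c * h x * cis (of_int k * x))) = c * (LINT x|TX. G x * (h x * cis (of_int k * x)))" for k :: int
      by (subst integral_mult_right_zero[symmetric]) (simp add: mult_ac)
    then show ?thesis using that unfolding Z_def by (auto intro!: continuous_intros)
  qed
  have Z_cis: "Z (\<lambda>x. h x * cis (of_int j * x))" if "Z h" for j h
  proof -
    have "(LINT x|TX. G x * (h x * cis (of_int j * x) * cis (of_int k * x))) = (LINT x|TX. G x * (h x * cis (of_int (j + k) * x)))" for k :: int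
      by (rule LINT_cong[OF refl]) (simp add: cis_mult distrib_right mult.assoc)
    moreover have "(LINT x|TX. G x * (h x * cis (of_int k * x))) = 0" for k :: int using that by (simp add: Z_def)
    ultimately show ?thesis using Z_cont[OF that] unfolding Z_def by (simp only:) (auto intro!: continuous_intros)
  qed
  have Q: "Z (\<lambda>x. h x * of_real (q (cis x)))" if "real_polynomial_function q" "Z h" for q :: "complex \<Rightarrow> real" and h
    using that
  proof (induction q arbitrary: h)
    case (linear f)
    interpret f: bounded_linear f by fact
    \<comment> \<open>A real-linear functional of the plane, restricted to the circle, is a
      combination of e^{ix} and e^{-ix}; this generator thus reduces to two frequency
      shifts.\<close>
    have "of_real (f (cis x)) = (of_real (f 1) - \<i> * of_real (f \<i>)) / 2 * cis (of_int 1 * x) + (of_real (f 1) + \<i> * of_real (f \<i>)) / 2 * cis (of_int (- 1) * x)" for x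
    proof -
      have "cis x = cos x *\<^sub>R 1 + sin x *\<^sub>R \<i>" by (simp add: complex_eq_iff)
      then have "f (cis x) = cos x * f 1 + sin x * f \<i>" by (simp add: f.add f.scaleR)
      then show ?thesis by (simp add: complex_eq_iff field_simps)
    qed
    then have "(\<lambda>x. h x * of_real (f (cis x))) = (\<lambda>x. (of_real (f 1) - \<i> * of_real (f \<i>)) / 2 * (h x * cis (of_int 1 * x)) + (of_real (f 1) + \<i> * of_real (f \<i>)) / 2 * (h x * cis (of_int (- 1) * x)))"
      by (simp add: fun_eq_iff algebra_simps)
    then show ?case using Z_add[OF Z_scale[OF Z_cis[OF linear(2), of 1]] Z_scale[OF Z_cis[OF linear(2), of "- 1"]]] by (simp only:)
  next
    case (const c)
    show ?case using Z_scale[OF const, of "of_real c"] by (simp add: mult.commute)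
  next
    case (add f g)
    show ?case using Z_add[OF add(3)[OF add(5)] add(4)[OF add(5)]] by (simp add: distrib_left)
  next
    case (mult f g)
    show ?case using mult(4)[OF mult(3)[OF mult(5)]] by (simp add: mult.assoc)
  qed
  obtain F where F: "continuous_on (sphere (0::complex) 1) F" "\<And>x. x \<in> {0..2*pi} \<Longrightarrow> F (cis x) = \<phi> x"
    using continuous_on_circle[OF \<phi> per] by blast
  define B where "B = (LINT x|TX. \<bar>g x\<bar>)"
  have B0: "0 \<le> B" unfolding B_def by simp
  have small: "\<bar>LINT x|TX. g x * \<phi> x\<bar> \<le> e * B" if e: "0 < e" for e
  proof -
    obtain q where q: "real_polynomial_function q" "\<And>w. w \<in> sphere 0 1 \<Longrightarrow> \<bar>F w - q w\<bar> < e"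
      using Stone_Weierstrass_real_polynomial_function[OF _ F(1) e] by auto
    have qc: "continuous_on UNIV (\<lambda>x. q (cis x))"
      by (rule continuous_on_compose2[OF continuous_on_polymonial_function[of q UNIV]])
        (use q(1) in \<open>auto simp: real_polynomial_function_eq intro!: continuous_intros\<close>)
    have gi: "integrable TX (\<lambda>x. g x * h x)" if "continuous_on UNIV h" for h :: "real \<Rightarrow> real"
    proof -
      have "integrable TX (\<lambda>x. G x * of_real (h x))"
        by (intro integrable_TX_mult[OF G] continuous_intros that)
      then have "integrable TX (\<lambda>x. complex_of_real (g x * h x))" by (simp add: G_def)
      then show ?thesis by (simp only: complex_of_real_integrable_eq)
    qed
    have "Z (\<lambda>x. 1 * of_real (q (cis x)))" by (rule Q[OF q(1) Z1])
    then have "(LINT x|TX. G x * (1 * of_real (q (cis x)) * cis (of_int 0 * x))) = 0" unfolding Z_def by blast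
    then have "(LINT x|TX. complex_of_real (g x * q (cis x))) = 0" by (simp add: G_def)
    then have q0: "(LINT x|TX. g x * q (cis x)) = 0" by (simp only: integral_complex_of_real of_real_eq_0_iff)
    have "(LINT x|TX. g x * \<phi> x) = (LINT x|TX. g x * \<phi> x - g x * q (cis x))"
      using q0 by (simp add: Bochner_Integration.integral_diff[OF gi[OF \<phi>] gi[OF qc]])
    also have "\<bar>\<dots>\<bar> \<le> (LINT x|TX. \<bar>g x * \<phi> x - g x * q (cis x)\<bar>)" by (rule integral_abs_bound)
    also have "\<dots> \<le> (LINT x|TX. e * \<bar>g x\<bar>)"
    proof (rule integral_mono)
      show "integrable TX (\<lambda>x. \<bar>g x * \<phi> x - g x * q (cis x)\<bar>)"
        by (intro integrable_abs Bochner_Integration.integrable_diff gi \<phi> qc)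
      show "integrable TX (\<lambda>x. e * \<bar>g x\<bar>)" using g by simp
      fix x assume "x \<in> space TX"
      then have x: "x \<in> {0..2*pi}" by (simp add: space_restrict_space)
      have "\<bar>\<phi> x - q (cis x)\<bar> \<le> e" using q(2)[of "cis x"] F(2)[OF x] by simp
      then have "\<bar>g x\<bar> * \<bar>\<phi> x - q (cis x)\<bar> \<le> \<bar>g x\<bar> * e" by (intro mult_left_mono) auto
      then show "\<bar>g x * \<phi> x - g x * q (cis x)\<bar> \<le> e * \<bar>g x\<bar>"
        by (simp only: right_diff_distrib[symmetric] abs_mult mult.commute[of e])
    qed
    also have "\<dots> = e * B" by (simp add: B_def)
    finally show ?thesis .
  qed
  have "\<bar>LINT x|TX. g x * \<phi> x\<bar> \<le> 0"
  proof (rule field_le_epsilon)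
    fix e :: real assume e: "0 < e"
    have "\<bar>LINT x|TX. g x * \<phi> x\<bar> \<le> e / (B + 1) * B" using e B0 by (intro small) auto
    also have "\<dots> \<le> e" using e B0 by (simp add: field_simps)
    finally show "\<bar>LINT x|TX. g x * \<phi> x\<bar> \<le> 0 + e" by simp
  qed
  then show ?thesis by simp
qed

subsection \<open>Test functions and integration by parts in time\<close>

text \<open>The coinductive rule yields some pair of partial derivatives; uniqueness identifies them
  with \<open>pt f\<close> and \<open>px f\<close>, so smoothness passes to these concrete
  functions.\<close>

lemma smooth2_cases:
  assumes "smooth2 f"
  shows "smooth2 (pt f)" "smooth2 (px f)"
    "((\<lambda>s. f s x) has_real_derivative pt f t x) (at t)" "(f t has_real_derivative px f t x) (at x)"
    "isCont (\<lambda>p. f (fst p) (snd p)) q"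
proof -
  from assms obtain ft fx where d: "\<And>t x. ((\<lambda>p. f (fst p) (snd p)) has_derivative (\<lambda>h. ft t x * fst h + fx t x * snd h)) (at (t, x))"
    and s: "smooth2 ft" "smooth2 fx"
    by (cases rule: smooth2.cases) auto
  have dt: "((\<lambda>s. f s x) has_real_derivative ft t x) (at t)" for t x
  proof -
    have "((\<lambda>s. (s, x)) has_derivative (\<lambda>h. (h, 0 :: real))) (at t)" by (auto intro!: derivative_eq_intros)
    from has_derivative_compose[where f = "\<lambda>s. (s, x)" and f' = "\<lambda>h. (h, 0)" and x = t and s = UNIV
        and g = "\<lambda>p. f (fst p) (snd p)" and g' = "\<lambda>h. ft t x * fst h + fx t x * snd h", OF this d] show ?thesis by (simp add: has_field_derivative_def)
  qed
  have dx: "(f t has_real_derivative fx t x) (at x)" for t x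
  proof -
    have "((\<lambda>y. (t, y)) has_derivative (\<lambda>h. (0 :: real, h))) (at x)" by (auto intro!: derivative_eq_intros)
    from has_derivative_compose[OF this, of "\<lambda>p. f (fst p) (snd p)", OF d] show ?thesis by (simp add: has_field_derivative_def)
  qed
  have "pt f = ft" "px f = fx" using dt dx by (auto simp: pt_def px_def fun_eq_iff intro!: DERIV_imp_deriv)
  with s dt dx show "smooth2 (pt f)" "smooth2 (px f)"
    "((\<lambda>s. f s x) has_real_derivative pt f t x) (at t)" "(f t has_real_derivative px f t x) (at x)"
    by auto
  show "isCont (\<lambda>p. f (fst p) (snd p)) q" using d[of "fst q" "snd q"] by (auto intro: has_derivative_continuous)
qed

lemma smooth2_continuous:
  assumes "smooth2 f"
  shows "continuous_on A (\<lambda>p. f (fst p) (snd p))" "continuous_on B (f t)" "continuous_on D (\<lambda>s. f s x)"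
proof -
  show c: "continuous_on A (\<lambda>p. f (fst p) (snd p))" for A
    by (intro continuous_at_imp_continuous_on ballI smooth2_cases(5) assms)
  show "continuous_on B (f t)" "continuous_on D (\<lambda>s. f s x)"
    by (intro continuous_at_imp_continuous_on ballI DERIV_isCont[OF smooth2_cases(4)[OF assms]] DERIV_isCont[OF smooth2_cases(3)[OF assms]])+
qed

lemma test_fun_px:
  assumes "test_fun f"
  shows "test_fun (px f)"
proof -
  have s: "smooth2 f" and p: "\<And>t x. f t (x + 2 * pi) = f t x" using assms by (auto simp: test_fun_def tperiodic_def)
  have "px f t (x + 2 * pi) = px f t x" for t x
  proof -
    have "((\<lambda>x. f t (x + 2 * pi)) has_real_derivative px f t (x + 2 * pi)) (at x)"
      using smooth2_cases(4)[OF s, of t "x + 2 * pi"] DERIV_shift[of "f t"] by blast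
    then show ?thesis using DERIV_unique[OF smooth2_cases(4)[OF s, of t x]] by (simp add: p)
  qed
  then show ?thesis using smooth2_cases(2)[OF s] by (simp add: test_fun_def tperiodic_def)
qed

lemma test_fun_smooth2: "test_fun f \<Longrightarrow> smooth2 f"
  by (simp add: test_fun_def)

section \<open>Fourier coefficients of test functions\<close>

lemma tcoef_integrable:
  assumes "continuous_on {0..2*pi} \<psi>"
  shows "integrable TX (\<lambda>x. cis (of_int n * x) * complex_of_real (\<psi> x))"
  by (intro continuous_imp_integrable_real continuous_intros assms)

lemma tcoef_eq_integral:
  assumes "continuous_on {0..2*pi} \<psi>"
  shows "tcoef \<psi> n = integral {0..2*pi} (\<lambda>x. cis (of_int n * x) * complex_of_real (\<psi> x))"
  unfolding tcoef_def by (rule lebesgue_integral_eq_integral[OF tcoef_integrable[OF assms]]) simp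

text \<open>Fundamental theorem of calculus for e^{inx} \<psi>(x), whose boundary values cancel by
  periodicity. The minus sign is that of integration by parts.\<close>

lemma tcoef_derivative:
  assumes d: "\<And>x. (\<psi> has_real_derivative \<psi>' x) (at x)" and c: "continuous_on UNIV \<psi>'" and p: "\<psi> (2 * pi) = \<psi> 0"
  shows "tcoef \<psi>' n = - (\<i> * of_int n) * tcoef \<psi> n"
proof -
  have c1: "continuous_on {0..2*pi} \<psi>'" using c by (rule continuous_on_subset) simp
  have c0: "continuous_on {0..2*pi} \<psi>" by (intro continuous_at_imp_continuous_on ballI DERIV_isCont[OF d])
  define e where "e x = cis (of_int n * x)" for x
  have "((\<lambda>x. \<i> * of_int n * e x * of_real (\<psi> x) + e x * of_real (\<psi>' x)) has_integral (e (2 * pi) * of_real (\<psi> (2 * pi)) - e 0 * of_real (\<psi> 0))) {0..2*pi}"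
  proof (rule fundamental_theorem_of_calculus)
    fix x :: real
    have 1: "((\<lambda>x. complex_of_real (\<psi> x)) has_vector_derivative complex_of_real (\<psi>' x)) (at x within {0..2*pi})"
      using d[of x] by (intro has_vector_derivative_of_real) (auto intro: DERIV_subset)
    show "((\<lambda>x. e x * of_real (\<psi> x)) has_vector_derivative \<i> * of_int n * e x * of_real (\<psi> x) + e x * of_real (\<psi>' x)) (at x within {0..2*pi})"
      using has_vector_derivative_mult[OF cis_has_vector_derivative 1, of n] by (simp add: e_def algebra_simps)
  qed simp
  moreover have "e (2 * pi) = 1" "e 0 = 1" using cis_multiple_2pi[of "real_of_int n"] by (simp_all add: e_def mult_ac)
  ultimately have "((\<lambda>x. \<i> * of_int n * e x * of_real (\<psi> x) + e x * of_real (\<psi>' x)) has_integral 0) {0..2*pi}"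
    using p by simp
  moreover have "((\<lambda>x. \<i> * of_int n * (e x * of_real (\<psi> x)) + e x * of_real (\<psi>' x)) has_integral \<i> * of_int n * tcoef \<psi> n + tcoef \<psi>' n) {0..2*pi}"
    unfolding tcoef_eq_integral[OF c0] tcoef_eq_integral[OF c1] e_def
    by (intro has_integral_add has_integral_mult_right integrable_integral integrable_continuous_real continuous_intros c0 c1)
  ultimately have "\<i> * of_int n * tcoef \<psi> n + tcoef \<psi>' n = 0"
    by (simp add: mult.assoc has_integral_unique)
  then show ?thesis by (simp add: eq_neg_iff_add_eq_0 add.commute)
qed

lemma tcoef_time_derivative:
  assumes f: "smooth2 f"
  shows "((\<lambda>s. tcoef (f s) n) has_vector_derivative tcoef (pt f t) n) (at t)"
proof -
  note ft = smooth2_cases(1)[OF f]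
  define e where "e x = cis (of_int n * x)" for x
  have "((\<lambda>s. integral (cbox 0 (2*pi)) (\<lambda>x. e x * of_real (f s x))) has_vector_derivative integral (cbox 0 (2*pi)) (\<lambda>x. e x * of_real (pt f t x))) (at t within UNIV)"
  proof (rule leibniz_rule_vector_derivative)
    fix s x :: real
    show "((\<lambda>s. e x * of_real (f s x)) has_vector_derivative e x * of_real (pt f s x)) (at s within UNIV)"
      using has_vector_derivative_mult_right[OF has_vector_derivative_of_real[OF smooth2_cases(3)[OF f, of x s]], of "e x"] by simp
    show "(\<lambda>x. e x * of_real (f s x)) integrable_on cbox 0 (2*pi)"
      unfolding e_def by (intro integrable_continuous continuous_intros smooth2_continuous f)
    have "continuous_on (UNIV \<times> cbox 0 (2*pi)) (\<lambda>p. e (snd p) * complex_of_real (pt f (fst p) (snd p)))"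
      unfolding e_def by (intro continuous_intros smooth2_continuous(1) ft)
    then show "continuous_on (UNIV \<times> cbox 0 (2*pi)) (\<lambda>(s, x). e x * complex_of_real (pt f s x))"
      by (simp add: case_prod_unfold)
  qed auto
  then show ?thesis
    by (simp add: tcoef_eq_integral[OF smooth2_continuous(2)[OF f]] tcoef_eq_integral[OF smooth2_continuous(2)[OF ft]] e_def)
qed

lemma tcoef_continuous: "smooth2 f \<Longrightarrow> continuous_on A (\<lambda>s. tcoef (f s) n)"
  by (intro continuous_at_imp_continuous_on ballI has_vector_derivative_continuous[OF tcoef_time_derivative])

text \<open>The bound is uniform in n. That is enough because the other factor of every pairing is
  summable over the frequencies.\<close>

lemma tcoef_bound:
  assumes "smooth2 f"
  obtains M where "0 \<le> M" "\<And>s n. s \<in> {0..t} \<Longrightarrow> cmod (tcoef (f s) n) \<le> M"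
proof -
  have "compact ((\<lambda>p. f (fst p) (snd p)) ` ({0..t} \<times> {0..2*pi}))"
    by (intro compact_continuous_image smooth2_continuous assms compact_Times compact_Icc)
  then obtain B where B: "\<And>s x. s \<in> {0..t} \<Longrightarrow> x \<in> {0..2*pi} \<Longrightarrow> \<bar>f s x\<bar> \<le> B"
    by (force dest!: compact_imp_bounded simp: bounded_iff)
  have "cmod (tcoef (f s) n) \<le> \<bar>B\<bar> * (2 * pi)" if s: "s \<in> {0..t}" for s n
  proof -
    have "cmod (integral (cbox 0 (2*pi)) (\<lambda>x. cis (of_int n * x) * complex_of_real (f s x))) \<le> \<bar>B\<bar> * Henstock_Kurzweil_Integration.content (cbox 0 (2*pi))"
    proof (rule integrable_bound)
      show "(\<lambda>x. cis (of_int n * x) * complex_of_real (f s x)) integrable_on cbox 0 (2*pi)"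
        by (intro integrable_continuous continuous_intros smooth2_continuous assms)
      show "norm (cis (of_int n * x) * complex_of_real (f s x)) \<le> \<bar>B\<bar>" if "x \<in> cbox 0 (2*pi)" for x
        using B[OF s, of x] that by (simp add: norm_mult)
    qed simp
    then show ?thesis by (simp add: tcoef_eq_integral[OF smooth2_continuous(2)[OF assms]])
  qed
  then show ?thesis by (intro that[of "\<bar>B\<bar> * (2 * pi)"]) auto
qed

section \<open>Integration by parts in time against an integrable forcing\<close>

lemma integrable_Icc_mult:
  fixes f h :: "real \<Rightarrow> complex"
  assumes f: "integrable lborel f" and h: "continuous_on UNIV h"
  shows "integrable lborel (\<lambda>r. indicator {0..t} r *\<^sub>R (h r * f r))"
proof -
  have "compact (h ` {0..t})" using h by (intro compact_continuous_image) (auto intro: continuous_on_subset)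
  then obtain M where M: "\<And>s. s \<in> {0..t} \<Longrightarrow> cmod (h s) \<le> M"
    by (meson bounded_iff compact_imp_bounded imageI)
  have [measurable]: "h \<in> borel_measurable borel" by (intro borel_measurable_continuous_onI h)
  have [measurable]: "f \<in> borel_measurable borel" using borel_measurable_integrable[OF f] by simp
  have "norm (indicator {0..t} r *\<^sub>R (h r * f r)) \<le> norm (M *\<^sub>R f r)" for r
  proof (cases "r \<in> {0..t}")
    case True
    have "cmod (h r) * cmod (f r) \<le> \<bar>M\<bar> * cmod (f r)" using M[OF True] by (intro mult_right_mono) auto
    then show ?thesis using True by (simp add: norm_mult)
  qed simp
  then show ?thesis
    by (intro Bochner_Integration.integrable_bound[OF integrable_scaleR_right[OF f, of M]]) auto
qed

abbreviation primitive0 :: "(real \<Rightarrow> complex) \<Rightarrow> real \<Rightarrow> complex" where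
  "primitive0 f s \<equiv> (LINT r|lborel. (if 0 \<le> r \<and> r \<le> s then f r else 0))"

text \<open>Fubini for g'(s) f(r) on the triangle 0 \<le> r \<le> s \<le> t: integrating in r first
  gives the primitive of f, integrating in s first gives g(t) - g(r). The primitive is only
  absolutely continuous, and this route never differentiates it.\<close>

lemma integral_by_parts_AC:
  fixes f g g' :: "real \<Rightarrow> complex"
  assumes f: "integrable lborel f" and t: "0 \<le> t"
    and g: "\<And>s. (g has_vector_derivative g' s) (at s)" and g': "continuous_on UNIV g'"
  shows "integrable lborel (\<lambda>s. indicator {0..t} s *\<^sub>R (g' s * primitive0 f s))"
    and "g t * primitive0 f t =
      (LINT s|lborel. indicator {0..t} s *\<^sub>R (g' s * primitive0 f s))
      + (LINT s|lborel. indicator {0..t} s *\<^sub>R (g s * f s))"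
proof -
  have [measurable]: "f \<in> borel_measurable borel" using borel_measurable_integrable[OF f] by simp
  have [measurable]: "g' \<in> borel_measurable borel" by (intro borel_measurable_continuous_onI g')
  have gc: "continuous_on UNIV g" by (intro continuous_at_imp_continuous_on ballI has_vector_derivative_continuous[OF g])
  have [measurable]: "g \<in> borel_measurable borel" by (intro borel_measurable_continuous_onI gc)
  have bdd: "\<exists>M. \<forall>s\<in>{0..t}. cmod (h s) \<le> M" if "continuous_on UNIV h" for h :: "real \<Rightarrow> complex"
  proof -
    have "compact (h ` {0..t})" using that by (intro compact_continuous_image) (auto intro: continuous_on_subset)
    then show ?thesis by (meson bounded_iff compact_imp_bounded imageI)
  qed
  define K where "K s r = (if 0 \<le> r \<and> r \<le> s \<and> s \<le> t then g' s * f r else 0)" for s r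
  obtain M where M: "\<And>s. s \<in> {0..t} \<Longrightarrow> cmod (g' s) \<le> M" using bdd[OF g'] by blast
  have [measurable]: "(\<lambda>(s, r). K s r) \<in> borel_measurable (lborel \<Otimes>\<^sub>M lborel)" unfolding K_def by measurable
  have int: "integrable (lborel \<Otimes>\<^sub>M lborel) (\<lambda>(s, r). K s r)"
  proof (rule integrableI_bounded)
    have "(\<integral>\<^sup>+p. ennreal (norm (case p of (s, r) \<Rightarrow> K s r)) \<partial>(lborel \<Otimes>\<^sub>M lborel)) = (\<integral>\<^sup>+s. \<integral>\<^sup>+r. ennreal (norm (K s r)) \<partial>lborel \<partial>lborel)"
      by (subst lborel.nn_integral_fst[symmetric]) auto
    also have "\<dots> \<le> (\<integral>\<^sup>+s. \<integral>\<^sup>+r. ennreal \<bar>M\<bar> * indicator {0..t} s * ennreal (norm (f r)) \<partial>lborel \<partial>lborel)"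
    proof (intro nn_integral_mono)
      fix s r
      show "ennreal (norm (K s r)) \<le> ennreal \<bar>M\<bar> * indicator {0..t} s * ennreal (norm (f r))"
      proof (cases "0 \<le> r \<and> r \<le> s \<and> s \<le> t")
        case True
        then have "cmod (g' s) * cmod (f r) \<le> \<bar>M\<bar> * cmod (f r)" using M[of s] by (intro mult_right_mono) auto
        then show ?thesis using True by (simp add: K_def norm_mult ennreal_mult[symmetric] ennreal_leI)
      qed (auto simp: K_def)
    qed
    also have "\<dots> = ennreal \<bar>M\<bar> * emeasure lborel {0..t} * (\<integral>\<^sup>+r. ennreal (norm (f r)) \<partial>lborel)"
      by (simp add: nn_integral_cmult nn_integral_multc)
    also have "\<dots> < \<infinity>" using f t by (simp add: integrable_iff_bounded ennreal_mult_less_top)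
    finally show "(\<integral>\<^sup>+p. ennreal (norm (case p of (s, r) \<Rightarrow> K s r)) \<partial>(lborel \<Otimes>\<^sub>M lborel)) < \<infinity>" .
  qed simp
  have inner: "(LINT r|lborel. K s r) = indicator {0..t} s *\<^sub>R (g' s * primitive0 f s)" for s
  proof (cases "s \<in> {0..t}")
    case True
    then have "(LINT r|lborel. K s r) = (LINT r|lborel. g' s * (if 0 \<le> r \<and> r \<le> s then f r else 0))"
      by (intro LINT_cong) (auto simp: K_def)
    then show ?thesis using True by simp
  next
    case False
    then have "K s = (\<lambda>_. 0)" by (auto simp: K_def fun_eq_iff)
    then show ?thesis using False by simp
  qed
  show "integrable lborel (\<lambda>s. indicator {0..t} s *\<^sub>R (g' s * primitive0 f s))"
    using lborel_pair.integrable_fst'[OF int] by (simp add: inner)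
  have inner': "(LINT s|lborel. K s r) = indicator {0..t} r *\<^sub>R ((g t - g r) * f r)" for r
  proof (cases "r \<in> {0..t}")
    case True
    have "(LINT s|lborel. K s r) = (LINT s|lborel. (indicator {r..t} s *\<^sub>R g' s) * f r)"
      using True by (intro LINT_cong) (auto simp: K_def indicator_def)
    also have "\<dots> = (LINT s|lborel. indicator {r..t} s *\<^sub>R g' s) * f r" by (rule integral_mult_left_zero)
    also have "(LINT s|lborel. indicator {r..t} s *\<^sub>R g' s) = g t - g r"
      using True by (intro integral_FTC_Icc has_vector_derivative_at_within[OF g] continuous_on_subset[OF g']) auto
    finally show ?thesis using True by simp
  next
    case False
    then have "K s r = 0" for s by (auto simp: K_def)
    then show ?thesis using False by simp
  qed
  have "(LINT s|lborel. LINT r|lborel. K s r) = (LINT r|lborel. LINT s|lborel. K s r)"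
    by (rule lborel_pair.Fubini_integral[OF int, symmetric])
  also have "\<dots> = (LINT r|lborel. indicator {0..t} r *\<^sub>R (g t * f r) - indicator {0..t} r *\<^sub>R (g r * f r))"
    unfolding inner' by (intro LINT_cong) (auto simp: algebra_simps)
  also have "\<dots> = (LINT r|lborel. indicator {0..t} r *\<^sub>R (g t * f r)) - (LINT r|lborel. indicator {0..t} r *\<^sub>R (g r * f r))"
    by (intro Bochner_Integration.integral_diff integrable_Icc_mult f gc continuous_intros)
  also have "(LINT r|lborel. indicator {0..t} r *\<^sub>R (g t * f r)) = (LINT r|lborel. g t * (if 0 \<le> r \<and> r \<le> t then f r else 0))"
    by (intro LINT_cong) (auto simp: indicator_def)
  finally show "g t * primitive0 f t =
      (LINT s|lborel. indicator {0..t} s *\<^sub>R (g' s * primitive0 f s))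
      + (LINT s|lborel. indicator {0..t} s *\<^sub>R (g s * f s))"
    unfolding inner by simp
qed

lemma borel_pair_lebesgue_on:
  fixes h :: "real \<times> real \<Rightarrow> 'a::topological_space"
  assumes "h \<in> borel_measurable borel"
  shows "h \<in> borel_measurable (borel \<Otimes>\<^sub>M lebesgue_on A)"
proof -
  have "(\<lambda>x. x) \<in> borel_measurable (lebesgue_on A)" by (rule borel_measurable_lebesgue_on) simp
  then have 1: "(\<lambda>p. (fst p, snd p)) \<in> measurable (borel \<Otimes>\<^sub>M lebesgue_on A) (borel \<Otimes>\<^sub>M (borel :: real measure))"
    by (intro measurable_Pair measurable_fst measurable_compose[OF measurable_snd]) simp_all
  have "h \<in> measurable (borel \<Otimes>\<^sub>M borel) borel" using assms by (simp add: borel_prod)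
  from measurable_compose[OF 1 this] show ?thesis by simp
qed

lemma integral_lebesgue_on_Icc:
  fixes f :: "real \<Rightarrow> 'a::{banach, second_countable_topology}"
  assumes [measurable]: "f \<in> borel_measurable borel"
  shows "(LINT s|lebesgue_on {0..t}. f s) = (LINT s|lborel. indicator {0..t} s *\<^sub>R f s)"
proof -
  have "(LINT s|lebesgue_on {0..t}. f s) = (LINT s|lebesgue. indicator {0..t} s *\<^sub>R f s)"
    by (rule integral_restrict_space) simp
  also have "\<dots> = (LINT s|lborel. indicator {0..t} s *\<^sub>R f s)"
    by (rule integral_completion) measurable
  finally show ?thesis .
qed

text \<open>A single use of Fubini over time and frequency, absolutely convergent because
  \<open>l1norm\<close> is integrable in time and the test coefficients are uniformly bounded. The
  third claim asks for the identity of series and function only at almost every time, as the fluxes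
  are under control only where \<open>H\<close> is finite.\<close>

lemma time_pair:
  fixes G :: "real \<Rightarrow> real \<Rightarrow> real"
  assumes v: "\<And>n. (\<lambda>s. v s n) \<in> borel_measurable borel"
    and fin: "(\<integral>\<^sup>+s\<in>{0..t}. l1norm (v s) \<partial>lborel) < \<infinity>"
    and \<psi>: "smooth2 \<psi>"
  shows "integrable lborel (\<lambda>s. indicator {0..t} s *\<^sub>R (v s n * tcoef (\<psi> s) n))"
    and "integrable C (\<lambda>n. LINT s|lborel. indicator {0..t} s *\<^sub>R (v s n * tcoef (\<psi> s) n))"
    and "(\<lambda>p. G (fst p) (snd p)) \<in> borel_measurable borel \<Longrightarrow>
      AE s in lborel. s \<in> {0..t} \<longrightarrow> (\<forall>x. fser (v s) x = complex_of_real (G s x)) \<Longrightarrow>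
      complex_of_real (LINT s|lebesgue_on {0..t}. LINT x|TX. G s x * \<psi> s x) =
      (LINT n|C. LINT s|lborel. indicator {0..t} s *\<^sub>R (v s n * tcoef (\<psi> s) n))"
proof -
  interpret P: pair_sigma_finite lborel C ..
  note v[measurable]
  have [measurable]: "(\<lambda>s. tcoef (\<psi> s) n) \<in> borel_measurable borel" for n
    by (intro borel_measurable_continuous_onI tcoef_continuous \<psi>)
  obtain M where M: "0 \<le> M" "\<And>s n. s \<in> {0..t} \<Longrightarrow> cmod (tcoef (\<psi> s) n) \<le> M"
    using tcoef_bound[OF \<psi>] by blast
  define J where "J s n = indicator {0..t} s *\<^sub>R (v s n * tcoef (\<psi> s) n)" for s n
  have Jm [measurable]: "(\<lambda>s. J s n) \<in> borel_measurable borel" for n unfolding J_def by measurable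
  have [measurable]: "(\<lambda>(s, n). J s n) \<in> borel_measurable (lborel \<Otimes>\<^sub>M C)"
    by (rule measurable_pair_C) simp
  have vm [measurable]: "(\<lambda>s. l1norm (v s)) \<in> borel_measurable borel"
    by (rule wnorm_measurable) simp_all
  have int: "integrable (lborel \<Otimes>\<^sub>M C) (\<lambda>(s, n). J s n)"
  proof (rule integrableI_bounded)
    have "(\<integral>\<^sup>+p. ennreal (norm (case p of (s, n) \<Rightarrow> J s n)) \<partial>(lborel \<Otimes>\<^sub>M C)) = (\<integral>\<^sup>+s. \<integral>\<^sup>+n. ennreal (norm (J s n)) \<partial>C \<partial>lborel)"
      by (subst C.nn_integral_fst[symmetric]) auto
    also have "\<dots> \<le> (\<integral>\<^sup>+s. ennreal M * (l1norm (v s) * indicator {0..t} s) \<partial>lborel)"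
    proof (intro nn_integral_mono)
      fix s
      have "(\<integral>\<^sup>+n. ennreal (norm (J s n)) \<partial>C) \<le> (\<integral>\<^sup>+n. ennreal M * indicator {0..t} s * ennreal (1 * cmod (v s n)) \<partial>C)"
      proof (intro nn_integral_mono)
        fix n
        show "ennreal (norm (J s n)) \<le> ennreal M * indicator {0..t} s * ennreal (1 * cmod (v s n))"
        proof (cases "s \<in> {0..t}")
          case True
          have "cmod (v s n) * cmod (tcoef (\<psi> s) n) \<le> cmod (v s n) * M" using M(2)[OF True] by (intro mult_left_mono) auto
          then show ?thesis using True M(1) by (simp add: J_def norm_mult ennreal_mult[symmetric] ennreal_leI mult.commute)
        qed (simp add: J_def)
      qed
      also have "\<dots> = ennreal M * indicator {0..t} s * l1norm (v s)" by (simp add: wnorm_def nn_integral_cmult)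
      finally show "(\<integral>\<^sup>+n. ennreal (norm (J s n)) \<partial>C) \<le> ennreal M * (l1norm (v s) * indicator {0..t} s)" by (simp add: mult_ac)
    qed
    also have "\<dots> = ennreal M * (\<integral>\<^sup>+s\<in>{0..t}. l1norm (v s) \<partial>lborel)"
      by (rule nn_integral_cmult) measurable
    also have "\<dots> < \<infinity>" using fin by (simp add: ennreal_mult_less_top)
    finally show "(\<integral>\<^sup>+p. ennreal (norm (case p of (s, n) \<Rightarrow> J s n)) \<partial>(lborel \<Otimes>\<^sub>M C)) < \<infinity>" .
  qed simp
  show "integrable C (\<lambda>n. LINT s|lborel. indicator {0..t} s *\<^sub>R (v s n * tcoef (\<psi> s) n))"
    using P.integrable_snd[OF int] by (simp add: J_def)
  show "integrable lborel (\<lambda>s. indicator {0..t} s *\<^sub>R (v s n * tcoef (\<psi> s) n))"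
  proof -
    have "integrable lborel (\<lambda>s. J s n)"
    proof (rule integrableI_bounded)
      have "(\<integral>\<^sup>+s. ennreal (norm (J s n)) \<partial>lborel) \<le> (\<integral>\<^sup>+s. \<integral>\<^sup>+n. ennreal (norm (J s n)) \<partial>C \<partial>lborel)"
        using norm_le_wnorm[of "\<lambda>_. 1" n "J _"] by (intro nn_integral_mono) (simp add: wnorm_def)
      also have "\<dots> = (\<integral>\<^sup>+p. ennreal (norm (case p of (s, n) \<Rightarrow> J s n)) \<partial>(lborel \<Otimes>\<^sub>M C))"
        by (subst C.nn_integral_fst[symmetric]) auto
      also have "\<dots> < \<infinity>" using int by (simp add: integrable_iff_bounded)
      finally show "(\<integral>\<^sup>+s. ennreal (norm (J s n)) \<partial>lborel) < \<infinity>" .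
    qed simp
    then show ?thesis by (simp add: J_def)
  qed
  assume G: "(\<lambda>p. G (fst p) (snd p)) \<in> borel_measurable borel"
    and Gv: "AE s in lborel. s \<in> {0..t} \<longrightarrow> (\<forall>x. fser (v s) x = complex_of_real (G s x))"
  define I where "I s = (LINT x|TX. G s x * \<psi> s x)" for s
  have [measurable]: "I \<in> borel_measurable borel"
    unfolding I_def
  proof (rule X.borel_measurable_lebesgue_integral)
    have "(\<lambda>p. \<psi> (fst p) (snd p)) \<in> borel_measurable borel"
      by (intro borel_measurable_continuous_onI smooth2_continuous \<psi>)
    with G have "(\<lambda>p. G (fst p) (snd p) * \<psi> (fst p) (snd p)) \<in> borel_measurable borel" by (rule borel_measurable_times)
    from borel_pair_lebesgue_on[OF this] show "(\<lambda>(s, x). G s x * \<psi> s x) \<in> borel_measurable (borel \<Otimes>\<^sub>M TX)"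
      by (simp add: case_prod_unfold)
  qed
  have "AE s in lborel. l1norm (v s) * indicator {0..t} s \<noteq> \<infinity>"
    by (rule nn_integral_noteq_infinite) (use fin in auto)
  with Gv have "AE s in lborel. indicator {0..t} s *\<^sub>R complex_of_real (I s) = (LINT n|C. J s n)"
  proof eventually_elim
    fix s assume eq: "s \<in> {0..t} \<longrightarrow> (\<forall>x. fser (v s) x = complex_of_real (G s x))"
      and f: "l1norm (v s) * indicator {0..t} s \<noteq> \<infinity>"
    show "indicator {0..t} s *\<^sub>R complex_of_real (I s) = (LINT n|C. J s n)"
    proof (cases "s \<in> {0..t}")
      case True
      have "integrable C (v s)" using f True by (simp add: integrable_C_iff less_top)
      moreover have "integrable TX (\<lambda>x. complex_of_real (\<psi> s x))"
        by (intro continuous_imp_integrable_real continuous_intros smooth2_continuous(2) \<psi>)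
      ultimately have "(LINT x|TX. fser (v s) x * complex_of_real (\<psi> s x)) = (LINT n|C. v s n * tcoef (\<psi> s) n)"
        unfolding tcoef_def by (rule fser_pair)
      moreover have "(LINT x|TX. fser (v s) x * complex_of_real (\<psi> s x)) = complex_of_real (I s)"
        using eq True by (simp add: I_def flip: integral_complex_of_real)
      ultimately show ?thesis using True by (simp add: J_def)
    qed (simp add: J_def)
  qed
  then have "(LINT s|lborel. indicator {0..t} s *\<^sub>R complex_of_real (I s)) = (LINT s|lborel. LINT n|C. J s n)"
    by (intro integral_cong_AE) measurable
  moreover have "(LINT s|lborel. LINT n|C. J s n) = (LINT n|C. LINT s|lborel. J s n)"
    by (rule P.Fubini_integral[OF int, symmetric])
  moreover have "complex_of_real (LINT s|lebesgue_on {0..t}. I s) = (LINT s|lborel. indicator {0..t} s *\<^sub>R complex_of_real (I s))"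
    by (subst integral_complex_of_real[symmetric], rule integral_lebesgue_on_Icc) measurable
  ultimately show "complex_of_real (LINT s|lebesgue_on {0..t}. LINT x|TX. G s x * \<psi> s x) =
      (LINT n|C. LINT s|lborel. indicator {0..t} s *\<^sub>R (v s n * tcoef (\<psi> s) n))"
    by (simp add: I_def J_def)
qed

section \<open>The equation of a single mode, tested in time\<close>

context thin_film begin

lemma sol_measurable [measurable]: "(\<lambda>t. sol t n) \<in> borel_measurable borel"
  using good_sol by (rule good_measurable)

lemma nonlin_integrable: "integrable lborel (\<lambda>s. N (sol s) n)"
proof (rule mode_integrable)
  show "(\<lambda>s. N (sol s) n) \<in> borel_measurable borel" for n by (rule nonlin_good_measurable[OF good_sol])
  show "(\<integral>\<^sup>+s. S s (N (sol s)) \<partial>lborel) < \<infinity>"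
    by (rule order_le_less_trans[OF nonlin_L1[OF good_sol]]) simp
qed

text \<open>On {0..t} the mode is e^{-ls} times the datum plus a primitive of e^{lr} N. Moving
  e^{-ls} onto the test function makes the integration by parts applicable; differentiating e^{-ls}
  c then returns both c' and the term with -L.\<close>

lemma sol_mode:
  fixes c c' :: "real \<Rightarrow> complex"
  assumes t: "0 \<le> t" and c: "\<And>s. (c has_vector_derivative c' s) (at s)" and c': "continuous_on UNIV c'"
  shows "sol t n * c t - zh n * c 0 = (LINT s|lborel. indicator {0..t} s *\<^sub>R (sol s n * c' s))
     + (LINT s|lborel. indicator {0..t} s *\<^sub>R ((- of_real (L n) * sol s n + N (sol s) n) * c s))"
proof -
  define l where "l = L n"
  \<comment> \<open>The cut-off to {0..t} keeps e^{lr} N integrable on the whole line.\<close>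
  define f where "f r = indicator {0..t} r *\<^sub>R (complex_of_real (exp (l * r)) * N (sol r) n)" for r
  have f: "integrable lborel f" unfolding f_def
    by (rule integrable_Icc_mult[OF nonlin_integrable]) (intro continuous_intros)
  define F where "F s = primitive0 f s" for s
  have cc: "continuous_on UNIV c" by (intro continuous_at_imp_continuous_on ballI has_vector_derivative_continuous[OF c])
  define g where "g s = complex_of_real (exp (- l * s)) * c s" for s
  define g' where "g' s = complex_of_real (exp (- l * s)) * (c' s - of_real l * c s)" for s
  have g: "(g has_vector_derivative g' s) (at s)" for s
  proof -
    have "((\<lambda>s. exp (- l * s)) has_real_derivative - l * exp (- l * s)) (at s)"
      by (auto intro!: derivative_eq_intros)
    then have "((\<lambda>s. complex_of_real (exp (- l * s))) has_vector_derivative complex_of_real (- l * exp (- l * s))) (at s)"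
      by (rule has_vector_derivative_of_real)
    from has_vector_derivative_mult[OF this c] show ?thesis
      by (simp add: g_def[abs_def] g'_def algebra_simps)
  qed
  have g'c: "continuous_on UNIV g'" unfolding g'_def[abs_def] by (intro continuous_intros cc c')
  have sol: "sol s n = complex_of_real (exp (- l * s)) * (zh n + F s)" if "s \<in> {0..t}" for s
  proof -
    have "(LINT r|lborel. (if 0 \<le> r \<and> r \<le> s then of_real (exp (- l * (s - r))) * N (sol r) n else 0))
      = (LINT r|lborel. complex_of_real (exp (- l * s)) * (if 0 \<le> r \<and> r \<le> s then f r else 0))"
    proof (intro LINT_cong refl)
      fix r
      have "exp (- l * (s - r)) = exp (- l * s) * exp (l * r)" by (simp add: exp_add[symmetric] algebra_simps)
      then show "(if 0 \<le> r \<and> r \<le> s then of_real (exp (- l * (s - r))) * N (sol r) n else 0) = complex_of_real (exp (- l * s)) * (if 0 \<le> r \<and> r \<le> s then f r else 0)"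
        using that by (simp add: f_def)
    qed
    also have "\<dots> = complex_of_real (exp (- l * s)) * F s" unfolding F_def by (rule integral_mult_right_zero)
    finally have *: "(LINT r|lborel. (if 0 \<le> r \<and> r \<le> s then of_real (exp (- l * (s - r))) * N (sol r) n else 0)) = complex_of_real (exp (- l * s)) * F s" .
    have "sol s n = complex_of_real (exp (- l * s)) * zh n + (LINT r|lborel. (if 0 \<le> r \<and> r \<le> s then of_real (exp (- l * (s - r))) * N (sol r) n else 0))"
      using that unfolding l_def by (subst sol_fixed_point[symmetric]) (simp add: Phi_def duhamel_def)
    then show ?thesis unfolding * by (simp only: distrib_left)
  qed
  have i1: "integrable lborel (\<lambda>s. indicator {0..t} s *\<^sub>R (g' s * zh n))"
    using integrable_mult_left[OF borel_integrable_atLeastAtMost'[OF continuous_on_subset[OF g'c subset_UNIV], of 0 t, unfolded set_integrable_def], of "zh n"] by simp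
  have i2: "integrable lborel (\<lambda>s. indicator {0..t} s *\<^sub>R (g' s * F s))"
    unfolding F_def by (rule integral_by_parts_AC(1)[OF f t g g'c])
  have gc: "continuous_on UNIV g" unfolding g_def[abs_def] by (intro continuous_intros cc)
  have i3: "integrable lborel (\<lambda>s. indicator {0..t} s *\<^sub>R (g s * f s))"
    by (rule integrable_Icc_mult[OF f gc])
  have ftc: "(LINT s|lborel. indicator {0..t} s *\<^sub>R g' s) = g t - g 0"
    using t by (intro integral_FTC_Icc has_vector_derivative_at_within[OF g] continuous_on_subset[OF g'c]) auto
  have "sol t n * c t - zh n * c 0 = (g t - g 0) * zh n + g t * F t"
    using sol[of t] t by (simp add: g_def algebra_simps)
  also have "\<dots> = (LINT s|lborel. indicator {0..t} s *\<^sub>R (g' s * zh n)) + ((LINT s|lborel. indicator {0..t} s *\<^sub>R (g' s * F s)) + (LINT s|lborel. indicator {0..t} s *\<^sub>R (g s * f s)))"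
    unfolding ftc[symmetric] integral_by_parts_AC(2)[OF f t g g'c, folded F_def]
    by (subst integral_mult_left_zero[symmetric]) simp
  also have "\<dots> = (LINT s|lborel. indicator {0..t} s *\<^sub>R (g' s * zh n) + (indicator {0..t} s *\<^sub>R (g' s * F s) + indicator {0..t} s *\<^sub>R (g s * f s)))"
    using i1 i2 i3 by simp
  also have "\<dots> = (LINT s|lborel. indicator {0..t} s *\<^sub>R (sol s n * c' s) + indicator {0..t} s *\<^sub>R ((- of_real (L n) * sol s n + N (sol s) n) * c s))"
  proof (intro LINT_cong refl)
    fix s
    show "indicator {0..t} s *\<^sub>R (g' s * zh n) + (indicator {0..t} s *\<^sub>R (g' s * F s) + indicator {0..t} s *\<^sub>R (g s * f s))
      = indicator {0..t} s *\<^sub>R (sol s n * c' s) + indicator {0..t} s *\<^sub>R ((- of_real (L n) * sol s n + N (sol s) n) * c s)"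
    proof (cases "s \<in> {0..t}")
      case True
      have "complex_of_real (exp (l * s)) * complex_of_real (exp (- (l * s))) = 1"
        by (simp flip: of_real_mult exp_add)
      then have "g s * f s = N (sol s) n * c s" using True by (simp add: g_def f_def mult.assoc mult.left_commute)
      moreover have "g' s * zh n + g' s * F s = sol s n * (c' s - of_real (L n) * c s)"
        unfolding sol[OF True] g'_def l_def by (simp add: algebra_simps)
      ultimately show ?thesis using True by (simp add: algebra_simps)
    qed simp
  qed
  also have "\<dots> = (LINT s|lborel. indicator {0..t} s *\<^sub>R (sol s n * c' s))
     + (LINT s|lborel. indicator {0..t} s *\<^sub>R ((- of_real (L n) * sol s n + N (sol s) n) * c s))"
  proof (rule Bochner_Integration.integral_add)
    have s: "integrable lborel (\<lambda>s. indicator {0..t} s *\<^sub>R sol s n)"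
    proof (rule Bochner_Integration.integrable_bound[of lborel "\<lambda>s. (2 * z) * indicator {0..t} s"])
      show "integrable lborel (\<lambda>s. 2 * z * indicator {0..t} s)"
        by (intro integrable_mult_right integrable_real_indicator) (use t in auto)
      show "AE s in lborel. norm (indicator {0..t} s *\<^sub>R sol s n) \<le> norm (2 * z * indicator {0..t} s)"
        using good_norm[OF good_sol] z(1) by (auto simp: indicator_def)
    qed simp
    have s2: "integrable lborel (\<lambda>s. indicator {0..t} s *\<^sub>R (h s * sol s n))" if "continuous_on UNIV h" for h
    proof -
      have "(\<lambda>s. indicator {0..t} s *\<^sub>R (h s * (indicator {0..t} s *\<^sub>R sol s n))) = (\<lambda>s. indicator {0..t} s *\<^sub>R (h s * sol s n))"
        by (auto simp: fun_eq_iff indicator_def)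
      then show ?thesis using integrable_Icc_mult[OF s that, of t] by simp
    qed
    show "integrable lborel (\<lambda>s. indicator {0..t} s *\<^sub>R (sol s n * c' s))"
      using s2[OF c'] by (simp add: mult.commute)
    have "integrable lborel (\<lambda>s. (- of_real (L n)) * (indicator {0..t} s *\<^sub>R (c s * sol s n)) + indicator {0..t} s *\<^sub>R (c s * N (sol s) n))"
      by (intro Bochner_Integration.integrable_add integrable_mult_right s2 cc integrable_Icc_mult nonlin_integrable)
    then show "integrable lborel (\<lambda>s. indicator {0..t} s *\<^sub>R ((- of_real (L n) * sol s n + N (sol s) n) * c s))"
      by (simp add: algebra_simps)
  qed
  finally show ?thesis .
qed

end

subsection \<open>Regularity of the solution and the weak formulation\<close>

text \<open>Both sides are suprema of finite partial sums; monotone convergence along the intervals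
  {-k..k} exhausts the integers.\<close>

lemma infsum_eq_nn_integral:
  fixes f :: "int \<Rightarrow> ennreal"
  shows "(\<Sum>\<^sub>\<infinity>n\<in>UNIV. f n) = (\<integral>\<^sup>+n. f n \<partial>C)"
proof (rule antisym)
  have fin: "sum f F = (\<integral>\<^sup>+n. f n * indicator F n \<partial>C)" if "finite F" for F
    using that by (subst nn_integral_count_space'[of F]) (auto simp: indicator_def)
  have inf: "(\<Sum>\<^sub>\<infinity>n\<in>UNIV. f n) = (SUP F\<in>{F. finite F \<and> F \<subseteq> UNIV}. sum f F)"
    by (rule nonneg_infsum_complete) simp
  show "(\<Sum>\<^sub>\<infinity>n\<in>UNIV. f n) \<le> (\<integral>\<^sup>+n. f n \<partial>C)"
    unfolding inf by (rule SUP_least) (auto simp: fin indicator_def intro!: nn_integral_mono)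
  have "f n = (SUP k. f n * indicator {- int k..int k} n)" for n
  proof (rule antisym)
    show "f n \<le> (SUP k. f n * indicator {- int k..int k} n)"
      by (rule SUP_upper2[of "nat \<bar>n\<bar>"]) (auto simp: indicator_def)
    show "(SUP k. f n * indicator {- int k..int k} n) \<le> f n"
      by (rule SUP_least) (auto simp: indicator_def)
  qed
  then have "(\<integral>\<^sup>+n. f n \<partial>C) = (\<integral>\<^sup>+n. (SUP k. f n * indicator {- int k..int k} n) \<partial>C)" by metis
  also have "\<dots> = (SUP k. \<integral>\<^sup>+n. f n * indicator {- int k..int k} n \<partial>C)"
    by (intro nn_integral_monotone_convergence_SUP) (auto simp: incseq_def le_fun_def indicator_def)
  also have "\<dots> \<le> (\<Sum>\<^sub>\<infinity>n\<in>UNIV. f n)"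
    unfolding inf by (rule SUP_least) (auto simp flip: fin intro!: SUP_upper)
  finally show "(\<integral>\<^sup>+n. f n \<partial>C) \<le> (\<Sum>\<^sub>\<infinity>n\<in>UNIV. f n)" .
qed

lemma anorm_eq_wnorm:
  "anorm s lam g = wnorm (\<lambda>n. (1 + real_of_int \<bar>n\<bar>) ^ s * exp (lam * real_of_int \<bar>n\<bar>)) (fourier_coeff g)"
  by (simp add: anorm_def wnorm_def infsum_eq_nn_integral)

lemma AE_lebesgue_on:
  assumes "AE t in lborel. P t"
  shows "AE t in lebesgue_on ({a..b} :: real set). P t"
  using AE_completion[OF assms] by (subst AE_restrict_space_iff) auto

lemma fourier_coeff_cnj: "fourier_coeff g (- n) = cnj (fourier_coeff g n)"
proof -
  define A where "A n x = complex_of_real (g x) * exp (- \<i> * of_int n * complex_of_real x)" for n x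
  have "A (- n) x = cnj (A n x)" for x
    by (simp add: A_def exp_cnj)
  then have "(LINT x|TX. A (- n) x) = cnj (LINT x|TX. A n x)" by simp
  then show ?thesis unfolding fourier_coeff_def A_def[symmetric] by simp
qed

lemma idiff_cnj: "(\<And>n. u (- n) = cnj (u n)) \<Longrightarrow> idiff j u (- n) = cnj (idiff j u n)"
  by (simp add: diag_def)

lemma idiff_Suc: "idiff 1 (idiff j u) = idiff (Suc j) u"
  by (simp add: diag_def fun_eq_iff mult.assoc)

text \<open>Translates between genuine derivatives, as they occur in the fluxes, and
  \<open>dpow\<close>, in which \<open>nonlin\<close> is written.\<close>

lemma conv_idiff: "conv u (idiff j v) n = \<i> ^ j * conv u (dpow j v) n"
proof -
  have "(\<lambda>k. u k * idiff j v (n - k)) = (\<lambda>k. \<i> ^ j * (u k * dpow j v (n - k)))"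
    by (simp add: diag_def fun_eq_iff power_mult_distrib mult_ac)
  then show ?thesis unfolding conv_def by simp
qed

section \<open>The solution and its derivatives in physical space\<close>

context thin_film begin

text \<open>Defined by a series at every time, hence jointly measurable in t and x. That
  \<open>zeta (Suc j)\<close> differentiates \<open>zeta j\<close> is established at the times where
  \<open>H\<close> is finite.\<close>

definition zeta :: "nat \<Rightarrow> real \<Rightarrow> real \<Rightarrow> real" where
  "zeta j t x = Re (fser (idiff j (sol t)) x)"

lemma zeta_0: "zeta 0 t x = Re (fser (sol t) x)"
  by (simp add: zeta_def diag_def[abs_def])

lemma zeta_measurable: "(\<lambda>p. zeta j (fst p) (snd p)) \<in> borel_measurable borel"
proof -
  have [measurable]: "(\<lambda>t. idiff j (sol t) n) \<in> borel_measurable borel" for n unfolding diag_def by measurable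
  have "(\<lambda>p. fser (idiff j (sol (fst p))) (snd p)) \<in> borel_measurable (borel \<Otimes>\<^sub>M borel)"
    unfolding fser_def
  proof (rule C.borel_measurable_lebesgue_integral, rule measurable_pair_C)
    fix n
    have "(\<lambda>p. cis (of_int n * snd p)) \<in> borel_measurable (borel \<Otimes>\<^sub>M borel)"
      by (rule measurable_compose[OF measurable_snd cis_measurable])
    then show "(\<lambda>p. idiff j (sol (fst p)) n * cis (of_int n * snd p)) \<in> borel_measurable (borel \<Otimes>\<^sub>M borel)"
      by measurable
  qed
  then show ?thesis unfolding zeta_def by (simp add: borel_prod)
qed

lemma wnorm_le_S: "l1norm (sol s) \<le> S s (sol s)"
  by (rule wnorm_mono, rule mult_right_mono[OF W.W_ge1]) simp

lemma wnorm_sol: "l1norm (sol s) \<le> ennreal (2 * z)"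
  by (rule order_trans[OF wnorm_le_S]) (use good_sol in \<open>simp add: good_def\<close>)

lemma integrable_sol: "integrable C (sol s)"
  unfolding integrable_C_iff by (rule order_le_less_trans[OF wnorm_sol]) simp

text \<open>All orders up to 4, including 0, are dominated by \<open>H\<close> alone: for nonzero n
  because |n|^j \<le> n^4 and W \<ge> 1, for n = 0 because the mean vanishes. Hence one integrable
  function \<open>Bd\<close> bounds every derivative required.\<close>

lemma wnorm_idiff:
  assumes "j \<le> 4"
  shows "l1norm (idiff j (sol s)) \<le> H s (sol s)"
proof (rule wnorm_mono)
  fix n
  show "1 * cmod (idiff j (sol s) n) \<le> of_int n ^ 4 * W s n * cmod (sol s n)"
  proof (cases "n = 0")
    case True
    then show ?thesis using good_sol by (simp add: diag_def good_def)
  next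
    case False
    then have "\<bar>real_of_int n\<bar> ^ j \<le> \<bar>real_of_int n\<bar> ^ 4" by (intro power_increasing assms) linarith
    then have "\<bar>real_of_int n\<bar> ^ j * 1 \<le> of_int n ^ 4 * W s n" using W.W_ge1 by (intro mult_mono) auto
    then have "\<bar>real_of_int n\<bar> ^ j * cmod (sol s n) \<le> of_int n ^ 4 * W s n * cmod (sol s n)"
      by (intro mult_right_mono) auto
    then show ?thesis by (simp add: diag_def norm_mult norm_power)
  qed
qed

lemma integrable_idiff:
  assumes "H s (sol s) < \<infinity>" "j \<le> 4"
  shows "integrable C (idiff j (sol s))"
  unfolding integrable_C_iff by (rule order_le_less_trans[OF wnorm_idiff[OF assms(2)] assms(1)])

lemma fser_zeta: "fser (idiff j (sol t)) x = complex_of_real (zeta j t x)"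
  unfolding zeta_def by (rule fser_cnj, rule idiff_cnj, rule sol_cnj)

lemma fser_sol: "fser (sol t) x = complex_of_real (zeta 0 t x)"
  unfolding zeta_0 by (rule fser_cnj, rule sol_cnj)

lemma zeta_DERIV:
  assumes "H t (sol t) < \<infinity>" "j < 4"
  shows "(zeta j t has_real_derivative zeta (Suc j) t x) (at x)"
proof -
  have "integrable C (idiff j (sol t))" "integrable C (idiff 1 (idiff j (sol t)))"
    unfolding idiff_Suc using assms by (intro integrable_idiff; simp)+
  from fser_DERIV[OF this] show ?thesis unfolding idiff_Suc zeta_def[symmetric] by (simp add: zeta_def[abs_def])
qed

definition Bd :: "real \<Rightarrow> real" where "Bd t = enn2real (H t (sol t))"

lemma zeta_le_Bd:
  assumes "H t (sol t) < \<infinity>" "j \<le> 4"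
  shows "\<bar>zeta j t x\<bar> \<le> Bd t"
proof -
  have "l1norm (idiff j (sol t)) \<le> ennreal (Bd t)"
    using wnorm_idiff[OF assms(2), of t] assms(1) by (simp add: Bd_def)
  from fser_bound[OF this] have "cmod (fser (idiff j (sol t)) x) \<le> Bd t" by (simp add: Bd_def)
  then show ?thesis unfolding fser_zeta by simp
qed

lemma Bd_integrable: "integrable (lebesgue_on {0..T}) Bd"
proof -
  have [measurable]: "(\<lambda>s. H s (sol s)) \<in> borel_measurable borel" by (rule S_measurable(2)) simp
  have [measurable]: "Bd \<in> borel_measurable borel" unfolding Bd_def[abs_def] by measurable
  have "integrable lborel Bd"
  proof (rule integrableI_bounded)
    have "(\<integral>\<^sup>+t. ennreal (norm (Bd t)) \<partial>lborel) \<le> (\<integral>\<^sup>+t. H t (sol t) \<partial>lborel)"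
      by (intro nn_integral_mono) (simp add: Bd_def ennreal_enn2real_if)
    also have "\<dots> \<le> ennreal (2 * z / \<kappa>)" using good_sol by (simp add: good_def)
    also have "\<dots> < \<infinity>" by simp
    finally show "(\<integral>\<^sup>+t. ennreal (norm (Bd t)) \<partial>lborel) < \<infinity>" .
  qed simp
  then have "integrable lebesgue Bd" by (subst integrable_completion) simp_all
  then have "integrable lebesgue (\<lambda>t. indicator {0..T} t *\<^sub>R Bd t)" by (rule integrable_mult_indicator[rotated]) simp
  then show ?thesis by (subst integrable_restrict_space) simp_all
qed

section \<open>Analytic norms of the solution\<close>

lemma zeta_coeff: "fourier_coeff (zeta 0 t) n = sol t n"
  using fourier_coeff_fser[OF integrable_sol[of t], of n] sol_cnj by (simp add: zeta_0[abs_def])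

text \<open>\<open>W\<close> exceeds e^{\<nu> t |n|} at least by the factor e^{\<delta> t / 64}, the
  same for all modes, and its inverse is the exponential decay.\<close>

lemma anorm_0_le:
  assumes t: "0 \<le> t" and \<nu>: "\<nu> \<le> \<delta> / 2"
  shows "anorm 0 (\<nu> * t) (zeta 0 t) \<le> ennreal (exp (- (t / 64) * \<delta>)) * S t (sol t)"
proof -
  have "anorm 0 (\<nu> * t) (zeta 0 t) = wnorm (\<lambda>n. exp (\<nu> * t * real_of_int \<bar>n\<bar>)) (sol t)"
    by (simp add: anorm_eq_wnorm zeta_coeff[abs_def])
  also have "\<dots> \<le> (\<integral>\<^sup>+n. ennreal (exp (- (t / 64) * \<delta>)) * ennreal (W t n * cmod (sol t n)) \<partial>C)"
    unfolding wnorm_def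
  proof (rule nn_integral_mono)
    fix n
    have "\<nu> * (t * real_of_int \<bar>n\<bar>) \<le> \<delta> / 2 * (t * real_of_int \<bar>n\<bar>)" using t \<nu> by (intro mult_right_mono) auto
    then have "\<nu> * t * real_of_int \<bar>n\<bar> \<le> - (t / 64) * \<delta> + \<theta> n * max 0 t"
      using t by (simp add: \<theta>_def algebra_simps)
    then have "exp (\<nu> * t * real_of_int \<bar>n\<bar>) \<le> exp (- (t / 64) * \<delta>) * W t n"
      unfolding W_def exp_add[symmetric] by simp
    then have "exp (\<nu> * t * real_of_int \<bar>n\<bar>) * cmod (sol t n) \<le> exp (- (t / 64) * \<delta>) * W t n * cmod (sol t n)"
      by (rule mult_right_mono) simp
    then show "ennreal (exp (\<nu> * t * real_of_int \<bar>n\<bar>) * cmod (sol t n)) \<le> ennreal (exp (- (t / 64) * \<delta>)) * ennreal (W t n * cmod (sol t n))"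
      by (simp only: ennreal_mult'[symmetric, OF exp_ge_zero] mult.assoc ennreal_leI)
  qed
  also have "\<dots> = ennreal (exp (- (t / 64) * \<delta>)) * S t (sol t)" unfolding wnorm_def by (rule nn_integral_cmult) simp
  finally show ?thesis .
qed

lemma anorm_4_le:
  assumes t: "0 \<le> t" and \<nu>: "\<nu> \<le> \<delta> / 2"
  shows "anorm 4 (\<nu> * t) (zeta 0 t) \<le> 16 * H t (sol t)"
proof -
  have "anorm 4 (\<nu> * t) (zeta 0 t) = wnorm (\<lambda>n. (1 + real_of_int \<bar>n\<bar>) ^ 4 * exp (\<nu> * t * real_of_int \<bar>n\<bar>)) (sol t)"
    by (simp add: anorm_eq_wnorm zeta_coeff[abs_def])
  also have "\<dots> \<le> (\<integral>\<^sup>+n. 16 * ennreal (of_int n ^ 4 * W t n * cmod (sol t n)) \<partial>C)"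
    unfolding wnorm_def
  proof (rule nn_integral_mono)
    fix n
    show "ennreal ((1 + real_of_int \<bar>n\<bar>) ^ 4 * exp (\<nu> * t * real_of_int \<bar>n\<bar>) * cmod (sol t n)) \<le> 16 * ennreal (of_int n ^ 4 * W t n * cmod (sol t n))"
    proof (cases "n = 0")
      case True
      then show ?thesis using good_sol by (simp add: good_def)
    next
      case False
      then have "1 + real_of_int \<bar>n\<bar> \<le> 2 * real_of_int \<bar>n\<bar>" by linarith
      then have "(1 + real_of_int \<bar>n\<bar>) ^ 4 \<le> (2 * real_of_int \<bar>n\<bar>) ^ 4" by (intro power_mono) auto
      also have "\<dots> = 16 * real_of_int n ^ 4" by (simp add: power_mult_distrib)
      finally have 1: "(1 + real_of_int \<bar>n\<bar>) ^ 4 \<le> 16 * real_of_int n ^ 4" .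
      have "\<nu> * (t * real_of_int \<bar>n\<bar>) \<le> \<delta> / 2 * (t * real_of_int \<bar>n\<bar>)" using t \<nu> by (intro mult_right_mono) auto
      moreover have "0 \<le> t * \<delta>" using t \<delta>(1) by simp
      ultimately have "\<nu> * t * real_of_int \<bar>n\<bar> \<le> \<theta> n * max 0 t"
        using t by (simp add: \<theta>_def algebra_simps)
      then have "exp (\<nu> * t * real_of_int \<bar>n\<bar>) \<le> W t n" unfolding W_def by simp
      then have "(1 + real_of_int \<bar>n\<bar>) ^ 4 * exp (\<nu> * t * real_of_int \<bar>n\<bar>) * cmod (sol t n) \<le> 16 * of_int n ^ 4 * W t n * cmod (sol t n)"
        using 1 by (intro mult_right_mono mult_mono) auto
      then have "ennreal ((1 + real_of_int \<bar>n\<bar>) ^ 4 * exp (\<nu> * t * real_of_int \<bar>n\<bar>) * cmod (sol t n)) \<le> ennreal (16 * (of_int n ^ 4 * W t n * cmod (sol t n)))"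
        by (intro ennreal_leI) (simp add: mult.assoc)
      also have "\<dots> = 16 * ennreal (of_int n ^ 4 * W t n * cmod (sol t n))"
        by (simp only: ennreal_mult'[of 16] zero_le_numeral ennreal_numeral)
      finally show ?thesis .
    qed
  qed
  also have "\<dots> = 16 * H t (sol t)" unfolding wnorm_def by (rule nn_integral_cmult) simp
  finally show ?thesis .
qed

text \<open>Dropping the decay factor gives the energy estimate, where 16 * \<delta>/64 = \<delta>/4
  is precisely the dissipation available. Keeping it and dropping the integral gives the
  decay.\<close>

lemma sol_analytic:
  assumes t: "0 \<le> t" and \<nu>: "\<nu> \<le> \<delta> / 2"
  shows "anorm 0 (\<nu> * t) (zeta 0 t) + ennreal (\<delta> / 64) * (\<integral>\<^sup>+ s\<in>{0..t}. anorm 4 (\<nu> * s) (zeta 0 s) \<partial>lebesgue) \<le> ennreal z"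
    and "anorm 0 (\<nu> * t) (zeta 0 t) \<le> ennreal z * ennreal (exp (- (t / 64) * \<delta>))"
    and "(\<integral>\<^sup>+ s\<in>{0..t}. anorm 4 (\<nu> * s) (zeta 0 s) \<partial>lebesgue) < \<infinity>"
proof -
  let ?A = "\<integral>\<^sup>+ s\<in>{0..t}. anorm 4 (\<nu> * s) (zeta 0 s) \<partial>lebesgue"
  have [measurable]: "(\<lambda>s. H s (sol s)) \<in> borel_measurable borel" by (rule S_measurable(2)) simp
  define I where "I = (\<integral>\<^sup>+s\<in>{0..t}. H s (sol s) \<partial>lborel)"
  have I: "?A \<le> 16 * I"
  proof -
    have "?A \<le> (\<integral>\<^sup>+s. 16 * (H s (sol s) * indicator {0..t} s) \<partial>lborel)"
      unfolding nn_integral_completion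
      by (intro nn_integral_mono) (auto simp: indicator_def intro: anorm_4_le \<nu>)
    also have "\<dots> = 16 * I" unfolding I_def by (rule nn_integral_cmult) measurable
    finally show ?thesis .
  qed
  have E: "S t (sol t) + ennreal (\<delta> / 4) * I \<le> ennreal z" unfolding I_def by (rule sol_energy[OF t])
  have S: "S t (sol t) \<le> ennreal z"
    by (rule order_trans[OF _ E]) simp
  have "exp (- (t / 64) * \<delta>) \<le> 1" using t \<delta>(1) by simp
  then have "ennreal (exp (- (t / 64) * \<delta>)) \<le> 1" using ennreal_leI by fastforce
  then have "ennreal (exp (- (t / 64) * \<delta>)) * S t (sol t) \<le> 1 * S t (sol t)" by (rule mult_right_mono) simp
  then have a0: "anorm 0 (\<nu> * t) (zeta 0 t) \<le> S t (sol t)"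
    using anorm_0_le[OF t \<nu>] by (simp only: mult_1)
  have "ennreal (\<delta> / 64) * ?A \<le> ennreal (\<delta> / 64) * (16 * I)"
    by (rule mult_left_mono[OF I]) simp
  also have "\<dots> = ennreal (\<delta> / 4) * I"
  proof -
    have "ennreal (\<delta> / 64) * 16 = ennreal (\<delta> / 64 * 16)"
      using \<delta>(1) by (subst ennreal_mult) auto
    then show ?thesis by (simp add: mult.assoc[symmetric])
  qed
  finally show "anorm 0 (\<nu> * t) (zeta 0 t) + ennreal (\<delta> / 64) * ?A \<le> ennreal z"
    by (intro order_trans[OF add_mono[OF a0] E])
  have "anorm 0 (\<nu> * t) (zeta 0 t) \<le> ennreal (exp (- (t / 64) * \<delta>)) * ennreal z"
    by (rule order_trans[OF anorm_0_le[OF t \<nu>] mult_left_mono[OF S]]) simp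
  then show "anorm 0 (\<nu> * t) (zeta 0 t) \<le> ennreal z * ennreal (exp (- (t / 64) * \<delta>))" by (simp only: mult.commute)
  have "I \<le> (\<integral>\<^sup>+s. H s (sol s) \<partial>lborel)" unfolding I_def by (intro nn_integral_mono) (auto simp: indicator_def)
  also have "\<dots> \<le> ennreal (2 * z / \<kappa>)" using good_sol by (simp add: good_def)
  also have "\<dots> < \<infinity>" by simp
  finally have "16 * I < \<infinity>" by (simp add: ennreal_mult_less_top)
  with I show "?A < \<infinity>" by (rule order_le_less_trans)
qed

end

lemma fser_continuous:
  assumes u: "integrable C u"
  shows "continuous_on UNIV (fser u)"
  unfolding continuous_on_sequentially
proof (intro allI ballI impI)
  fix h :: "nat \<Rightarrow> real" and x assume h: "(\<forall>k. h k \<in> UNIV) \<and> h \<longlonglongrightarrow> x"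
  have "(\<lambda>k. LINT n|C. u n * cis (of_int n * h k)) \<longlonglongrightarrow> (LINT n|C. u n * cis (of_int n * x))"
  proof (rule integral_dominated_convergence[where w = "\<lambda>n. norm (u n)"])
    show "AE n in C. (\<lambda>k. u n * cis (of_int n * h k)) \<longlonglongrightarrow> u n * cis (of_int n * x)"
      using h by (intro AE_I2 tendsto_intros) auto
  qed (use u in \<open>auto simp: norm_mult\<close>)
  then show "(fser u \<circ> h) \<longlonglongrightarrow> fser u x" by (simp add: fser_def o_def)
qed

section \<open>Fluxes and the weak formulation\<close>

context thin_film begin

text \<open>A flux bounded by a multiple of \<open>H\<close> inherits integrability in time, which
  is the hypothesis for pairing it with test functions.\<close>

lemma flux_finite:
  assumes "\<And>s. l1norm (v s) \<le> c * H s (sol s)" and c: "c < \<infinity>"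
  shows "(\<integral>\<^sup>+s\<in>{0..t}. l1norm (v s) \<partial>lborel) < \<infinity>"
proof -
  have [measurable]: "(\<lambda>s. H s (sol s)) \<in> borel_measurable borel" by (rule S_measurable(2)) simp
  have "(\<integral>\<^sup>+s\<in>{0..t}. l1norm (v s) \<partial>lborel) \<le> (\<integral>\<^sup>+s. c * H s (sol s) \<partial>lborel)"
    using assms(1) by (intro nn_integral_mono) (simp add: indicator_def)
  also have "\<dots> = c * (\<integral>\<^sup>+s. H s (sol s) \<partial>lborel)" by (rule nn_integral_cmult) measurable
  also have "\<dots> \<le> c * ennreal (2 * z / \<kappa>)"
    using good_sol by (intro mult_left_mono) (auto simp: good_def)
  also have "\<dots> < \<infinity>" using c by (simp add: ennreal_mult_less_top)
  finally show ?thesis .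
qed

lemma wnorm_conv_sol:
  assumes "j \<le> 4" "l1norm u \<le> c"
  shows "l1norm (\<lambda>n. idiff j (sol s) n + conv u (idiff j (sol s)) n) \<le> (1 + c) * H s (sol s)"
proof -
  have "l1norm (\<lambda>n. idiff j (sol s) n + conv u (idiff j (sol s)) n)
    \<le> l1norm (idiff j (sol s)) + l1norm u * l1norm (idiff j (sol s))"
    by (intro order_trans[OF wnorm_add_le] add_mono one.S_conv_le order_refl) simp
  also have "\<dots> \<le> H s (sol s) + c * H s (sol s)"
    by (intro add_mono mult_mono wnorm_idiff assms) simp_all
  finally show ?thesis by (simp add: distrib_right)
qed

lemma wnorm_gam_sol: "\<exists>c<\<infinity>. \<forall>s. l1norm (gam \<epsilon> (sol s)) \<le> c"
proof -
  define R where "R = ennreal (2 * z)"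
  define c where "c = ennreal (cmod (of_real (3 * \<epsilon>))) * R + ennreal (cmod (of_real (3 * \<epsilon>\<^sup>2))) * (R * R) + ennreal (cmod (of_real (\<epsilon> ^ 3))) * (R * R * R)"
  have "l1norm (gam \<epsilon> (sol s)) \<le> c" for s
  proof -
    have 1: "l1norm (sol s) \<le> R" unfolding R_def by (rule wnorm_sol)
    have 2: "l1norm (conv (sol s) (sol s)) \<le> R * R"
      by (intro order_trans[OF one.S_conv_le] mult_mono 1) simp_all
    have 3: "l1norm (conv (conv (sol s) (sol s)) (sol s)) \<le> R * R * R"
      by (intro order_trans[OF one.S_conv_le] mult_mono 1 2) simp_all
    have sc: "l1norm (\<lambda>n. k * u n) \<le> ennreal (cmod k) * b" if "l1norm u \<le> b" for k u b
      using mult_left_mono[OF that, of "ennreal (cmod k)"] by (simp add: wnorm_scale)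
    show ?thesis unfolding c_def gam_def[abs_def]
      by (intro order_trans[OF wnorm_add_le] add_mono sc 1 2 3) simp_all
  qed
  moreover have "c < \<infinity>" by (simp add: c_def R_def ennreal_mult_less_top)
  ultimately show ?thesis by blast
qed

lemma fser_gam_sol:
  "fser (gam \<epsilon> (sol t)) x = complex_of_real ((1 + \<epsilon> * zeta 0 t x) ^ 3 - 1)"
proof -
  have i: "integrable C (\<lambda>n. k * u n)" if "integrable C u" for k :: complex and u using that by simp
  have "fser (gam \<epsilon> (sol t)) x = of_real (3 * \<epsilon>) * fser (sol t) x + of_real (3 * \<epsilon>\<^sup>2) * (fser (sol t) x * fser (sol t) x)
     + of_real (\<epsilon> ^ 3) * (fser (sol t) x * fser (sol t) x * fser (sol t) x)"
    unfolding gam_def[abs_def]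
    by (subst fser_add, (rule i integrable_conv integrable_sol Bochner_Integration.integrable_add)+)+
      (simp add: fser_scale fser_conv integrable_conv integrable_sol)
  also have "\<dots> = complex_of_real ((1 + \<epsilon> * zeta 0 t x) ^ 3 - 1)"
    unfolding fser_sol of_real_mult[symmetric] of_real_add[symmetric] by (intro arg_cong[of _ _ complex_of_real]) algebra
  finally show ?thesis .
qed

lemma integrable_gam_sol: "integrable C (gam \<epsilon> (sol t))"
proof -
  obtain c where "c < \<infinity>" "l1norm (gam \<epsilon> (sol t)) \<le> c" using wnorm_gam_sol by blast
  then show ?thesis unfolding integrable_C_iff by (simp add: order_le_less_trans)
qed

lemma fser_flux:
  assumes fin: "H t (sol t) < \<infinity>" and j: "j \<le> 4" and u: "integrable C u" "fser u x = complex_of_real a"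
  shows "fser (\<lambda>n. idiff j (sol t) n + conv u (idiff j (sol t)) n) x = complex_of_real ((1 + a) * zeta j t x)"
proof -
  note i = integrable_idiff[OF fin j]
  show ?thesis
    unfolding fser_add[OF i integrable_conv[OF u(1) i]] fser_conv[OF u(1) i] fser_zeta u(2)
    by (simp only: distrib_right mult_1_left of_real_add of_real_mult)
qed

text \<open>The algebraic link between weak form and fixed point: with the derivatives of the test
  function transferred to them, the three fluxes add up to the right-hand side of the mode equation.
  Their linear parts give -n^2 - \<beta> n^4 + m n^4 = -L n.\<close>

lemma flux_symbol:
  assumes "v1 = (\<lambda>n. idiff 1 a n + conv (\<lambda>n. of_real \<epsilon> * a n) (idiff 1 a) n)"
    and "v3 = (\<lambda>n. idiff 3 a n + conv (\<lambda>n. of_real \<epsilon> * a n) (idiff 3 a) n)"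
    and "v2 = (\<lambda>n. idiff 2 a n + conv (gam \<epsilon> a) (idiff 2 a) n)"
  shows "\<i> * of_int n * v1 n - of_real \<beta> * (\<i> * of_int n * v3 n) + of_real m * ((\<i> * of_int n) ^ 2 * v2 n)
     = - of_real (L n) * a n + N a n"
proof -
  have c: "conv (\<lambda>n. of_real \<epsilon> * a n) w n = of_real \<epsilon> * conv a w n" for w n
    by (simp add: conv_def mult.assoc)
  have i: "\<i> ^ 3 = - \<i>" by (simp add: power3_eq_cube)
  have d: "idiff 1 a n = \<i> * of_int n * a n" "idiff 3 a n = - \<i> * of_int n ^ 3 * a n" "idiff 2 a n = - (of_int n ^ 2) * a n"
    by (simp_all add: diag_def power_mult_distrib i)
  define K1 K3 K2 where "K1 = conv a (dpow 1 a) n" and "K3 = conv a (dpow 3 a) n" and "K2 = conv (gam \<epsilon> a) (dpow 2 a) n"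
  have v: "v1 n = \<i> * of_int n * a n + of_real \<epsilon> * (\<i> * K1)" "v3 n = - \<i> * of_int n ^ 3 * a n + of_real \<epsilon> * (- \<i> * K3)"
      "v2 n = - (of_int n ^ 2) * a n - K2"
    unfolding assms c conv_idiff d K1_def K3_def K2_def by (simp_all only: i power_one_right) simp_all
  have Nn: "N a n = of_real (- \<epsilon>) * (of_int n * K1) + of_real (- \<beta> * \<epsilon>) * (of_int n * K3) + of_real m * (of_int n ^ 2 * K2)"
    unfolding nonlin_def K1_def K3_def K2_def by (simp only: power_one_right)
  have Ln: "complex_of_real (L n) = of_int n ^ 2 + of_real (\<beta> - m) * of_int n ^ 4"
    unfolding L_def unfolding \<delta>(2) by simp
  have h: "\<i> * of_int n * v1 n = - (of_int n ^ 2 * a n) - of_real \<epsilon> * (of_int n * K1)"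
    "\<i> * of_int n * v3 n = of_int n ^ 4 * a n + of_real \<epsilon> * (of_int n * K3)"
    "(\<i> * of_int n) ^ 2 * v2 n = of_int n ^ 4 * a n + of_int n ^ 2 * K2"
    unfolding v by (simp_all add: algebra_simps power2_eq_square power3_eq_cube power4_eq_xxxx)
  have "\<i> * of_int n * v1 n - of_real \<beta> * (\<i> * of_int n * v3 n) + of_real m * ((\<i> * of_int n) ^ 2 * v2 n)
    = - (of_int n ^ 2 * a n) - of_real \<epsilon> * (of_int n * K1) - of_real \<beta> * (of_int n ^ 4 * a n + of_real \<epsilon> * (of_int n * K3))
      + of_real m * (of_int n ^ 4 * a n + of_int n ^ 2 * K2)"
    unfolding h ..
  then show ?thesis unfolding Nn Ln by (simp only:) (simp add: algebra_simps)
qed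

lemma weak_identity:
  fixes z0 :: "real \<Rightarrow> real"
  assumes z0: "integrable TX z0" "\<And>n. fourier_coeff z0 n = zh n"
    and \<phi>: "test_fun \<phi>" and t: "0 \<le> t"
  shows "(LINT x|TX. zeta 0 t x * \<phi> t x) - (LINT x|TX. z0 x * \<phi> 0 x)
           - (LINT s|lebesgue_on {0..t}. LINT x|TX. zeta 0 s x * pt \<phi> s x)
           = - (LINT s|lebesgue_on {0..t}. LINT x|TX. (1 + \<epsilon> * zeta 0 s x) * zeta 1 s x * px \<phi> s x)
             + \<beta> * (LINT s|lebesgue_on {0..t}. LINT x|TX. (1 + \<epsilon> * zeta 0 s x) * zeta 3 s x * px \<phi> s x)
             + m * (LINT s|lebesgue_on {0..t}. LINT x|TX. (1 + \<epsilon> * zeta 0 s x) ^ 3 * zeta 2 s x * pxx \<phi> s x)"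
proof -
  have pxx: "pxx \<phi> = px (px \<phi>)" by (simp add: pxx_def px_def fun_eq_iff)
  note tf1 = test_fun_px[OF \<phi>] and tf2 = test_fun_px[OF test_fun_px[OF \<phi>]]
  note sm = test_fun_smooth2[OF \<phi>] and sm1 = test_fun_smooth2[OF tf1] and sm2 = test_fun_smooth2[OF tf2]
  note smt = smooth2_cases(1)[OF sm]
  have per: "f s (x + 2 * pi) = f s x" if "test_fun f" for f s x using that by (simp add: test_fun_def tperiodic_def)
  have tpx: "tcoef (px f s) n = - (\<i> * of_int n) * tcoef (f s) n" if f: "test_fun f" for f s n
  proof (rule tcoef_derivative)
    show "(f s has_real_derivative px f s x) (at x)" for x by (rule smooth2_cases(4)[OF test_fun_smooth2[OF f]])
    show "continuous_on UNIV (px f s)" by (rule smooth2_continuous(2)[OF test_fun_smooth2[OF test_fun_px[OF f]]])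
    show "f s (2 * pi) = f s 0" using per[OF f, of s 0] by simp
  qed
  have [measurable]: "(\<lambda>s. diag q (sol s) n) \<in> borel_measurable borel" for q n unfolding diag_def by measurable
  obtain cg where cg: "cg < \<infinity>" "\<And>s. l1norm (gam \<epsilon> (sol s)) \<le> cg" using wnorm_gam_sol by blast
  define ce where "ce = ennreal \<epsilon> * ennreal (2 * z)"
  have ce: "ce < \<infinity>" "l1norm (\<lambda>n. of_real \<epsilon> * sol s n) \<le> ce" for s
    using wnorm_sol \<epsilon> by (auto simp: ce_def ennreal_mult_less_top wnorm_scale intro: mult_left_mono)
  define v1 where "v1 s n = idiff 1 (sol s) n + conv (\<lambda>n. of_real \<epsilon> * sol s n) (idiff 1 (sol s)) n" for s n
  define v3 where "v3 s n = idiff 3 (sol s) n + conv (\<lambda>n. of_real \<epsilon> * sol s n) (idiff 3 (sol s)) n" for s n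
  define v2 where "v2 s n = idiff 2 (sol s) n + conv (gam \<epsilon> (sol s)) (idiff 2 (sol s)) n" for s n
  have gm: "(\<lambda>s. gam \<epsilon> (sol s) n) \<in> borel_measurable borel" for n
    unfolding gam_def by (intro borel_measurable_add borel_measurable_times conv_measurable sol_measurable) simp_all
  have m1: "(\<lambda>s. v1 s n) \<in> borel_measurable borel" and m3: "(\<lambda>s. v3 s n) \<in> borel_measurable borel" and m2: "(\<lambda>s. v2 s n) \<in> borel_measurable borel" for n
    unfolding v1_def v2_def v3_def by (intro borel_measurable_add conv_measurable gm; measurable)+
  have fl: "(\<integral>\<^sup>+s\<in>{0..t}. l1norm (\<lambda>n. idiff j (sol s) n + conv (u s) (idiff j (sol s)) n) \<partial>lborel) < \<infinity>"
    if "j \<le> 4" "d < \<infinity>" "\<And>s. l1norm (u s) \<le> d" for j u d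
    by (rule flux_finite[OF wnorm_conv_sol[OF that(1,3)]]) (use that(2) in simp)
  have f1: "(\<integral>\<^sup>+s\<in>{0..t}. l1norm (v1 s) \<partial>lborel) < \<infinity>" unfolding v1_def[abs_def] by (rule fl[OF _ ce]) simp
  have f3: "(\<integral>\<^sup>+s\<in>{0..t}. l1norm (v3 s) \<partial>lborel) < \<infinity>" unfolding v3_def[abs_def] by (rule fl[OF _ ce]) simp
  have f2: "(\<integral>\<^sup>+s\<in>{0..t}. l1norm (v2 s) \<partial>lborel) < \<infinity>" unfolding v2_def[abs_def] by (rule fl[OF _ cg]) simp
  have f0: "(\<integral>\<^sup>+s\<in>{0..t}. l1norm (sol s) \<partial>lborel) < \<infinity>"
    by (rule flux_finite[of _ 1]) (use wnorm_idiff[of 0] in \<open>auto simp: diag_def[abs_def]\<close>)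
  have zm: "(\<lambda>p. zeta j (fst p) (snd p)) \<in> borel_measurable borel" for j by (rule zeta_measurable)
  note [measurable] = zm
  note fin = good_AE_finite[OF good_sol]
  have e: "fser (\<lambda>n. of_real \<epsilon> * sol s n) x = complex_of_real (\<epsilon> * zeta 0 s x)" "integrable C (\<lambda>n. of_real \<epsilon> * sol s n)" for s x
    using integrable_sol by (auto simp: fser_scale fser_sol)
  have ae1: "AE s in lborel. s \<in> {0..t} \<longrightarrow> (\<forall>x. fser (v1 s) x = complex_of_real ((1 + \<epsilon> * zeta 0 s x) * zeta 1 s x))"
    using fin by eventually_elim (auto simp only: v1_def[abs_def] fser_flux[OF _ _ e(2,1)])
  have ae3: "AE s in lborel. s \<in> {0..t} \<longrightarrow> (\<forall>x. fser (v3 s) x = complex_of_real ((1 + \<epsilon> * zeta 0 s x) * zeta 3 s x))"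
    using fin by eventually_elim (auto simp only: v3_def[abs_def] fser_flux[OF _ _ e(2,1)])
  have ae2: "AE s in lborel. s \<in> {0..t} \<longrightarrow> (\<forall>x. fser (v2 s) x = complex_of_real ((1 + \<epsilon> * zeta 0 s x) ^ 3 * zeta 2 s x))"
    using fin
  proof eventually_elim
    case (elim s)
    from fser_flux[OF this _ integrable_gam_sol fser_gam_sol, of 2] show ?case by (simp add: v2_def[abs_def])
  qed
  define c where "c n s = tcoef (\<phi> s) n" for n s
  have T1: "complex_of_real (LINT x|TX. zeta 0 s x * \<phi> s x) = (LINT n|C. sol s n * c n s)" for s
  proof -
    have "(LINT x|TX. fser (sol s) x * complex_of_real (\<phi> s x)) = (LINT n|C. sol s n * c n s)"
      unfolding c_def tcoef_def
      by (rule fser_pair[OF integrable_sol]) (intro continuous_imp_integrable_real continuous_intros smooth2_continuous(2) sm)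
    then show ?thesis by (simp add: fser_sol flip: integral_complex_of_real)
  qed
  \<comment> \<open>The datum and the series at time 0 share their Fourier coefficients but need not
    agree pointwise. Uniqueness is applied to the difference, tested against the continuous periodic
    function \<open>\<phi> 0\<close>.\<close>
  have T2: "complex_of_real (LINT x|TX. z0 x * \<phi> 0 x) = (LINT n|C. zh n * c n 0)"
  proof -
    have zeta0: "continuous_on UNIV (\<lambda>x. zeta 0 0 x)"
      unfolding zeta_0 by (intro continuous_intros fser_continuous integrable_sol)
    have g: "integrable TX (\<lambda>x. zeta 0 0 x)" by (intro continuous_imp_integrable_real continuous_on_subset[OF zeta0]) simp
    have i: "integrable TX (\<lambda>x. h x * \<phi> 0 x)" if "integrable TX h" for h :: "real \<Rightarrow> real"
    proof -
      have "integrable TX (\<lambda>x. complex_of_real (h x) * complex_of_real (\<phi> 0 x))"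
        using that by (intro integrable_TX_mult continuous_intros smooth2_continuous(2) sm) simp
      then have "integrable TX (\<lambda>x. complex_of_real (h x * \<phi> 0 x))" by simp
      then show ?thesis by (simp only: complex_of_real_integrable_eq)
    qed
    have "(LINT x|TX. (z0 x - zeta 0 0 x) * \<phi> 0 x) = 0"
    proof (rule integral_zero_of_fourier_coeff_zero)
      show "integrable TX (\<lambda>x. z0 x - zeta 0 0 x)" using z0 g by simp
      show "fourier_coeff (\<lambda>x. z0 x - zeta 0 0 x) n = 0" for n
      proof -
        have e: "continuous_on UNIV (\<lambda>x. exp (- \<i> * of_int n * complex_of_real x))" by (intro continuous_intros)
        have "fourier_coeff (\<lambda>x. z0 x - zeta 0 0 x) n = fourier_coeff z0 n - fourier_coeff (zeta 0 0) n"
          unfolding fourier_coeff_def right_diff_distrib[symmetric]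
          using integrable_TX_mult[OF _ e, of "\<lambda>x. complex_of_real (z0 x)"] integrable_TX_mult[OF _ e, of "\<lambda>x. complex_of_real (zeta 0 0 x)"] z0 g
          by (simp add: left_diff_distrib Bochner_Integration.integral_diff)
        then show ?thesis by (simp add: z0 zeta_coeff sol_initial)
      qed
      show "continuous_on UNIV (\<phi> 0)" by (rule smooth2_continuous(2)[OF sm])
      show "\<phi> 0 (x + 2 * pi) = \<phi> 0 x" for x by (rule per[OF \<phi>])
    qed
    then have "(LINT x|TX. z0 x * \<phi> 0 x) = (LINT x|TX. zeta 0 0 x * \<phi> 0 x)"
      by (simp add: left_diff_distrib Bochner_Integration.integral_diff[OF i[OF z0(1)] i[OF g]])
    then show ?thesis using T1[of 0] by (simp add: sol_initial)
  qed
  have ic: "integrable C (\<lambda>n. u n * c n s)" if u: "integrable C u" and s: "0 \<le> s" for u s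
  proof -
    obtain M where M: "cmod (c n s) \<le> M" for n
      using tcoef_bound[OF sm, of s] s unfolding c_def by (metis atLeastAtMost_iff order_refl)
    have "cmod (u n * c n s) \<le> norm (complex_of_real M * u n)" for n
    proof -
      have "cmod (u n) * cmod (c n s) \<le> cmod (u n) * \<bar>M\<bar>" using M[of n] by (intro mult_left_mono) auto
      then show ?thesis by (simp add: norm_mult mult.commute)
    qed
    then show ?thesis
      by (intro Bochner_Integration.integrable_bound[OF integrable_mult_right[OF u, of "complex_of_real M"]]) auto
  qed
  define A where "A n = (LINT s|lborel. indicator {0..t} s *\<^sub>R (sol s n * tcoef (pt \<phi> s) n))" for n
  define b1 where "b1 n s = indicator {0..t} s *\<^sub>R (v1 s n * tcoef (px \<phi> s) n)" for n s
  define b3 where "b3 n s = indicator {0..t} s *\<^sub>R (v3 s n * tcoef (px \<phi> s) n)" for n s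
  define b2 where "b2 n s = indicator {0..t} s *\<^sub>R (v2 s n * tcoef (px (px \<phi>) s) n)" for n s
  note tp0 = time_pair[OF sol_measurable f0 smt, folded A_def] and tp1 = time_pair[OF m1 f1 sm1, folded b1_def]
    and tp3 = time_pair[OF m3 f3 sm1, folded b3_def] and tp2 = time_pair[OF m2 f2 sm2, folded b2_def]
  have P0: "complex_of_real (LINT s|lebesgue_on {0..t}. LINT x|TX. zeta 0 s x * pt \<phi> s x) = (LINT n|C. A n)"
    by (rule tp0(3)[OF zm]) (simp add: fser_sol)
  have P1: "complex_of_real (LINT s|lebesgue_on {0..t}. LINT x|TX. (1 + \<epsilon> * zeta 0 s x) * zeta 1 s x * px \<phi> s x) = (LINT n|C. LINT s|lborel. b1 n s)"
    by (rule tp1(3)[OF _ ae1]) measurable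
  have P3: "complex_of_real (LINT s|lebesgue_on {0..t}. LINT x|TX. (1 + \<epsilon> * zeta 0 s x) * zeta 3 s x * px \<phi> s x) = (LINT n|C. LINT s|lborel. b3 n s)"
    by (rule tp3(3)[OF _ ae3]) measurable
  have P2: "complex_of_real (LINT s|lebesgue_on {0..t}. LINT x|TX. (1 + \<epsilon> * zeta 0 s x) ^ 3 * zeta 2 s x * px (px \<phi>) s x) = (LINT n|C. LINT s|lborel. b2 n s)"
    by (rule tp2(3)[OF _ ae2]) measurable
  \<comment> \<open>Each spatial derivative of \<phi> becomes a factor -i n on its coefficient. A
    single one reverses the sign of the first two fluxes and the two in the last term square it
    away, which is the combination in \<open>flux_symbol\<close>.\<close>
  have mode: "sol t n * c n t - zh n * c n 0 - A n = - (LINT s|lborel. b1 n s) + of_real \<beta> * (LINT s|lborel. b3 n s) + of_real m * (LINT s|lborel. b2 n s)" for n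
  proof -
    have "sol t n * c n t - zh n * c n 0 - A n = (LINT s|lborel. indicator {0..t} s *\<^sub>R ((- of_real (L n) * sol s n + N (sol s) n) * c n s))"
      unfolding A_def
      by (subst sol_mode[OF t, of "c n" "\<lambda>s. tcoef (pt \<phi> s) n"])
        (auto simp: c_def[abs_def] intro!: tcoef_time_derivative sm tcoef_continuous smt)
    also have "\<dots> = (LINT s|lborel. - b1 n s + of_real \<beta> * b3 n s + of_real m * b2 n s)"
    proof (intro LINT_cong refl)
      fix s
      have f: "- of_real (L n) * sol s n + N (sol s) n = \<i> * of_int n * v1 s n - of_real \<beta> * (\<i> * of_int n * v3 s n) + of_real m * ((\<i> * of_int n) ^ 2 * v2 s n)"
        by (rule flux_symbol[symmetric]) (auto simp: v1_def[abs_def] v2_def[abs_def] v3_def[abs_def])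
      show "indicator {0..t} s *\<^sub>R ((- of_real (L n) * sol s n + N (sol s) n) * c n s) = - b1 n s + of_real \<beta> * b3 n s + of_real m * b2 n s"
        unfolding f b1_def b2_def b3_def tpx[OF tf1] tpx[OF \<phi>] c_def[symmetric]
        by (simp add: algebra_simps power2_eq_square)
    qed
    also have "\<dots> = - (LINT s|lborel. b1 n s) + of_real \<beta> * (LINT s|lborel. b3 n s) + of_real m * (LINT s|lborel. b2 n s)"
      using tp1(1)[of n] tp3(1)[of n] tp2(1)[of n] by simp
    finally show ?thesis .
  qed
  have "complex_of_real ((LINT x|TX. zeta 0 t x * \<phi> t x) - (LINT x|TX. z0 x * \<phi> 0 x)
           - (LINT s|lebesgue_on {0..t}. LINT x|TX. zeta 0 s x * pt \<phi> s x))
     = (LINT n|C. sol t n * c n t - zh n * c n 0 - A n)"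
    unfolding of_real_diff T1 T2 P0
    using ic[OF integrable_sol[of t] t] ic[OF integrable_sol[of 0] order_refl] tp0(2) by (simp add: sol_initial)
  also have "\<dots> = - (LINT n|C. LINT s|lborel. b1 n s) + of_real \<beta> * (LINT n|C. LINT s|lborel. b3 n s) + of_real m * (LINT n|C. LINT s|lborel. b2 n s)"
    unfolding mode using tp1(2) tp3(2) tp2(2) by simp
  finally show ?thesis
    unfolding P1[symmetric] P2[symmetric] P3[symmetric] pxx
    by (simp only: of_real_minus[symmetric] of_real_mult[symmetric] of_real_add[symmetric] of_real_eq_iff)
qed

text \<open>At almost every time the first three derivatives are classical, so the integral
  condition on the third is the fundamental theorem of calculus, and \<open>Bd\<close> is the common
  integrable bound.\<close>

lemma weak_solution_zeta:
  assumes z0: "integrable TX z0" "\<And>n. fourier_coeff z0 n = zh n"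
    and par: "\<beta> = sqrt \<mu> / bo" "m = \<mu> / 3"
  shows "weak_solution \<epsilon> \<mu> bo z0 T (zeta 0)"
proof -
  have cont: "continuous_on A (zeta 0 t)" for A t
  proof -
    have "continuous_on UNIV (zeta 0 t)" unfolding zeta_0[abs_def] by (intro continuous_intros fser_continuous integrable_sol)
    then show ?thesis by (rule continuous_on_subset) simp
  qed
  have bd: "\<bar>zeta 0 t x\<bar> \<le> 2 * z" for t x
  proof -
    have "cmod (fser (sol t) x) \<le> 2 * z" using z(1) by (intro fser_bound wnorm_sol) simp
    then show ?thesis by (simp add: fser_sol)
  qed
  have per: "tperiodic (zeta 0 t)" for t by (simp add: tperiodic_def zeta_0 fser_periodic)
  have fin: "AE t in lebesgue_on {0..T}. H t (sol t) < \<infinity>"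
    by (rule AE_lebesgue_on) (rule good_AE_finite[OF good_sol])
  have reg: "AE t in lebesgue_on {0..T}.
           (\<forall>x. (zeta 0 t has_real_derivative zeta 1 t x) (at x)) \<and>
           (\<forall>x. (zeta 1 t has_real_derivative zeta 2 t x) (at x)) \<and>
           (\<forall>x\<ge>0. (zeta 3 t has_integral (zeta 2 t x - zeta 2 t 0)) {0..x}) \<and>
           (\<forall>x. \<bar>zeta 0 t x\<bar> \<le> Bd t \<and> \<bar>zeta 1 t x\<bar> \<le> Bd t \<and> \<bar>zeta 2 t x\<bar> \<le> Bd t) \<and>
           (AE x in lebesgue. \<bar>zeta 3 t x\<bar> \<le> Bd t)"
    using fin
  proof eventually_elim
    case f: (elim t)
    have d1: "(zeta 0 t has_real_derivative zeta 1 t x) (at x)" for x using zeta_DERIV[OF f, of 0 x] by simp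
    have d2: "(zeta 1 t has_real_derivative zeta 2 t x) (at x)" for x
      by (rule zeta_DERIV[OF f, of 1 x, unfolded Suc_1]) simp
    have d3: "(zeta 2 t has_real_derivative zeta 3 t x) (at x)" for x using zeta_DERIV[OF f, of 2 x] by simp
    have "(zeta 3 t has_integral (zeta 2 t x - zeta 2 t 0)) {0..x}" if "0 \<le> x" for x
    proof (rule fundamental_theorem_of_calculus[OF that])
      show "(zeta 2 t has_vector_derivative zeta 3 t y) (at y within {0..x})" for y
        by (rule has_vector_derivative_at_within) (use d3[of y] in \<open>simp add: has_real_derivative_iff_has_vector_derivative\<close>)
    qed
    then show ?case
      by (intro conjI allI impI AE_I2 d1 d2 zeta_le_Bd[OF f]) simp_all
  qed
  show ?thesis
    unfolding weak_solution_def par[symmetric]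
  proof (intro conjI)
    show "\<forall>t. tperiodic (zeta 0 t)" using per by blast
    show "\<forall>t\<in>{0..T}. integrable (lebesgue_on TT) (zeta 0 t)" by (intro ballI continuous_imp_integrable_real cont)
    show "\<exists>M. AE t in lebesgue_on {0..T}. \<forall>x. \<bar>zeta 0 t x\<bar> \<le> M" using bd by (intro exI[of _ "2 * z"] AE_I2) simp
  qed (intro exI[of _ "zeta 1"] exI[of _ "zeta 2"] exI[of _ "zeta 3"] exI[of _ Bd] conjI zeta_measurable Bd_integrable reg
      allI impI ballI weak_identity z0; simp)+
qed

end

theorem theorem6p12:
  fixes \<epsilon> \<mu> bo :: real and z0 :: "real \<Rightarrow> real"
  assumes "0 < \<epsilon>" and "\<epsilon> \<le> 1" and "0 < bo" and "0 < \<mu>" and "\<mu> < 1"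
    and "sqrt \<mu> / bo - \<mu> / 3 > 0"
    and "tperiodic z0" and "integrable (lebesgue_on {0..2*pi}) z0"
    and "fourier_coeff z0 0 = 0"
    and "anorm 0 0 z0 < \<infinity>"
    and "anorm 0 0 z0 < ennreal ((sqrt \<mu> / bo - \<mu> / 3) /
                   (128 * \<epsilon> * (sqrt \<mu> / bo + 55 / 6 * \<mu> + 1)))"
  shows "\<exists>\<zeta>. \<forall>T>0. weak_solution \<epsilon> \<mu> bo z0 T \<zeta> \<and>
           (\<forall>\<nu>. 0 \<le> \<nu> \<and> \<nu> < (sqrt \<mu> / bo - \<mu> / 3) / 2 \<longrightarrow>
              (SUP t\<in>{0..T}. anorm 0 (\<nu> * t) (\<zeta> t)) < \<infinity> \<and>
              (\<integral>\<^sup>+ t\<in>{0..T}. anorm 4 (\<nu> * t) (\<zeta> t) \<partial>lebesgue) < \<infinity> \<and>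
              (\<forall>t\<in>{0..T}.
                 anorm 0 (\<nu> * t) (\<zeta> t)
                   + ennreal ((sqrt \<mu> / bo - \<mu> / 3) / 64) *
                     (\<integral>\<^sup>+ s\<in>{0..t}. anorm 4 (\<nu> * s) (\<zeta> s) \<partial>lebesgue)
                   \<le> anorm 0 0 z0 \<and>
                 anorm 0 (\<nu> * t) (\<zeta> t)
                   \<le> anorm 0 0 z0 * ennreal (exp (- (t / 64) * (sqrt \<mu> / bo - \<mu> / 3)))))"
proof -
  define \<beta> m \<delta> z where "\<beta> = sqrt \<mu> / bo" and "m = \<mu> / 3" and "\<delta> = sqrt \<mu> / bo - \<mu> / 3" and "z = enn2real (anorm 0 0 z0)"
  have hz: "anorm 0 0 z0 = ennreal z" "0 \<le> z" using assms(10) by (simp_all add: z_def)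
  define K where "K = sqrt \<mu> / bo + 55 / 6 * \<mu> + 1"
  have K0: "0 < K" unfolding K_def using assms(3,4) by (intro add_pos_pos) auto
  have "z < \<delta> / (128 * \<epsilon> * K)"
    using assms(11) hz(2) unfolding hz(1) \<delta>_def[symmetric] K_def[symmetric] by (simp add: ennreal_less_iff)
  then have "z * (128 * \<epsilon> * K) < \<delta>" using K0 assms(1) by (simp add: pos_less_divide_eq)
  then have small: "\<epsilon> * z * K \<le> \<delta> / 128" by (simp add: mult_ac)
  \<comment> \<open>With m = \<mu>/3, the term 55/6 \<mu> of the smallness condition reads 55/2
    m.\<close>
  have K: "K = 1 + \<beta> + 55 / 2 * m" by (simp add: K_def \<beta>_def m_def)
  interpret thin_film \<epsilon> \<beta> m \<delta> z "fourier_coeff z0"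
  proof
    show "l1norm (fourier_coeff z0) = ennreal z" using hz(1) by (simp add: anorm_eq_wnorm)
    show "\<epsilon> * z * (1 + \<beta> + 55 / 2 * m) \<le> \<delta> / 128" using small unfolding K .
    show "0 \<le> \<beta>" "0 \<le> m" using assms(3,4) by (simp_all add: \<beta>_def m_def)
    show "0 < \<delta>" using assms(6) by (simp add: \<delta>_def)
    show "\<delta> = \<beta> - m" by (simp add: \<delta>_def \<beta>_def m_def)
  qed (use assms hz(2) fourier_coeff_cnj in auto)
  show ?thesis
    unfolding \<delta>_def[symmetric]
  \<comment> \<open>The witness is chosen before T and \<nu>: the construction runs on the whole
    half-line and with the limiting rate \<delta>/2.\<close>
  proof (intro exI[of _ "zeta 0"] allI impI conjI)
    fix T :: real assume T: "0 < T"
    show "weak_solution \<epsilon> \<mu> bo z0 T (zeta 0)"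
      by (rule weak_solution_zeta) (use assms(8) in \<open>simp_all add: \<beta>_def m_def\<close>)
    fix \<nu> assume "0 \<le> \<nu> \<and> \<nu> < \<delta> / 2"
    then have \<nu>: "\<nu> \<le> \<delta> / 2" by simp
    have a: "anorm 0 (\<nu> * t) (zeta 0 t) \<le> ennreal z" if "0 \<le> t" for t
      by (rule order_trans[OF _ sol_analytic(1)[OF that \<nu>]]) simp
    have "(SUP t\<in>{0..T}. anorm 0 (\<nu> * t) (zeta 0 t)) \<le> ennreal z"
      by (rule SUP_least) (simp add: a)
    then show "(SUP t\<in>{0..T}. anorm 0 (\<nu> * t) (zeta 0 t)) < \<infinity>" by (rule order_le_less_trans) simp
    show "(\<integral>\<^sup>+ t\<in>{0..T}. anorm 4 (\<nu> * t) (zeta 0 t) \<partial>lebesgue) < \<infinity>"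
      using T by (intro sol_analytic(3) \<nu>) simp
    show "\<forall>t\<in>{0..T}. anorm 0 (\<nu> * t) (zeta 0 t) + ennreal (\<delta> / 64) * (\<integral>\<^sup>+ s\<in>{0..t}. anorm 4 (\<nu> * s) (zeta 0 s) \<partial>lebesgue) \<le> anorm 0 0 z0 \<and>
       anorm 0 (\<nu> * t) (zeta 0 t) \<le> anorm 0 0 z0 * ennreal (exp (- (t / 64) * \<delta>))"
      using sol_analytic(1,2)[OF _ \<nu>] by (simp add: hz(1))
  qed
qed

end
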